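(* There exist absolute constants $C_1,C_2,C_3>0$ such that the following holds for every $m\ge2$ and $\epsilon\in(0,1)$. There are an exponent $\alpha=\alpha(m,\epsilon)$ and a learning algorithm which, for every $n$ and every product distribution $\mathcal{D}=\times_{j=1}^n\mathcal{D}_j$ on weight matrices satisfying the small items assumption for the MaxMin objective with $\zeta=C_1\frac{\log m}{\epsilon^2}$, draws at most $C_2\cdot\frac{m}{\log m}\cdot\log\frac{m}{\epsilon}$ independent instances from $\mathcal{D}$ and outputs, with high probability, a vector $\mathbf{w}\in\mathbb{R}_{>0}^m$ such that $$\mathbb{E}_{P\sim\mathcal{D}}\Big[\min_{i\in[m]}\ell_i(P,\alpha,\mathbf{w})\Big]\ \ge\ (1-C_3\epsilon)\cdot T,\qquad T=\mathbb{E}_{P\sim\mathcal{D}}[\ell^{\mathrm{SNT}}(P)].$$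
   Context: There are $m$ agents and $n$ divisible items; an instance is a weight matrix $P=(p_{i,j})\in\mathbb{R}_{>0}^{m\times n}$. The $j$th column of $P$ is drawn independently from a discrete distribution $\mathcal{D}_j$ on $\mathbb{R}_{>0}^m$, so $P\sim\mathcal{D}=\times_j\mathcal{D}_j$. The learning algorithm has access to $\mathcal{D}$ only through independent samples $P\sim\mathcal{D}$. A feasible allocation is $X=(x_{i,j})\in[0,1]^{m\times n}$ with $\sum_i x_{i,j}=1$ for each $j$; loads are $\ell_i(P,X)=\sum_j p_{i,j}x_{i,j}$, and $\ell^{\mathrm{SNT}}(P)=\max_X\min_i\ell_i(P,X)$ is the optimal MaxMin value. For $\alpha\in\mathbb{R}$ and $\mathbf{w}\in\mathbb{R}_{>0}^m$, $\ell_i(P,\alpha,\mathbf{w})$ is the load of agent $i$ under the (exponentiated) proportional allocation $x_{i,j}=p_{i,j}^\alpha w_i/\sum_{i'}p_{i',j}^\alpha w_{i'}$, where the exponent $\alpha$ is fixed in advance. Small items assumption with parameter $\zeta$ (for MaxMin): with $T=\mathbb{E}_{P\sim\mathcal{D}}[\ell^{\mathrm{SNT}}(P)]$, every $P$ in the support of $\mathcal{D}$ satisfies $p_{i,j}\le T/\zeta$ for all $i\in[m],j\in[n]$. "With high probability" means with probability at least $1-1/m$ over the drawn samples (and any internal randomness). *)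

theory Defs
  imports "HOL-Probability.Probability"
begin

text \<open>
  Agents are \<open>i < m\<close> and items are \<open>j < n\<close>.  A weight matrix is stored by columns, because the
  columns are what is drawn independently: \<open>P j\<close> is the \<open>j\<close>-th column, and \<open>P j i\<close> stands for
  \<open>p\<^sub>i\<^sub>,\<^sub>j\<close>.  Allocations are indexed in the same order.
\<close>

type_synonym column = "nat \<Rightarrow> real"
type_synonym matrix = "nat \<Rightarrow> column"

definition feasible :: "nat \<Rightarrow> nat \<Rightarrow> matrix \<Rightarrow> bool" where
  "feasible m n X \<longleftrightarrow>
     (\<forall>j<n. \<forall>i<m. X j i \<in> {0..1}) \<and> (\<forall>j<n. (\<Sum>i<m. X j i) = 1)"

definition load :: "nat \<Rightarrow> matrix \<Rightarrow> matrix \<Rightarrow> nat \<Rightarrow> real" where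
  "load n P X i = (\<Sum>j<n. P j i * X j i)"

definition min_load :: "nat \<Rightarrow> nat \<Rightarrow> matrix \<Rightarrow> matrix \<Rightarrow> real" where
  "min_load m n P X = Min ((\<lambda>i. load n P X i) ` {..<m})"

definition opt_snt :: "nat \<Rightarrow> nat \<Rightarrow> matrix \<Rightarrow> real" where
  "opt_snt m n P = (SUP X\<in>{X. feasible m n X}. min_load m n P X)"

definition prop_alloc :: "nat \<Rightarrow> real \<Rightarrow> (nat \<Rightarrow> real) \<Rightarrow> matrix \<Rightarrow> matrix" where
  "prop_alloc m \<alpha> w P = (\<lambda>j i. P j i powr \<alpha> * w i / (\<Sum>i'<m. P j i' powr \<alpha> * w i'))"

text \<open>The supremum in \<open>opt_snt\<close> is attained.\<close>

lemma opt_snt_attained: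
  assumes "m > 0"
  shows "\<exists>X. feasible m n X \<and> opt_snt m n P = min_load m n P X
           \<and> (\<forall>Y. feasible m n Y \<longrightarrow> min_load m n P Y \<le> min_load m n P X)"
proof -
  define B :: "matrix set" where "B = {X. \<forall>j. X j \<in> {x. \<forall>i. x i \<in> {0..1}}}"
  have c1: "compact {x::column. \<forall>i. x i \<in> {0..1}}"
    using compactin_PiE[where X = "\<lambda>_::nat. euclidean :: real topology" and I = UNIV
        and S = "\<lambda>_. {0..1}"]
    by (simp add: euclidean_product_topology PiE_UNIV_domain Pi_def)
  have "compact B"
    using compactin_PiE[where X = "\<lambda>_::nat. euclidean :: column topology" and I = UNIV
        and S = "\<lambda>_. {x. \<forall>i. x i \<in> {0..1}}"] c1
    by (simp add: B_def euclidean_product_topology PiE_UNIV_domain Pi_def)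
  have ent: "continuous_on UNIV (\<lambda>X::matrix. X j i)" for i j
    by (intro continuous_on_product_then_coordinatewise[OF continuous_on_product_coordinates])
  have "closed (\<Inter>j\<in>{..<n}. {X::matrix. (\<Sum>i<m. X j i) = 1})"
    by (intro closed_INT ballI closed_Collect_eq continuous_on_sum ent continuous_on_const)
  then have comp: "compact (B \<inter> (\<Inter>j\<in>{..<n}. {X::matrix. (\<Sum>i<m. X j i) = 1}))" (is "compact ?K")
    using \<open>compact B\<close> by (rule compact_Int_closed[rotated])
  have cmin: "continuous_on UNIV (\<lambda>X. Min ((\<lambda>i. load n P X i) ` {..<Suc k}))" for k
  proof (induction k)
    case 0
    show ?case unfolding load_def
      by (simp add: lessThan_Suc) (intro continuous_on_sum continuous_on_mult ent continuous_on_const)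
  next
    case (Suc k)
    have eq: "(\<lambda>X. Min ((\<lambda>i. load n P X i) ` {..<Suc (Suc k)}))
        = (\<lambda>X. min (load n P X (Suc k)) (Min ((\<lambda>i. load n P X i) ` {..<Suc k})))"
      by (rule ext, subst lessThan_Suc, unfold image_insert, rule Min_insert) auto
    have "continuous_on UNIV (\<lambda>X. load n P X (Suc k))" unfolding load_def
      by (intro continuous_on_sum continuous_on_mult ent continuous_on_const)
    then show ?case unfolding eq by (intro continuous_on_min Suc.IH)
  qed
  have cont: "continuous_on ?K (min_load m n P)"
    using cmin[of "m - 1"] assms continuous_on_subset unfolding min_load_def by fastforce
  have "(\<lambda>j i. if i = 0 then 1 else 0) \<in> ?K"
    using assms by (auto simp: B_def sum.delta)
  then obtain X where X: "X \<in> ?K" "\<forall>Y\<in>?K. min_load m n P Y \<le> min_load m n P X"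
    using continuous_attains_sup[OF comp _ cont] by blast
  have fX: "feasible m n X" using X(1) by (auto simp: feasible_def B_def)
  have max: "min_load m n P Y \<le> min_load m n P X" if "feasible m n Y" for Y
  proof -
    define Z where "Z = (\<lambda>j i. if j < n \<and> i < m then Y j i else 0)"
    have "Z \<in> ?K" using that by (auto simp: Z_def B_def feasible_def)
    moreover have "min_load m n P Z = min_load m n P Y"
      unfolding min_load_def load_def Z_def
      by (intro arg_cong[where f = Min] image_cong refl sum.cong) auto
    ultimately show ?thesis using X(2) by metis
  qed
  have "opt_snt m n P = min_load m n P X"
    unfolding opt_snt_def by (rule cSup_eq_maximum) (use fX max in auto)
  with fX max show ?thesis by blast
qed

text \<open>The product distribution \<open>\<D>\<close>; entries outside the index range are \<open>undefined\<close>.\<close>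

definition product_dist :: "nat \<Rightarrow> (nat \<Rightarrow> column pmf) \<Rightarrow> matrix pmf" where
  "product_dist n D = Pi_pmf {..<n} undefined D"

definition positive_columns :: "nat \<Rightarrow> nat \<Rightarrow> (nat \<Rightarrow> column pmf) \<Rightarrow> bool" where
  "positive_columns m n D \<longleftrightarrow> (\<forall>j<n. set_pmf (D j) \<subseteq> {..<m} \<rightarrow>\<^sub>E {0<..})"

definition expected_opt :: "nat \<Rightarrow> nat \<Rightarrow> (nat \<Rightarrow> column pmf) \<Rightarrow> real" where
  "expected_opt m n D = measure_pmf.expectation (product_dist n D) (\<lambda>P. opt_snt m n P)"

text \<open>
  If \<open>opt_snt\<close> is not integrable, then \<open>expected_opt\<close> is \<open>0\<close>; for positive weights and
  \<open>\<zeta> > 0\<close> the assumption below then fails, so it forces \<open>T\<close> to be a genuine expectation.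
\<close>

definition small_items :: "nat \<Rightarrow> nat \<Rightarrow> (nat \<Rightarrow> column pmf) \<Rightarrow> real \<Rightarrow> bool" where
  "small_items m n D \<zeta> \<longleftrightarrow>
     (\<forall>P\<in>set_pmf (product_dist n D). \<forall>i<m. \<forall>j<n. P j i \<le> expected_opt m n D / \<zeta>)"

text \<open>
  A (possibly randomised) learning algorithm for fixed \<open>m\<close> and \<open>\<epsilon>\<close> maps the number of items, which
  is visible in any drawn matrix, and the list of drawn matrices to a distribution over outputs.
  It draws \<open>N\<close> instances; one that stops earlier is covered, since it may ignore the later ones.
\<close>

type_synonym learner = "nat \<Rightarrow> matrix list \<Rightarrow> (nat \<Rightarrow> real) pmf"

definition learner_output :: "nat \<Rightarrow> (nat \<Rightarrow> column pmf) \<Rightarrow> nat \<Rightarrow> learner \<Rightarrow> (nat \<Rightarrow> real) pmf" where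
  "learner_output n D N A = bind_pmf (replicate_pmf N (product_dist n D)) (A n)"

end

theory Submission
  imports Defs
begin

text \<open>
  The load contributions of the sampled items are rounded to integers, so that each agent has an
  integer level, which grows with its own weight and falls with the weights of the others.  The
  learner draws a random threshold for each agent and takes the least weights, in a geometric grid,
  for which every agent reaches its threshold.  The threshold scale is the smallest optimum of \<open>m + 3\<close>
  further samples.  That the thresholds can be met follows from the fact that proportional shares with
  a large exponent nearly maximise the total value at prices given by the weights.

  The range of the weights grows with the number of items, so no union bound over weights is possible
  with a number of samples that does not depend on it.  Instead, the sample \<open>S\<close> is compared with a ghost
  sample \<open>S'\<close>.  If one agent at a time switches from its level in \<open>S\<close> to its level in \<open>S\<close> and \<open>S'\<close>
  together, then the other agents follow along a monotone curve, and thresholds for \<open>S\<close> inject into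
  thresholds for the sum with the same solution.  So the random solution for \<open>S\<close> is dominated by the one
  for the sum, at the cost of a factor \<open>O(1 / \<epsilon>)\<close> per agent.  The latter is invariant under exchanging
  items between \<open>S\<close> and \<open>S'\<close>, hence its levels in \<open>S\<close> and \<open>S'\<close> differ by a sum with
  random signs.  The small items assumption makes a relative deviation \<open>\<epsilon>\<close> so
  unlikely that it beats the factor \<open>O(1 / \<epsilon>)\<close> to the power \<open>m\<close>.
\<close>

section \<open>Least solutions of threshold systems\<close>

text \<open>The comparison with the ghost sample is a matter of counting, which is why loads are
  rounded: thresholds form finite boxes of integers, and a total weight \<open>(4 * hi) ^ m\<close>
  for both samples together is set against the \<open>(hi - lo) ^ m\<close> thresholds that the
  learner can draw. Thresholds below \<open>lo\<close> would permit small loads, so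
  \<open>hi - lo\<close> is only of order \<epsilon> * \<open>hi\<close>; this gives 8 / \<epsilon>
  per agent. The thresholds have to be random, because the injection preserves their number and says
  nothing about a single one.

  Against this stands a signed sum of items of size at most b at a total load of order N * T. It
  deviates by a relative \<epsilon> with probability exponentially small in \<epsilon>^2 * N * T /
  b, and the small items assumption makes the exponent a multiple of N * ln m. The number of samples
  is thus dictated by N * ln m >= m * ln (m / \<epsilon>), and the constant 1152 makes the multiple
  equal to 8.

  The exponent is \<alpha> = m / \<epsilon>, since each of the m agents may cost a fraction 1 /
  \<alpha> compared with the best one.\<close>

text \<open>
  An exponent vector \<open>q\<close> stands for the weights \<open>\<rho> ^ q i\<close>.  The level of an agent depends only
  on the ratios of the weights, and it grows when the weight of the agent grows relative to all others.
\<close>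

definition others_antitone ::
  "nat \<Rightarrow> nat \<Rightarrow>
   ((nat \<Rightarrow> nat) \<Rightarrow> nat) \<Rightarrow> bool" where
  "others_antitone m i h \<longleftrightarrow> (\<forall>q q'. q' i = q i \<longrightarrow> (\<forall>k<m. q' k \<le> q k) \<longrightarrow> h q \<le> h q')"

definition substitutes ::
  "nat \<Rightarrow> nat \<Rightarrow>
   ((nat \<Rightarrow> nat) \<Rightarrow> nat) \<Rightarrow> bool" where
  "substitutes m i h \<longleftrightarrow>
     (\<forall>q q'. (\<forall>k<m. int (q' k) - int (q' i) \<le> int (q k) - int (q i)) \<longrightarrow> h q \<le> h q')"

text \<open>The alternative \<open>q i = K\<close> makes the constant vector \<open>K\<close> a
  solution whatever the thresholds are, so a least solution always exists.\<close>

definition solutions ::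
  "nat \<Rightarrow> nat \<Rightarrow> (nat \<Rightarrow> (nat \<Rightarrow> nat) \<Rightarrow> nat) \<Rightarrow>
   (nat \<Rightarrow> nat) \<Rightarrow> (nat \<Rightarrow> nat) set" where
  "solutions m K H \<tau> = {q. (\<forall>i<m. q i \<le> K \<and> (q i = K \<or> \<tau> i \<le> H i q)) \<and> (\<forall>i\<ge>m. q i = 0)}"

definition least_solution ::
  "nat \<Rightarrow> nat \<Rightarrow> (nat \<Rightarrow> (nat \<Rightarrow> nat) \<Rightarrow> nat) \<Rightarrow>
   (nat \<Rightarrow> nat) \<Rightarrow> nat \<Rightarrow> nat" where
  "least_solution m K H \<tau> = (\<lambda>i. LEAST v. \<exists>q\<in>solutions m K H \<tau>. q i = v)"

lemma substitutes_others_antitone: "substitutes m i h \<Longrightarrow> others_antitone m i h"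
  unfolding substitutes_def others_antitone_def by fastforce

lemma substitutes_add: "substitutes m i g \<Longrightarrow> substitutes m i h \<Longrightarrow> substitutes m i (\<lambda>q. g q + h q)"
  unfolding substitutes_def by (meson add_mono)

lemma least_solution_le: "q \<in> solutions m K H \<tau> \<Longrightarrow> least_solution m K H \<tau> i \<le> q i"
  unfolding least_solution_def by (rule Least_le) blast

lemma solutions_level: "q \<in> solutions m K H \<tau> \<Longrightarrow> i < m \<Longrightarrow> q i = K \<or> \<tau> i \<le> H i q"
  by (simp add: solutions_def)

lemma solutions_bounds:
  assumes "q \<in> solutions m K H \<tau>"
  shows "i < m \<Longrightarrow> q i \<le> K" "i \<ge> m \<Longrightarrow> q i = 0"
  using assms by (simp_all add: solutions_def)

text \<open>For each \<open>i\<close> some solution attains the least exponent at \<open>i\<close>.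
  Lowering all its other exponents to their least values can only raise the level of
  \<open>i\<close>, so the vector of all least exponents is again a solution.\<close>

lemma least_solution_solutions:
  assumes "\<And>i. i < m \<Longrightarrow> others_antitone m i (H i)"
  shows "least_solution m K H \<tau> \<in> solutions m K H \<tau>"
proof -
  let ?l = "least_solution m K H \<tau>"
  have "(\<lambda>i. if i < m then K else 0) \<in> solutions m K H \<tau>" by (auto simp: solutions_def)
  then have "\<exists>q\<in>solutions m K H \<tau>. q i = ?l i" for i
    using LeastI_ex[of "\<lambda>v. \<exists>q\<in>solutions m K H \<tau>. q i = v"] unfolding least_solution_def by blast
  then obtain w where w: "w i \<in> solutions m K H \<tau>" "w i i = ?l i" for i by metis
  have "?l i = K \<or> \<tau> i \<le> H i ?l" if "i < m" for i
  proof -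
    have "H i (w i) \<le> H i ?l"
      using assms[OF that] w(2) least_solution_le[OF w(1)] unfolding others_antitone_def by simp
    with solutions_level[OF w(1) that, of i] w(2)[of i] show ?thesis by auto
  qed
  moreover have "?l i \<le> K" if "i < m" for i using solutions_bounds(1)[OF w(1) that] w(2) by metis
  moreover have "?l i = 0" if "i \<ge> m" for i using solutions_bounds(2)[OF w(1) that] w(2) by metis
  ultimately show ?thesis by (auto simp: solutions_def)
qed

text \<open>
  Taking the exponent of agent \<open>r\<close> itself as its level forces the \<open>r\<close>-th exponent of the least
  solution to be \<open>v\<close>; as \<open>v\<close> varies, the solutions trace a curve.
\<close>

definition curve ::
  "nat \<Rightarrow> nat \<Rightarrow> (nat \<Rightarrow> (nat \<Rightarrow> nat) \<Rightarrow> nat) \<Rightarrow>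
   (nat \<Rightarrow> nat) \<Rightarrow> nat \<Rightarrow> nat \<Rightarrow> nat \<Rightarrow> nat" where
  "curve m K H \<tau> r v = least_solution m K (H(r := (\<lambda>q. q r))) (\<tau>(r := v))"

context
  fixes m K r :: nat and H :: "nat \<Rightarrow> (nat \<Rightarrow> nat) \<Rightarrow> nat" and \<tau> :: "nat \<Rightarrow> nat"
  assumes r: "r < m" and substitutes: "\<And>i. i < m \<Longrightarrow> i \<noteq> r \<Longrightarrow> substitutes m i (H i)"
begin

lemma curve_solutions: "curve m K H \<tau> r v \<in> solutions m K (H(r := (\<lambda>q. q r))) (\<tau>(r := v))"
  unfolding curve_def
proof (rule least_solution_solutions)
  fix i assume "i < m"
  then show "others_antitone m i ((H(r := (\<lambda>q. q r))) i)"
    using substitutes_others_antitone[OF substitutes] by (auto simp: others_antitone_def)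
qed

text \<open>The threshold only forces the exponent of \<open>r\<close> to be at least
  \<open>v\<close>. Lowering it to exactly \<open>v\<close> raises the levels of all others, hence
  keeps a solution, and minimality does the rest.\<close>

lemma curve_r: "v \<le> K \<Longrightarrow> curve m K H \<tau> r v r = v"
proof -
  assume v: "v \<le> K"
  let ?c = "curve m K H \<tau> r v"
  have c: "?c \<in> solutions m K (H(r := (\<lambda>q. q r))) (\<tau>(r := v))" by (rule curve_solutions)
  then have ge: "v \<le> ?c r" using r v by (force simp: solutions_def)
  have "(?c(r := v)) i = K \<or> (\<tau>(r := v)) i \<le> (H(r := (\<lambda>q. q r))) i (?c(r := v))"
    if "i < m" for i
  proof (cases "i = r")
    case False
    have "H i ?c \<le> H i (?c(r := v))"
      using substitutes_others_antitone[OF substitutes[OF that False]] False ge by (auto simp: others_antitone_def)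
    with solutions_level[OF c that] False show ?thesis by (auto intro: le_trans)
  qed simp
  then have "?c(r := v) \<in> solutions m K (H(r := (\<lambda>q. q r))) (\<tau>(r := v))"
    using solutions_bounds[OF c] v r unfolding solutions_def by auto
  from least_solution_le[OF this, of r] ge show ?thesis by (simp add: curve_def)
qed

lemma curve_mono: "v \<le> v' \<Longrightarrow> v' \<le> K \<Longrightarrow> curve m K H \<tau> r v i \<le> curve m K H \<tau> r v' i"
proof -
  assume v: "v \<le> v'" "v' \<le> K"
  let ?c = "curve m K H \<tau> r v'"
  have c: "?c \<in> solutions m K (H(r := (\<lambda>q. q r))) (\<tau>(r := v'))" by (rule curve_solutions)
  have "?c i = K \<or> (\<tau>(r := v)) i \<le> (H(r := (\<lambda>q. q r))) i ?c" if "i < m" for i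
    using solutions_level[OF c that] v by (cases "i = r") auto
  then have "?c \<in> solutions m K (H(r := (\<lambda>q. q r))) (\<tau>(r := v))"
    using solutions_bounds[OF c] unfolding solutions_def by blast
  then show ?thesis unfolding curve_def[of _ _ _ _ _ v] by (rule least_solution_le)
qed

text \<open>Shifting every exponent by \<open>v' - v\<close> preserves all ratios and so all levels.
  Capping at \<open>K\<close> only lowers the competitors of an agent that stays below the cap. The
  shifted vector therefore solves the system for \<open>v'\<close> and bounds its least
  solution.\<close>

lemma curve_ratio:
  assumes "v \<le> v'" "v' \<le> K" "i < m"
  shows "curve m K H \<tau> r v' i \<le> curve m K H \<tau> r v i + (v' - v)"
proof -
  let ?c = "curve m K H \<tau> r v"
  define z where "z = (\<lambda>i. if i < m then min K (?c i + (v' - v)) else 0)"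
  have c: "?c \<in> solutions m K (H(r := (\<lambda>q. q r))) (\<tau>(r := v))" by (rule curve_solutions)
  have cr: "?c r = v" using assms curve_r by simp
  have "z k = K \<or> \<tau> k \<le> H k z" if k: "k < m" "k \<noteq> r" for k
  proof (cases "?c k + (v' - v) < K")
    case True
    have "H k ?c \<le> H k z"
    proof -
      have "int (z i) - int (z k) \<le> int (?c i) - int (?c k)" if "i < m" for i
        using that k True by (simp add: z_def)
      then show ?thesis using substitutes[OF k] unfolding substitutes_def by blast
    qed
    moreover have "?c k = K \<or> \<tau> k \<le> H k ?c" using solutions_level[OF c k(1)] k by simp
    ultimately show ?thesis using True by auto
  qed (use k in \<open>auto simp: z_def\<close>)
  then have "z \<in> solutions m K (H(r := (\<lambda>q. q r))) (\<tau>(r := v'))"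
    using r cr assms by (auto simp: solutions_def z_def)
  from least_solution_le[OF this, of i] assms show ?thesis by (simp add: curve_def z_def)
qed

text \<open>Along the curve the exponent of \<open>r\<close> grows by exactly \<open>v' - v\<close>
  and every other one by at most that, so \<open>r\<close> gains weight relative to
  everybody.\<close>

lemma curve_level_mono:
  assumes "substitutes m r G" "v \<le> v'" "v' \<le> K"
  shows "G (curve m K H \<tau> r v) \<le> G (curve m K H \<tau> r v')"
proof -
  have "int (curve m K H \<tau> r v' k) - int (curve m K H \<tau> r v' r)
      \<le> int (curve m K H \<tau> r v k) - int (curve m K H \<tau> r v r)" if "k < m" for k
    using curve_ratio[OF assms(2,3) that] curve_r[of v] curve_r[of v'] assms by simp
  with assms(1) show ?thesis unfolding substitutes_def by blast
qed

text \<open>A solution whose exponent at \<open>r\<close> is \<open>u\<close> lies above the curve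
  point \<open>u\<close>, and moving down to that point can only raise \<open>G\<close>. So the
  system reduces to a search for the first sufficient point on a curve that depends neither on
  \<open>G\<close> nor on \<open>t\<close>; this is what makes \<open>G\<close> and
  \<open>G + G'\<close> comparable.\<close>

lemma least_solution_on_curve:
  fixes t :: nat
  assumes G: "substitutes m r G"
  defines "v \<equiv> LEAST v. v = K \<or> t \<le> G (curve m K H \<tau> r v)"
  shows "least_solution m K (H(r := G)) (\<tau>(r := t)) = curve m K H \<tau> r v"
proof
  fix i
  let ?l = "least_solution m K (H(r := G)) (\<tau>(r := t))"
  have l: "?l \<in> solutions m K (H(r := G)) (\<tau>(r := t))"
    using substitutes G by (intro least_solution_solutions) (auto intro: substitutes_others_antitone)
  have vK: "v \<le> K" unfolding v_def by (rule Least_le) simp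
  have v: "v = K \<or> t \<le> G (curve m K H \<tau> r v)"
    unfolding v_def by (rule LeastI[of _ K]) simp
  have "curve m K H \<tau> r v \<in> solutions m K (H(r := G)) (\<tau>(r := t))"
    using curve_solutions[of v] v r curve_r[OF vK] by (auto simp: solutions_def)
  then have 1: "?l i \<le> curve m K H \<tau> r v i" for i by (rule least_solution_le)
  define u where "u = ?l r"
  have uK: "u \<le> K" using l r by (auto simp: u_def solutions_def)
  have "?l \<in> solutions m K (H(r := (\<lambda>q. q r))) (\<tau>(r := u))"
    using l r by (auto simp: solutions_def u_def)
  then have 2: "curve m K H \<tau> r u i \<le> ?l i" for i
    unfolding curve_def by (rule least_solution_le)
  have "G ?l \<le> G (curve m K H \<tau> r u)"
    using substitutes_others_antitone[OF G] 2 curve_r[OF uK] unfolding others_antitone_def u_def by simp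
  then have "u = K \<or> t \<le> G (curve m K H \<tau> r u)"
    using l r by (force simp: solutions_def u_def)
  then have "v \<le> u" unfolding v_def by (rule Least_le)
  from curve_mono[OF this uK, of i] 1[of i] 2[of i]
  show "?l i = curve m K H \<tau> r v i" by simp
qed

text \<open>
  Adding a ghost level \<open>G'\<close> to agent \<open>r\<close> can only spread the solutions out: a threshold \<open>t\<close>
  solved at the point \<open>q\<close> is sent to the threshold \<open>t + G' q\<close>, which is solved there
  for \<open>G + G'\<close>.  All thresholds for which this leaves the range are solved at or
  beyond the solution for the last threshold \<open>L'\<close>.
\<close>

lemma hybrid_step:
  assumes G: "substitutes m r G" "substitutes m r G'"
    and overflow: "\<And>q. G q < L \<Longrightarrow> L' \<le> G q + G' q \<Longrightarrow> q \<in> B"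
  defines "s \<equiv> \<lambda>t. least_solution m K (H(r := G)) (\<tau>(r := t))"
    and "u \<equiv> \<lambda>t. least_solution m K (H(r := (\<lambda>q. G q + G' q))) (\<tau>(r := t))"
  shows "card {t\<in>{1..L}. s t \<in> B}
           \<le> card {t\<in>{1..L'}. u t \<in> B} + (if u L' \<in> B then L else 0)"
proof (cases "u L' \<in> B")
  case True
  have "card {t\<in>{1..L}. s t \<in> B} \<le> card {1..L}" by (intro card_mono) auto
  with True show ?thesis by simp
next
  case False
  let ?c = "curve m K H \<tau> r"
  define vs where "vs = (\<lambda>t. LEAST v. v = K \<or> t \<le> G (?c v))"
  define vu where "vu = (\<lambda>t. LEAST v. v = K \<or> t \<le> G (?c v) + G' (?c v))"
  have s: "s t = ?c (vs t)" for t
    unfolding s_def vs_def by (rule least_solution_on_curve[OF G(1)])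
  have u: "u t = ?c (vu t)" for t
    unfolding u_def vu_def by (rule least_solution_on_curve[OF substitutes_add[OF G]])
  have vsK: "vs t \<le> K" for t unfolding vs_def by (rule Least_le) simp
  have vuK: "vu t \<le> K" for t unfolding vu_def by (rule Least_le) simp
  have vs: "vs t = K \<or> t \<le> G (?c (vs t))" for t unfolding vs_def by (rule LeastI[of _ K]) simp
  have vu: "vu t = K \<or> t \<le> G (?c (vu t)) + G' (?c (vu t))" for t
    unfolding vu_def by (rule LeastI[of _ K]) simp
  have vs_less: "v < vs t \<Longrightarrow> v \<noteq> K \<and> G (?c v) < t" for v t
    unfolding vs_def by (drule not_less_Least) simp
  have vu_less: "v < vu t \<Longrightarrow> v \<noteq> K \<and> G (?c v) + G' (?c v) < t" for v t
    unfolding vu_def by (drule not_less_Least) simp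
  define f where "f = (\<lambda>t. t + G' (s t))"
  have vs_mono: "t \<le> t' \<Longrightarrow> vs t \<le> vs t'" for t t'
    using vs[of t'] vs_less[of "vs t'" t] by (metis le_trans not_le)
  have key: "f t \<in> {1..L'} \<and> u (f t) = s t" if t: "t \<in> {1..L}" "s t \<in> B" for t
  proof -
    have "vs t \<noteq> vu L'" using t False s u by auto
    \<comment> \<open>If the point for \<open>L'\<close> came earlier on the curve, \<open>G\<close>
      would still be below \<open>t \<le> L\<close> there while the sum has reached
      \<open>L'\<close>; the overflow hypothesis would put it into \<open>B\<close>, against the
      case assumption.\<close>
    moreover have "\<not> vu L' < vs t"
    proof
      assume "vu L' < vs t"
      then have "vu L' \<noteq> K" "G (?c (vu L')) < t" using vs_less by auto
      then have "?c (vu L') \<in> B" using vu[of L'] t overflow[of "?c (vu L')"] by simp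
      with False u show False by simp
    qed
    ultimately have lt: "vs t < vu L'" by simp
    then have le: "t \<le> G (?c (vs t))" using vs vuK[of L'] by (metis not_le)
    have 1: "f t \<le> G (?c (vs t)) + G' (?c (vs t))" using le s by (simp add: f_def)
    then have "f t \<le> L'" using vu_less[OF lt] by simp
    moreover have "vu (f t) = vs t"
    proof (rule antisym)
      show "vu (f t) \<le> vs t" unfolding vu_def by (rule Least_le) (use 1 in simp)
      \<comment> \<open>At an earlier point \<open>G\<close> is below \<open>t\<close> and
        \<open>G'\<close> is at most its value at \<open>s t\<close>, so the sum stays below
        \<open>f t\<close>.\<close>
      show "vs t \<le> vu (f t)"
      proof (rule ccontr)
        assume "\<not> ?thesis"
        then have c: "vu (f t) < vs t" by simp
        have "G' (?c (vu (f t))) \<le> G' (?c (vs t))"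
          using curve_level_mono[OF G(2)] c vsK by simp
        with vs_less[OF c] vu[of "f t"] s show False by (simp add: f_def)
      qed
    qed
    ultimately show ?thesis using t s u by (simp add: f_def)
  qed
  have inj: "inj f"
  proof (rule strict_mono_imp_inj_on, rule strict_monoI)
    fix t t' :: nat assume "t < t'"
    moreover have "G' (s t) \<le> G' (s t')"
      unfolding s using curve_level_mono[OF G(2) vs_mono vsK] \<open>t < t'\<close> by simp
    ultimately show "f t < f t'" by (simp add: f_def)
  qed
  have "card {t\<in>{1..L}. s t \<in> B} = card (f ` {t\<in>{1..L}. s t \<in> B})"
    using inj by (intro card_image[symmetric]) (auto simp: inj_on_def)
  also have "\<dots> \<le> card {t\<in>{1..L'}. u t \<in> B}"
    by (intro card_mono) (use key in auto)
  finally show ?thesis by simp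
qed

end

lemma sum_PiE_insert:
  fixes f :: "('a \<Rightarrow> 'b) \<Rightarrow> real"
  assumes "r \<notin> A"
  shows "sum f (PiE (insert r A) S) = (\<Sum>g\<in>PiE A S. \<Sum>t\<in>S r. f (g(r := t)))"
proof -
  have inj: "inj_on (\<lambda>(y, g). g(r := y)) (S r \<times> PiE A S)"
    using assms by (rule inj_combinator)
  have "sum f (PiE (insert r A) S) = (\<Sum>(y, g)\<in>S r \<times> PiE A S. f (g(r := y)))"
    unfolding PiE_insert_eq using inj by (subst sum.reindex) (auto simp: case_prod_unfold)
  also have "\<dots> = (\<Sum>y\<in>S r. \<Sum>g\<in>PiE A S. f (g(r := y)))"
    by (rule sum.cartesian_product[symmetric])
  finally show ?thesis by (subst sum.swap)
qed

text \<open>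
  One agent after the other, \<open>hybrid_step\<close> replaces the sample by the sample and the ghost sample
  together.  The extra weight \<open>L\<close> of the last threshold pays for the thresholds that overflow.
\<close>

lemma hybrid_sum:
  fixes G G' :: "nat \<Rightarrow> (nat \<Rightarrow> nat) \<Rightarrow> nat"
  assumes G: "\<And>i. i < m \<Longrightarrow> substitutes m i (G i)" "\<And>i. i < m \<Longrightarrow> substitutes m i (G' i)"
    and overflow: "\<And>i q. i < m \<Longrightarrow> G i q < L \<Longrightarrow> L' \<le> G i q + G' i q \<Longrightarrow> q \<in> B"
    and L: "1 \<le> L" "L \<le> L'"
  shows "real (card {\<tau>\<in>{..<m} \<rightarrow>\<^sub>E {1..L}. least_solution m K G \<tau> \<in> B})
    \<le> (\<Sum>\<tau>\<in>{..<m} \<rightarrow>\<^sub>E {1..L'}. (\<Prod>i<m. 1 + (if \<tau> i = L' then real L else 0)) *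
          of_bool (least_solution m K (\<lambda>i q. G i q + G' i q) \<tau> \<in> B))"
proof -
  \<comment> \<open>In stage \<open>k\<close> the first \<open>k\<close> agents use both samples. A
    switched agent has all thresholds up to \<open>L'\<close> with the surcharge at the last one;
    the weight of an unswitched agent cuts its thresholds off at \<open>L\<close>. All stages thus
    share one index set, and each step changes only one coordinate.\<close>
  define H where "H = (\<lambda>k i q. if i < k then G i q + G' i q else G i q)"
  define w :: "nat \<Rightarrow> nat \<Rightarrow> nat \<Rightarrow> real" where
    "w = (\<lambda>k i t. if i < k then 1 + (if t = L' then real L else 0) else of_bool (t \<le> L))"
  define Z where "Z = (\<lambda>k. \<Sum>\<tau>\<in>{..<m} \<rightarrow>\<^sub>E {1..L'}. (\<Prod>i<m. w k i (\<tau> i)) *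
          of_bool (least_solution m K (H k) \<tau> \<in> B))"
  have w0: "0 \<le> w k i t" for k i t by (simp add: w_def)
  have grossH: "substitutes m i (H k i)" if "i < m" for i k
    using G[OF that] substitutes_add[of m i "G i" "G' i"] by (cases "i < k") (simp_all add: H_def)
  have step: "Z k \<le> Z (Suc k)" if k: "k < m" for k
  proof -
    define A where "A = {..<m} - {k}"
    have ins: "{..<m} = insert k A" "k \<notin> A" "finite A" using k by (auto simp: A_def)
    have wA: "(\<Prod>i\<in>A. w (Suc k) i (g i)) = (\<Prod>i\<in>A. w k i (g i))" for g :: "nat \<Rightarrow> nat"
      by (rule prod.cong) (auto simp: w_def A_def)
    have split: "Z j = (\<Sum>g\<in>A \<rightarrow>\<^sub>E {1..L'}. (\<Prod>i\<in>A. w j i (g i)) *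
        (\<Sum>t\<in>{1..L'}. w j k t * of_bool (least_solution m K (H j) (g(k := t)) \<in> B)))" for j
    proof -
      have "(\<Prod>i\<in>A. w j i (if i = k then t else g i)) = (\<Prod>i\<in>A. w j i (g i))"
        for t :: nat and g :: "nat \<Rightarrow> nat" using ins by (intro prod.cong) auto
      then show ?thesis unfolding Z_def ins(1) sum_PiE_insert[OF ins(2)]
        using ins by (simp add: sum_distrib_left mult_ac del: sum_mult_of_bool_eq sum_of_bool_mult_eq)
    qed
    have Hk: "H k = (H k)(k := G k)" "H (Suc k) = (H k)(k := (\<lambda>q. G k q + G' k q))"
      by (auto simp: H_def fun_eq_iff less_Suc_eq)
    have inner: "(\<Sum>t\<in>{1..L'}. w k k t * of_bool (least_solution m K (H k) (g(k := t)) \<in> B))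
       \<le> (\<Sum>t\<in>{1..L'}. w (Suc k) k t * of_bool (least_solution m K (H (Suc k)) (g(k := t)) \<in> B))" for g
    proof -
      let ?s = "\<lambda>t. least_solution m K (H k) (g(k := t))" and ?u = "\<lambda>t. least_solution m K (H (Suc k)) (g(k := t))"
      have "(\<Sum>t\<in>{1..L'}. w k k t * of_bool (?s t \<in> B)) = (\<Sum>t\<in>{1..L}. of_bool (?s t \<in> B))"
        using L by (intro sum.mono_neutral_cong_right) (auto simp: w_def)
      also have "\<dots> = real (card {t\<in>{1..L}. ?s t \<in> B})"
        by (simp add: Int_def)
      also have "\<dots> \<le> real (card {t\<in>{1..L'}. ?u t \<in> B} + (if ?u L' \<in> B then L else 0))"
      proof -
        have "card {t\<in>{1..L}. least_solution m K ((H k)(k := G k)) (g(k := t)) \<in> B}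
          \<le> card {t\<in>{1..L'}. least_solution m K ((H k)(k := (\<lambda>q. G k q + G' k q))) (g(k := t)) \<in> B}
            + (if least_solution m K ((H k)(k := (\<lambda>q. G k q + G' k q))) (g(k := L')) \<in> B then L else 0)"
          by (rule hybrid_step[OF k grossH G[OF k] overflow[OF k]])
        then show ?thesis unfolding Hk(1)[symmetric] Hk(2)[symmetric] of_nat_le_iff .
      qed
      also have "\<dots> = (\<Sum>t\<in>{1..L'}. of_bool (?u t \<in> B)) + (if ?u L' \<in> B then real L else 0)"
        by (simp add: Int_def)
      also have "(if ?u L' \<in> B then real L else 0) =
          (\<Sum>t\<in>{1..L'}. (if t = L' then real L else 0) * of_bool (?u t \<in> B))"
        using L by (subst sum.remove[of _ L']) (auto intro!: sum.neutral)
      also have "(\<Sum>t\<in>{1..L'}. of_bool (?u t \<in> B)) + \<dots> =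
          (\<Sum>t\<in>{1..L'}. w (Suc k) k t * of_bool (?u t \<in> B))"
        by (simp add: w_def sum.distrib distrib_right)
      finally show ?thesis .
    qed
    show ?thesis unfolding split wA
      by (intro sum_mono mult_left_mono inner prod_nonneg ballI w0)
  qed
  have "Z 0 \<le> Z k" if "k \<le> m" for k
    using that
  proof (induction k)
    case (Suc k)
    then show ?case using step[of k] by simp
  qed simp
  then have "Z 0 \<le> Z m" by simp
  moreover have "Z m = (\<Sum>\<tau>\<in>{..<m} \<rightarrow>\<^sub>E {1..L'}. (\<Prod>i<m. 1 + (if \<tau> i = L' then real L else 0)) *
          of_bool (least_solution m K (\<lambda>i q. G i q + G' i q) \<tau> \<in> B))"
  proof -
    have "H m i = (\<lambda>i q. G i q + G' i q) i" if "i < m" for i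
      using that by (simp add: H_def)
    then have "solutions m K (H m) \<tau> = solutions m K (\<lambda>i q. G i q + G' i q) \<tau>" for \<tau>
      by (auto simp: solutions_def)
    then show ?thesis by (simp add: Z_def w_def least_solution_def)
  qed
  moreover have "Z 0 = real (card {\<tau>\<in>{..<m} \<rightarrow>\<^sub>E {1..L}. least_solution m K G \<tau> \<in> B})"
  proof -
    have sub: "({..<m} \<rightarrow>\<^sub>E {1..L}) \<subseteq> ({..<m} \<rightarrow>\<^sub>E {1..L'})" using L by (intro PiE_mono) auto
    have zero: "(\<Prod>i<m. w 0 i (\<tau> i)) = 0"
      if "\<tau> \<in> ({..<m} \<rightarrow>\<^sub>E {1..L'}) - ({..<m} \<rightarrow>\<^sub>E {1..L})" for \<tau>
    proof -
      have "\<tau> \<in> {..<m} \<rightarrow>\<^sub>E {1..L}" if "\<And>i. i < m \<Longrightarrow> \<tau> i \<le> L"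
        using that \<open>\<tau> \<in> _\<close> by (auto simp: PiE_iff)
      with that obtain i where "i < m" "\<not> \<tau> i \<le> L" by blast
      then show ?thesis by (intro prod_zero) (auto simp: w_def)
    qed
    have one: "(\<Prod>i<m. w 0 i (\<tau> i)) = 1" if "\<tau> \<in> {..<m} \<rightarrow>\<^sub>E {1..L}" for \<tau>
      using that by (intro prod.neutral) (force simp: w_def)
    have "Z 0 = (\<Sum>\<tau>\<in>{..<m} \<rightarrow>\<^sub>E {1..L}. of_bool (least_solution m K G \<tau> \<in> B))"
      unfolding Z_def using sub zero one
      by (intro sum.mono_neutral_cong_right) (auto intro!: finite_PiE simp: H_def)
    also have "\<dots> = real (card {\<tau>\<in>{..<m} \<rightarrow>\<^sub>E {1..L}. least_solution m K G \<tau> \<in> B})"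
      by (simp add: Int_def finite_PiE)
    finally show ?thesis .
  qed
  ultimately show ?thesis by simp
qed

lemma sum_hybrid_weights:
  assumes "1 \<le> L'"
  shows "(\<Sum>\<tau>\<in>{..<m} \<rightarrow>\<^sub>E {1..L'}. \<Prod>i<m. 1 + (if \<tau> i = L' then real L else 0))
    = (real L' + real L) ^ m"
proof -
  have "(\<Prod>i<m. \<Sum>t\<in>{1..L'}. 1 + (if t = L' then real L else 0))
      = (\<Sum>\<tau>\<in>{..<m} \<rightarrow>\<^sub>E {1..L'}. \<Prod>i<m. 1 + (if \<tau> i = L' then real L else 0))"
    by (rule prod_sum_PiE) auto
  then show ?thesis using assms by (simp add: sum.distrib)
qed

section \<open>Ghost samples and symmetrization\<close>

lemma pmf_replicate_pmf:
  "pmf (replicate_pmf N p) xs = (if length xs = N then \<Prod>k<N. pmf p (xs ! k) else 0)"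
proof (induction N arbitrary: xs)
  case 0
  then show ?case by (simp add: indicator_def)
next
  case (Suc N)
  show ?case
  proof (cases xs)
    case Nil
    then show ?thesis using set_replicate_pmf[of "Suc N" p] by (auto simp: pmf_eq_0_set_pmf)
  next
    case (Cons a as)
    have "replicate_pmf (Suc N) p = map_pmf (\<lambda>(x, xs). x # xs) (pair_pmf p (replicate_pmf N p))"
      by (simp add: pair_pmf_def map_pmf_def bind_assoc_pmf bind_return_pmf)
    moreover have "inj (\<lambda>(x, xs). x # xs)" by (auto simp: inj_def)
    ultimately have "pmf (replicate_pmf (Suc N) p) xs = pmf (pair_pmf p (replicate_pmf N p)) (a, as)"
      using pmf_map_inj'[of "\<lambda>(x, xs). x # xs" "pair_pmf p (replicate_pmf N p)" "(a, as)"]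
      by (simp add: Cons)
    then show ?thesis by (simp add: Cons pmf_pair Suc.IH prod.lessThan_Suc_shift del: prod.lessThan_Suc)
  qed
qed

text \<open>Single items rather than whole instances are exchanged, because the small items
  assumption bounds single items only. The identity outside the range makes the map an involution on
  all pairs of lists.\<close>

definition swap_item ::
  "nat \<Rightarrow> nat \<Rightarrow> matrix list \<times> matrix list \<Rightarrow>
   matrix list \<times> matrix list" where
  "swap_item k j = (\<lambda>(S, S'). if k < length S \<and> k < length S' then
     (S[k := (S ! k)(j := (S' ! k) j)], S'[k := (S' ! k)(j := (S ! k) j)]) else (S, S'))"

lemma swap_item_swap_item: "swap_item k j (swap_item k j z) = z"
  by (auto simp: swap_item_def split: prod.splits)

text \<open>The columns are independent, so the probability of a pair of samples is a product over
  columns; exchanging two columns drawn from the same \<open>D j\<close> permutes equal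
  factors.\<close>

lemma swap_item_invariant:
  fixes D :: "nat \<Rightarrow> column pmf"
  assumes j: "j < n"
  defines "p \<equiv> product_dist n D"
  shows "map_pmf (swap_item k j) (pair_pmf (replicate_pmf N p) (replicate_pmf N p))
    = pair_pmf (replicate_pmf N p) (replicate_pmf N p)" (is "map_pmf ?s ?M = ?M")
proof (rule pmf_eqI)
  fix z
  have col: "pmf p (P(j := Q j)) * pmf p (Q(j := P j)) = pmf p P * pmf p Q" for P Q
  proof -
    define c where "c = (\<lambda>P. if \<forall>a. a \<notin> {..<n} \<longrightarrow> P a = undefined
        then \<Prod>a\<in>{..<n} - {j}. pmf (D a) (P a) else 0)"
    have split: "pmf p (P(j := x)) = pmf (D j) x * c P" for P x
      unfolding p_def product_dist_def c_def using j
      by (subst pmf_Pi) (auto simp: prod.remove[of _ j] intro!: prod.cong)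
    show ?thesis using split[of P "Q j"] split[of Q "P j"] split[of P "P j"] split[of Q "Q j"]
      by simp
  qed
  have inv: "pmf ?M (?s z) = pmf ?M z" for z
  proof -
    obtain S S' where z: "z = (S, S')" by (cases z)
    show ?thesis
    proof (cases "length S = N \<and> length S' = N \<and> k < N")
      case True
      have upd: "(\<Prod>l<N. pmf p (T[k := x] ! l)) = pmf p x * (\<Prod>l\<in>{..<N} - {k}. pmf p (T ! l))"
        if "length T = N" for T x
      proof -
        have "(\<Prod>l\<in>{..<N} - {k}. pmf p (T[k := x] ! l)) = (\<Prod>l\<in>{..<N} - {k}. pmf p (T ! l))"
          by (intro prod.cong) auto
        then show ?thesis using True that by (simp add: prod.remove[of _ k])
      qed
      have id: "(\<Prod>l<N. pmf p (T ! l)) = pmf p (T ! k) * (\<Prod>l\<in>{..<N} - {k}. pmf p (T ! l))" for T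
        using True by (intro prod.remove) auto
      show ?thesis using True col[of "S ! k" "S' ! k"]
        by (simp add: z swap_item_def pmf_pair pmf_replicate_pmf upd id)
    next
      case False
      then show ?thesis by (auto simp: z swap_item_def pmf_pair pmf_replicate_pmf)
    qed
  qed
  have "inj ?s" by (metis injI swap_item_swap_item)
  then have "pmf (map_pmf ?s ?M) (?s (?s z)) = pmf ?M (?s z)" by (rule pmf_map_inj')
  then show "pmf (map_pmf ?s ?M) z = pmf ?M z" by (simp add: swap_item_swap_item inv)
qed

text \<open>This replaces random signs. As \<open>M\<close> is invariant under the swap at
  \<open>a\<close>, the integrand may be averaged with its swapped version; all other factors stay
  fixed, and the two values of the factor at \<open>a\<close> have mean at most 1. Factors are
  removed one by one in this way.\<close>

lemma nn_integral_symmetrize: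
  fixes M :: "'z pmf" and g :: "'a \<Rightarrow> 'z \<Rightarrow> real"
  assumes fin: "finite I"
    and inv: "\<And>a. a \<in> I \<Longrightarrow> map_pmf (sw a) M = M"
    and nonneg: "\<And>a z. 0 \<le> g a z"
    and other: "\<And>a b z. a \<in> I \<Longrightarrow> b \<in> I \<Longrightarrow> a \<noteq> b \<Longrightarrow> z \<in> set_pmf M \<Longrightarrow> g b (sw a z) = g b z"
    and two: "\<And>a z. a \<in> I \<Longrightarrow> z \<in> set_pmf M \<Longrightarrow> g a z + g a (sw a z) \<le> 2"
  shows "(\<integral>\<^sup>+z. ennreal (\<Prod>a\<in>I. g a z) \<partial>M) \<le> 1"
  using fin order_refl[of I]
proof (induction I rule: finite_subset_induct')
  case empty
  then show ?case by simp
next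
  case (insert a F)
  let ?R = "\<lambda>z. \<Prod>b\<in>F. g b z"
  have R0: "0 \<le> ?R z" for z by (intro prod_nonneg ballI nonneg)
  have Rsw: "?R (sw a z) = ?R z" if "z \<in> set_pmf M" for z
  proof (rule prod.cong[OF refl])
    fix b assume "b \<in> F"
    then show "g b (sw a z) = g b z" using insert.hyps that by (intro other) auto
  qed
  have "2 * (\<integral>\<^sup>+z. ennreal (g a z * ?R z) \<partial>M)
      = (\<integral>\<^sup>+z. ennreal (g a z * ?R z) \<partial>M) + (\<integral>\<^sup>+z. ennreal (g a z * ?R z) \<partial>map_pmf (sw a) M)"
    using inv[of a] insert by (simp add: mult_2)
  also have "\<dots> = (\<integral>\<^sup>+z. ennreal (g a z * ?R z) \<partial>M)
      + (\<integral>\<^sup>+z. ennreal (g a (sw a z) * ?R (sw a z)) \<partial>M)"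
    by simp
  also have "\<dots> = (\<integral>\<^sup>+z. ennreal (g a z * ?R z) + ennreal (g a (sw a z) * ?R (sw a z)) \<partial>M)"
    by (subst nn_integral_add) auto
  also have "\<dots> \<le> (\<integral>\<^sup>+z. 2 * ennreal (?R z) \<partial>M)"
  proof (intro nn_integral_mono_AE AE_pmfI)
    fix z assume z: "z \<in> set_pmf M"
    have "g a z * ?R z + g a (sw a z) * ?R (sw a z) \<le> 2 * ?R z"
      using mult_right_mono[OF two[OF insert(2) z] R0] by (simp add: Rsw[OF z] distrib_right)
    then show "ennreal (g a z * ?R z) + ennreal (g a (sw a z) * ?R (sw a z)) \<le> 2 * ennreal (?R z)"
      using R0 nonneg
      by (simp flip: ennreal_plus ennreal_mult' ennreal_numeral add: ennreal_leI)
  qed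
  also have "\<dots> = 2 * (\<integral>\<^sup>+z. ennreal (?R z) \<partial>M)" by (subst nn_integral_cmult) auto
  also have "\<dots> \<le> 2 * 1" by (intro mult_left_mono insert.IH) auto
  finally have "(\<integral>\<^sup>+z. ennreal (g a z * ?R z) \<partial>M) \<le> 1"
    by (subst (asm) ennreal_mult_le_mult_iff) auto
  then show ?case using insert by simp
qed

definition level ::
  "nat \<Rightarrow> (column \<Rightarrow> (nat \<Rightarrow> nat) \<Rightarrow> nat) \<Rightarrow>
   matrix list \<Rightarrow> (nat \<Rightarrow> nat) \<Rightarrow> nat" where
  "level n h S q = (\<Sum>k<length S. \<Sum>j<n. h ((S ! k) j) q)"

text \<open>A swap only moves terms within the combined sum. Hence whatever is computed from the
  summed levels alone, in particular the least solution for both samples together, survives all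
  swaps.\<close>

lemma level_swap_item:
  assumes "length S = length S'"
  shows "level n h (fst (swap_item k j (S, S'))) q + level n h (snd (swap_item k j (S, S'))) q
    = level n h S q + level n h S' q"
proof (cases "k < length S")
  case True
  have "(\<Sum>l<length S. (\<Sum>i<n. h ((S[k := (S ! k)(j := (S' ! k) j)] ! l) i) q) +
           (\<Sum>i<n. h ((S'[k := (S' ! k)(j := (S ! k) j)] ! l) i) q))
      = (\<Sum>l<length S. (\<Sum>i<n. h ((S ! l) i) q) + (\<Sum>i<n. h ((S' ! l) i) q))"
  proof (rule sum.cong[OF refl])
    fix l
    show "(\<Sum>i<n. h ((S[k := (S ! k)(j := (S' ! k) j)] ! l) i) q) +
           (\<Sum>i<n. h ((S'[k := (S' ! k)(j := (S ! k) j)] ! l) i) q)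
       = (\<Sum>i<n. h ((S ! l) i) q) + (\<Sum>i<n. h ((S' ! l) i) q)"
      unfolding sum.distrib[symmetric]
      using True assms by (intro sum.cong) (auto simp: nth_list_update)
  qed
  then show ?thesis using True assms by (simp add: level_def swap_item_def sum.distrib)
qed (simp add: swap_item_def)

section \<open>Exponential moments and deviations of signed sums of items\<close>

lemma exp_minus_le:
  fixes x :: real
  assumes "0 \<le> x"
  shows "exp (- x) \<le> 1 - x + x\<^sup>2"
proof -
  have "1 \<le> 1 + x ^ 3" using assms by simp
  also have "\<dots> = (1 + x) * (1 - x + x\<^sup>2)" by (simp add: algebra_simps power2_eq_square power3_eq_cube)
  also have "\<dots> \<le> exp x * (1 - x + x\<^sup>2)"
  proof (intro mult_right_mono)
    have "1 - x + x\<^sup>2 = (1 - x / 2)\<^sup>2 + 3 / 4 * x\<^sup>2" by (simp add: power2_eq_square algebra_simps)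
    then show "0 \<le> 1 - x + x\<^sup>2" by simp
  qed simp
  finally show ?thesis by (simp add: exp_minus field_simps)
qed

lemma exp_symmetric_bound:
  fixes x :: real
  assumes "\<bar>x\<bar> \<le> 1"
  shows "exp x + exp (- x) \<le> 2 * exp (x\<^sup>2)"
proof -
  have "exp \<bar>x\<bar> + exp (- \<bar>x\<bar>) \<le> 2 * (1 + x\<^sup>2)"
    using exp_bound[of "\<bar>x\<bar>"] exp_minus_le[of "\<bar>x\<bar>"] assms by simp
  also have "\<dots> \<le> 2 * exp (x\<^sup>2)" using exp_ge_add_one_self[of "x\<^sup>2"] by (intro mult_left_mono) auto
  finally show ?thesis by (auto simp: abs_if split: if_splits)
qed

text \<open>The point \<open>y z\<close> depends on the samples, so there is no fixed variance to
  refer to; the variance bound is placed inside the exponent instead. A swap reverses the sign of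
  one difference u - v and changes nothing else, and
  \<open>(u - v)\<^sup>2 \<le> b * (u + v)\<close> lets the subtracted term pay for its exponential
  moment.\<close>

lemma ghost_mgf:
  fixes D :: "nat \<Rightarrow> column pmf" and y :: "matrix list \<times> matrix list \<Rightarrow> nat \<Rightarrow> nat" and n N :: nat
  defines "p \<equiv> product_dist n D"
  defines "M \<equiv> pair_pmf (replicate_pmf N p) (replicate_pmf N p)"
  assumes hb: "\<And>j c q. j < n \<Longrightarrow> c \<in> set_pmf (D j) \<Longrightarrow> real (h c q) \<le> b"
    and y: "\<And>k j z. z \<in> set_pmf M \<Longrightarrow> y (swap_item k j z) = y z"
    and lam: "\<bar>\<theta>\<bar> * b \<le> 1"
  shows "(\<integral>\<^sup>+z. ennreal (exp (\<theta> * (real (level n h (fst z) (y z)) - real (level n h (snd z) (y z)))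
      - \<theta>\<^sup>2 * b * (real (level n h (fst z) (y z)) + real (level n h (snd z) (y z))))) \<partial>M) \<le> 1"
proof -
  define g :: "nat \<times> nat \<Rightarrow> matrix list \<times> matrix list \<Rightarrow> real" where
    "g = (\<lambda>(k, j) z. exp (\<theta> * (real (h ((fst z ! k) j) (y z)) - real (h ((snd z ! k) j) (y z)))
      - \<theta>\<^sup>2 * b * (real (h ((fst z ! k) j) (y z)) + real (h ((snd z ! k) j) (y z)))))"
  let ?sw = "\<lambda>(k, j). swap_item k j" and ?I = "{..<N} \<times> {..<n}"
  have M: "length S = N" "length S' = N" "\<And>k. k < N \<Longrightarrow> S ! k \<in> set_pmf p"
      "\<And>k. k < N \<Longrightarrow> S' ! k \<in> set_pmf p" if "(S, S') \<in> set_pmf M" for S S'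
    using that by (auto simp: M_def set_replicate_pmf)
  have col: "P j \<in> set_pmf (D j)" if "P \<in> set_pmf p" "j < n" for P j
    using that by (auto simp: p_def product_dist_def set_Pi_pmf PiE_dflt_def)
  have "(\<integral>\<^sup>+z. ennreal (\<Prod>a\<in>?I. g a z) \<partial>M) \<le> 1"
  proof (rule nn_integral_symmetrize[where sw = ?sw])
    show "map_pmf (?sw a) M = M" if "a \<in> ?I" for a
      using that swap_item_invariant unfolding M_def p_def by (auto split: prod.splits)
    show "g b (?sw a z) = g b z" if "a \<in> ?I" "b \<in> ?I" "a \<noteq> b" "z \<in> set_pmf M" for a b z
    proof -
      obtain k j k' j' S S' where *: "a = (k, j)" "b = (k', j')" "z = (S, S')"
        by (cases a; cases b; cases z) auto
      with that M[of S S'] y[OF that(4), of k j] show ?thesis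
        by (auto simp: g_def swap_item_def nth_list_update)
    qed
    show "g a z + g a (?sw a z) \<le> 2" if "a \<in> ?I" "z \<in> set_pmf M" for a z
    proof -
      obtain k j S S' where a: "a = (k, j)" and z: "z = (S, S')" by (cases a; cases z) auto
      have kj: "k < N" "j < n" using that a by auto
      note MM = M[of S S', folded z, OF that(2)]
      define u v where "u = real (h ((S ! k) j) (y z))" and "v = real (h ((S' ! k) j) (y z))"
      have u: "0 \<le> u" "u \<le> b" using hb[OF kj(2) col[OF MM(3)[OF kj(1)] kj(2)]] by (auto simp: u_def)
      have v: "0 \<le> v" "v \<le> b" using hb[OF kj(2) col[OF MM(4)[OF kj(1)] kj(2)]] by (auto simp: v_def)
      have ysw: "y (swap_item k j z) = y z" by (rule y[OF that(2)])
      have g1: "g a z = exp (\<theta> * (u - v) - \<theta>\<^sup>2 * b * (u + v))"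
        by (simp add: g_def a z u_def v_def)
      have g2: "g a (?sw a z) = exp (\<theta> * (v - u) - \<theta>\<^sup>2 * b * (u + v))"
        using ysw kj MM by (simp add: g_def a z u_def v_def swap_item_def add.commute)
      have "(u - v)\<^sup>2 \<le> b * (u + v)"
      proof -
        have "(u - v)\<^sup>2 \<le> u * u + v * v" using u v by (simp add: power2_eq_square algebra_simps)
        also have "\<dots> \<le> b * u + b * v" using u v by (intro add_mono mult_right_mono) auto
        finally show ?thesis by (simp add: distrib_left)
      qed
      then have d2: "(\<theta> * (u - v))\<^sup>2 \<le> \<theta>\<^sup>2 * b * (u + v)"
        by (simp add: power_mult_distrib mult.assoc mult_left_mono)
      have "\<bar>u - v\<bar> \<le> b" using u v by auto
      then have "\<bar>\<theta> * (u - v)\<bar> \<le> 1"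
        using lam by (simp add: abs_mult) (meson abs_ge_zero mult_left_mono order_trans)
      note sym = exp_symmetric_bound[OF this]
      have neg: "\<theta> * (v - u) = - (\<theta> * (u - v))" by (simp add: algebra_simps)
      have "g a z + g a (?sw a z)
          = (exp (\<theta> * (u - v)) + exp (- (\<theta> * (u - v)))) * exp (- (\<theta>\<^sup>2 * b * (u + v)))"
        unfolding g1 g2 neg distrib_right exp_add[symmetric] by simp
      also have "\<dots> \<le> 2 * exp ((\<theta> * (u - v))\<^sup>2) * exp (- (\<theta>\<^sup>2 * b * (u + v)))"
        by (intro mult_right_mono sym) simp
      also have "\<dots> = 2 * exp ((\<theta> * (u - v))\<^sup>2 - \<theta>\<^sup>2 * b * (u + v))"
        by (simp add: mult_exp_exp)
      also have "\<dots> \<le> 2 * 1" using d2 by (intro mult_left_mono) auto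
      finally show ?thesis by simp
    qed
  qed (auto simp: g_def)
  moreover have "(\<Prod>a\<in>?I. g a z) = exp (\<theta> * (real (level n h (fst z) (y z)) - real (level n h (snd z) (y z)))
      - \<theta>\<^sup>2 * b * (real (level n h (fst z) (y z)) + real (level n h (snd z) (y z))))"
    if "z \<in> set_pmf M" for z
  proof -
    have len: "length (fst z) = N" "length (snd z) = N" using M[of "fst z" "snd z"] that by auto
    show ?thesis unfolding g_def level_def len
      by (simp add: exp_sum[symmetric] case_prod_unfold sum_subtractf sum_distrib_left sum.distrib
        right_diff_distrib distrib_left sum.cartesian_product)
  qed
  ultimately show ?thesis
    by (subst nn_integral_cong_AE[where v = "\<lambda>z. ennreal (\<Prod>a\<in>?I. g a z)"]) (auto intro!: AE_pmfI)
qed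

lemma ghost_deviation:
  fixes D :: "nat \<Rightarrow> column pmf" and y :: "matrix list \<times> matrix list \<Rightarrow> nat \<Rightarrow> nat" and n N :: nat
  defines "p \<equiv> product_dist n D"
  defines "M \<equiv> pair_pmf (replicate_pmf N p) (replicate_pmf N p)"
  assumes hb: "\<And>j c q. j < n \<Longrightarrow> c \<in> set_pmf (D j) \<Longrightarrow> real (h c q) \<le> b"
    and y: "\<And>k j z. z \<in> set_pmf M \<Longrightarrow> y (swap_item k j z) = y z"
    and eta: "0 < \<eta>" "\<eta> \<le> 1" and b: "0 < b"
  shows "measure_pmf.prob M {z. lo \<le> real (level n h (fst z) (y z)) + real (level n h (snd z) (y z)) \<and>
      \<eta> * (real (level n h (fst z) (y z)) + real (level n h (snd z) (y z))) \<le>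
      \<bar>real (level n h (fst z) (y z)) - real (level n h (snd z) (y z))\<bar>}
    \<le> 2 * exp (- (\<eta>\<^sup>2 * lo / (4 * b)))" (is "measure_pmf.prob M ?E \<le> _")
proof -
  define s s' where "s = (\<lambda>z. real (level n h (fst z) (y z)))"
    and "s' = (\<lambda>z. real (level n h (snd z) (y z)))"
  have one: "measure_pmf.prob M {z. lo \<le> s z + s' z \<and> \<eta> * (s z + s' z) \<le> \<sigma> * (s z - s' z)}
      \<le> exp (- (\<eta>\<^sup>2 * lo / (4 * b)))" (is "measure_pmf.prob M ?A \<le> exp (- ?t)")
    if sig: "\<bar>\<sigma>\<bar> = 1" for \<sigma> :: real
  proof -
    \<comment> \<open>This value maximises \<open>\<theta> * \<eta> - \<theta>\<^sup>2 * b\<close>.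
      The maximum \<open>\<eta>\<^sup>2 / (4 * b)\<close> is multiplied by the summed level, which
      is at least \<open>lo\<close> on the event; the sign \<sigma> covers both directions.\<close>
    define \<theta> where "\<theta> = \<eta> / (2 * b)"
    have "(\<integral>\<^sup>+z. ennreal (exp (\<sigma> * \<theta> * (s z - s' z) - (\<sigma> * \<theta>)\<^sup>2 * b * (s z + s' z))) \<partial>M) \<le> 1"
      unfolding s_def s'_def M_def p_def
    proof (rule ghost_mgf[OF hb])
      show "\<bar>\<sigma> * \<theta>\<bar> * b \<le> 1" using sig eta b by (simp add: abs_mult \<theta>_def)
    qed (use y in \<open>auto simp: M_def p_def\<close>)
    moreover have "ennreal (exp ?t) * emeasure M ?A
       \<le> (\<integral>\<^sup>+z. ennreal (exp (\<sigma> * \<theta> * (s z - s' z) - (\<sigma> * \<theta>)\<^sup>2 * b * (s z + s' z))) \<partial>M)"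
    proof -
      have "ennreal (exp ?t) * emeasure M ?A = (\<integral>\<^sup>+z. ennreal (exp ?t) * indicator ?A z \<partial>M)"
        by (subst nn_integral_cmult_indicator) auto
      also have "\<dots> \<le> (\<integral>\<^sup>+z. ennreal (exp (\<sigma> * \<theta> * (s z - s' z) - (\<sigma> * \<theta>)\<^sup>2 * b * (s z + s' z))) \<partial>M)"
      proof (rule nn_integral_mono)
        fix z
        show "ennreal (exp ?t) * indicator ?A z
          \<le> ennreal (exp (\<sigma> * \<theta> * (s z - s' z) - (\<sigma> * \<theta>)\<^sup>2 * b * (s z + s' z)))"
        proof (cases "z \<in> ?A")
          case True
          have l: "0 \<le> \<theta>" using eta b by (simp add: \<theta>_def)
          have sq: "\<sigma>\<^sup>2 = 1" using sig by (metis power2_abs one_power2)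
          have "?t \<le> \<eta>\<^sup>2 / (4 * b) * (s z + s' z)"
            using True b by (simp add: mult_left_mono divide_right_mono)
          also have "\<dots> = \<theta> * (\<eta> * (s z + s' z)) - \<theta>\<^sup>2 * b * (s z + s' z)"
            using b by (simp add: \<theta>_def power2_eq_square field_simps)
          also have "\<dots> \<le> \<theta> * (\<sigma> * (s z - s' z)) - \<theta>\<^sup>2 * b * (s z + s' z)"
            using True l by (simp add: mult_left_mono)
          also have "\<dots> = \<sigma> * \<theta> * (s z - s' z) - (\<sigma> * \<theta>)\<^sup>2 * b * (s z + s' z)"
            using sq by (simp add: power_mult_distrib)
          finally show ?thesis using True by (simp add: ennreal_leI)
        qed simp
      qed
      finally show ?thesis .
    qed
    ultimately have "ennreal (exp ?t) * emeasure M ?A \<le> 1" by (rule order_trans[rotated])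
    then have "exp ?t * measure_pmf.prob M ?A \<le> 1"
      by (simp add: measure_pmf.emeasure_eq_measure flip: ennreal_mult')
    then show ?thesis by (simp add: exp_minus field_simps)
  qed
  have "?E \<subseteq> {z. lo \<le> s z + s' z \<and> \<eta> * (s z + s' z) \<le> 1 * (s z - s' z)}
      \<union> {z. lo \<le> s z + s' z \<and> \<eta> * (s z + s' z) \<le> -1 * (s z - s' z)}"
    by (auto simp: s_def s'_def abs_if split: if_splits)
  then have "measure_pmf.prob M ?E \<le> measure_pmf.prob M ({z. lo \<le> s z + s' z \<and> \<eta> * (s z + s' z) \<le> 1 * (s z - s' z)}
      \<union> {z. lo \<le> s z + s' z \<and> \<eta> * (s z + s' z) \<le> -1 * (s z - s' z)})"
    by (intro measure_pmf.finite_measure_mono) auto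
  also have "\<dots> \<le> measure_pmf.prob M {z. lo \<le> s z + s' z \<and> \<eta> * (s z + s' z) \<le> 1 * (s z - s' z)}
      + measure_pmf.prob M {z. lo \<le> s z + s' z \<and> \<eta> * (s z + s' z) \<le> -1 * (s z - s' z)}"
    by (rule measure_Un_le) auto
  also have "\<dots> \<le> exp (- (\<eta>\<^sup>2 * lo / (4 * b))) + exp (- (\<eta>\<^sup>2 * lo / (4 * b)))"
    by (intro add_mono one) auto
  finally show ?thesis by simp
qed

section \<open>Concentration of loads\<close>

lemma integrable_pmf_bounded:
  fixes f :: "'a \<Rightarrow> real"
  assumes "\<And>x. x \<in> set_pmf p \<Longrightarrow> \<bar>f x\<bar> \<le> B"
  shows "integrable (measure_pmf p) f"
  using assms by (intro measure_pmf.integrable_const_bound[where B = B]) (auto intro!: AE_pmfI)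

lemma nn_integral_pmf_bounded:
  fixes f :: "'a \<Rightarrow> real"
  assumes "\<And>x. x \<in> set_pmf p \<Longrightarrow> 0 \<le> f x" "\<And>x. x \<in> set_pmf p \<Longrightarrow> f x \<le> B"
  shows "(\<integral>\<^sup>+x. ennreal (f x) \<partial>p) = ennreal (measure_pmf.expectation p f)"
  by (rule nn_integral_eq_integral)
     (use assms in \<open>auto intro!: integrable_pmf_bounded[of _ _ B] AE_pmfI\<close>)

lemma expectation_pmf_mono:
  fixes f :: "'a \<Rightarrow> real"
  assumes "\<And>x. x \<in> set_pmf p \<Longrightarrow> \<bar>f x\<bar> \<le> B" "\<And>x. x \<in> set_pmf p \<Longrightarrow> \<bar>g x\<bar> \<le> B'"
    "\<And>x. x \<in> set_pmf p \<Longrightarrow> f x \<le> g x"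
  shows "measure_pmf.expectation p f \<le> measure_pmf.expectation p g"
  by (rule integral_mono_AE)
     (use assms in \<open>auto intro!: integrable_pmf_bounded AE_pmfI\<close>)

lemma expectation_bind_pmf_bounded:
  fixes h :: "'b \<Rightarrow> real"
  assumes "\<And>y. y \<in> set_pmf (bind_pmf p f) \<Longrightarrow> 0 \<le> h y" "\<And>y. y \<in> set_pmf (bind_pmf p f) \<Longrightarrow> h y \<le> B"
  shows "measure_pmf.expectation (bind_pmf p f) h
    = measure_pmf.expectation p (\<lambda>x. measure_pmf.expectation (f x) h)"
proof -
  have h: "0 \<le> h y" "h y \<le> B" if "x \<in> set_pmf p" "y \<in> set_pmf (f x)" for x y
    using assms that by auto
  have e0: "0 \<le> measure_pmf.expectation (f x) h" if "x \<in> set_pmf p" for x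
    using h that by (intro integral_nonneg_AE AE_pmfI) auto
  have eB: "measure_pmf.expectation (f x) h \<le> B" if "x \<in> set_pmf p" for x
    using h that by (intro measure_pmf.integral_le_const integrable_pmf_bounded[of _ _ B] AE_pmfI) auto
  have "ennreal (measure_pmf.expectation (bind_pmf p f) h) = (\<integral>\<^sup>+x. ennreal (h x) \<partial>bind_pmf p f)"
    using assms by (intro nn_integral_pmf_bounded[symmetric])
  also have "\<dots> = (\<integral>\<^sup>+x. \<integral>\<^sup>+y. ennreal (h y) \<partial>f x \<partial>p)" by (rule nn_integral_bind_pmf)
  also have "\<dots> = (\<integral>\<^sup>+x. ennreal (measure_pmf.expectation (f x) h) \<partial>p)"
    using h by (intro nn_integral_cong_AE AE_pmfI nn_integral_pmf_bounded) auto
  also have "\<dots> = ennreal (measure_pmf.expectation p (\<lambda>x. measure_pmf.expectation (f x) h))"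
    by (rule nn_integral_pmf_bounded[OF e0 eB])
  finally show ?thesis
    by (subst (asm) ennreal_inj) (use assms e0 in \<open>auto intro!: integral_nonneg_AE AE_pmfI\<close>)
qed

lemma product_dist_column:
  assumes "P \<in> set_pmf (product_dist n D)" "j < n"
  shows "P j \<in> set_pmf (D j)"
  using assms by (auto simp: product_dist_def set_Pi_pmf PiE_dflt_def)

lemma product_dist_upd:
  assumes "P \<in> set_pmf (product_dist n D)" "j < n" "c \<in> set_pmf (D j)"
  shows "P(j := c) \<in> set_pmf (product_dist n D)"
  using assms by (auto simp: product_dist_def set_Pi_pmf PiE_dflt_def)

lemma map_product_dist_column:
  "j < n \<Longrightarrow> map_pmf (\<lambda>P. P j) (product_dist n D) = D j"
  unfolding product_dist_def by (subst Pi_pmf_component) auto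

lemma product_dist_resample:
  assumes "j < n"
  shows "bind_pmf (D j) (\<lambda>c. map_pmf (\<lambda>P. P(j := c)) (product_dist n D)) = product_dist n D"
proof -
  have A: "{..<n} = insert j ({..<n} - {j})" using assms by auto
  have "product_dist n D = bind_pmf (D j) (\<lambda>c. bind_pmf (Pi_pmf ({..<n} - {j}) undefined D)
      (\<lambda>f. return_pmf (f(j := c))))"
    unfolding product_dist_def by (subst A, subst Pi_pmf_insert') auto
  also have "Pi_pmf ({..<n} - {j}) undefined D = map_pmf (\<lambda>f. f(j := undefined)) (product_dist n D)"
    unfolding product_dist_def by (rule Pi_pmf_remove) simp
  finally have eq: "product_dist n D = bind_pmf (D j) (\<lambda>c. bind_pmf
      (map_pmf (\<lambda>f. f(j := undefined)) (product_dist n D)) (\<lambda>f. return_pmf (f(j := c))))" .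
  have "bind_pmf (map_pmf (\<lambda>f. f(j := undefined)) (product_dist n D)) (\<lambda>f. return_pmf (f(j := c)))
      = map_pmf (\<lambda>P. P(j := c)) (product_dist n D)" for c
    by (simp add: map_pmf_def bind_assoc_pmf bind_return_pmf)
  from eq[unfolded this] show ?thesis by (rule sym)
qed

section \<open>Exponential moments and lower tails of loads\<close>

definition mean_load ::
  "nat \<Rightarrow> (nat \<Rightarrow> column pmf) \<Rightarrow>
   (nat \<Rightarrow> column \<Rightarrow> real) \<Rightarrow> real" where
  "mean_load n D z = (\<Sum>j<n. measure_pmf.expectation (D j) (z j))"

lemma mean_load_eq:
  assumes "\<And>j c. j < n \<Longrightarrow> c \<in> set_pmf (D j) \<Longrightarrow> \<bar>z j c\<bar> \<le> b"
  shows "measure_pmf.expectation (product_dist n D) (\<lambda>P. \<Sum>j<n. z j (P j)) = mean_load n D z"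
proof -
  have "measure_pmf.expectation (product_dist n D) (\<lambda>P. \<Sum>j<n. z j (P j))
     = (\<Sum>j<n. measure_pmf.expectation (product_dist n D) (\<lambda>P. z j (P j)))"
    using assms product_dist_column
    by (intro Bochner_Integration.integral_sum) (auto intro!: integrable_pmf_bounded[of _ _ b])
  also have "\<dots> = mean_load n D z"
    unfolding mean_load_def
  proof (rule sum.cong[OF refl])
    fix j assume "j \<in> {..<n}"
    then show "measure_pmf.expectation (product_dist n D) (\<lambda>P. z j (P j)) = measure_pmf.expectation (D j) (z j)"
      using integral_map_pmf[of "\<lambda>P. P j" "product_dist n D" "z j"] map_product_dist_column[of j n D]
      by simp
  qed
  finally show ?thesis .
qed

lemma prod_mono_ennreal:
  fixes f g :: "'i \<Rightarrow> ennreal"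
  assumes "\<And>i. i \<in> A \<Longrightarrow> f i \<le> g i"
  shows "prod f A \<le> prod g A"
  using assms by (induction A rule: infinite_finite_induct) (auto intro: mult_mono)

text \<open>Since \<open>z j c \<le> b\<close>, the quadratic term of exp (- x) <= 1 - x + x^2 is at
  most the fraction \<open>l * b\<close> of the linear one. The bound is therefore linear in each
  contribution and only the means remain.\<close>

lemma mgf_load:
  assumes z: "\<And>j c. j < n \<Longrightarrow> c \<in> set_pmf (D j) \<Longrightarrow> 0 \<le> z j c"
      "\<And>j c. j < n \<Longrightarrow> c \<in> set_pmf (D j) \<Longrightarrow> z j c \<le> b"
    and l: "0 \<le> l"
  shows "(\<integral>\<^sup>+P. ennreal (exp (- (l * (\<Sum>j<n. z j (P j))))) \<partial>product_dist n D)
    \<le> ennreal (exp (- (l * (1 - l * b) * mean_load n D z)))"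
proof -
  have "(\<integral>\<^sup>+P. ennreal (exp (- (l * (\<Sum>j<n. z j (P j))))) \<partial>product_dist n D)
      = (\<integral>\<^sup>+P. (\<Prod>j<n. ennreal (exp (- (l * z j (P j))))) \<partial>product_dist n D)"
    by (simp add: prod_ennreal exp_sum[symmetric] sum_distrib_left sum_negf)
  also have "\<dots> = (\<Prod>j<n. \<integral>\<^sup>+c. ennreal (exp (- (l * z j c))) \<partial>D j)"
    unfolding product_dist_def by (rule nn_integral_prod_Pi_pmf) simp
  also have "\<dots> \<le> (\<Prod>j<n. ennreal (exp (- (l * (1 - l * b) * measure_pmf.expectation (D j) (z j)))))"
  proof (rule prod_mono_ennreal)
    fix j assume "j \<in> {..<n}"
    then have j: "j < n" by simp
    let ?\<mu> = "measure_pmf.expectation (D j) (z j)"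
    have int: "integrable (D j) (z j)"
      using z j by (intro integrable_pmf_bounded[of _ _ b]) auto
    have "exp (- (l * z j c)) \<le> 1 - l * (1 - l * b) * z j c" if c: "c \<in> set_pmf (D j)" for c
    proof -
      have "exp (- (l * z j c)) \<le> 1 - l * z j c + (l * z j c)\<^sup>2"
        using z l j c by (intro exp_minus_le) auto
      also have "(l * z j c)\<^sup>2 \<le> l * z j c * (l * b)"
        unfolding power2_eq_square using z l j c by (intro mult_left_mono) auto
      finally show ?thesis by (simp add: algebra_simps)
    qed
    then have "(\<integral>\<^sup>+c. ennreal (exp (- (l * z j c))) \<partial>D j) \<le> (\<integral>\<^sup>+c. ennreal (1 - l * (1 - l * b) * z j c) \<partial>D j)"
      by (intro nn_integral_mono_AE AE_pmfI ennreal_leI) auto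
    also have "\<dots> = ennreal (measure_pmf.expectation (D j) (\<lambda>c. 1 - l * (1 - l * b) * z j c))"
    proof (rule nn_integral_eq_integral)
      show "AE c in D j. 0 \<le> 1 - l * (1 - l * b) * z j c"
        using \<open>\<And>c. c \<in> set_pmf (D j) \<Longrightarrow> exp (- (l * z j c)) \<le> 1 - l * (1 - l * b) * z j c\<close>
        by (intro AE_pmfI) (meson exp_ge_zero order_trans)
    qed (use int in auto)
    also have "measure_pmf.expectation (D j) (\<lambda>c. 1 - l * (1 - l * b) * z j c) = 1 - l * (1 - l * b) * ?\<mu>"
      using int by (simp add: measure_pmf.prob_space)
    also have "ennreal \<dots> \<le> ennreal (exp (- (l * (1 - l * b) * ?\<mu>)))"
      using exp_ge_add_one_self[of "- (l * (1 - l * b) * ?\<mu>)"] by (intro ennreal_leI) simp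
    finally show "(\<integral>\<^sup>+c. ennreal (exp (- (l * z j c))) \<partial>D j)
      \<le> ennreal (exp (- (l * (1 - l * b) * ?\<mu>)))" .
  qed
  also have "\<dots> = ennreal (exp (- (l * (1 - l * b) * mean_load n D z)))"
    by (simp add: prod_ennreal exp_sum[symmetric] sum_distrib_left sum_negf mean_load_def)
  finally show ?thesis .
qed

lemma nn_integral_replicate_pmf_prod:
  fixes f :: "'a \<Rightarrow> ennreal"
  shows "(\<integral>\<^sup>+S. (\<Prod>k<N. f (S ! k)) \<partial>replicate_pmf N p) = (\<integral>\<^sup>+x. f x \<partial>p) ^ N"
proof (induction N)
  case (Suc N)
  show ?case
    by (simp add: prod.lessThan_Suc_shift nn_integral_cmult nn_integral_multc Suc.IH
      del: prod.lessThan_Suc)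
qed simp

lemma chernoff_lower:
  fixes f :: "'a \<Rightarrow> real" and p :: "'a pmf"
  assumes "(\<integral>\<^sup>+x. ennreal (exp (- (l * f x))) \<partial>p) \<le> ennreal B" "0 \<le> l" "0 \<le> B"
  shows "measure_pmf.prob p {x. f x \<le> a} \<le> exp (l * a) * B"
proof -
  have "emeasure p {x. f x \<le> a} = (\<integral>\<^sup>+x. indicator {x. f x \<le> a} x \<partial>p)" by simp
  also have "\<dots> \<le> (\<integral>\<^sup>+x. ennreal (exp (l * a)) * ennreal (exp (- (l * f x))) \<partial>p)"
  proof (rule nn_integral_mono)
    fix x
    show "indicator {x. f x \<le> a} x \<le> ennreal (exp (l * a)) * ennreal (exp (- (l * f x)))"
    proof (cases "f x \<le> a")
      case True
      then have "1 \<le> exp (l * a) * exp (- (l * f x))"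
        using assms(2) by (simp add: mult_exp_exp mult_left_mono)
      with True show ?thesis by (simp flip: ennreal_mult ennreal_1 add: ennreal_leI)
    qed simp
  qed
  also have "\<dots> = ennreal (exp (l * a)) * (\<integral>\<^sup>+x. ennreal (exp (- (l * f x))) \<partial>p)"
    by (rule nn_integral_cmult) simp
  also have "\<dots> \<le> ennreal (exp (l * a)) * ennreal B" using assms by (intro mult_left_mono) auto
  finally show ?thesis
    using assms by (simp add: measure_pmf.emeasure_eq_measure flip: ennreal_mult)
qed

lemma load_lower_tail:
  assumes z: "\<And>j c. j < n \<Longrightarrow> c \<in> set_pmf (D j) \<Longrightarrow> 0 \<le> z j c"
      "\<And>j c. j < n \<Longrightarrow> c \<in> set_pmf (D j) \<Longrightarrow> z j c \<le> b"
    and b: "0 < b" and e: "0 \<le> e" "e \<le> 1" and \<mu>: "\<mu> \<le> mean_load n D z"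
  shows "measure_pmf.prob (replicate_pmf N (product_dist n D))
      {S. (\<Sum>k<N. \<Sum>j<n. z j ((S ! k) j)) \<le> (1 - 2 * e) * (N * \<mu>)} \<le> exp (- (e\<^sup>2 * N * \<mu> / b))"
proof -
  \<comment> \<open>With this \<open>l\<close> the exponential moment loses a factor 1 - e of the
    mean. The remaining distance to 1 - 2 e, times \<open>l\<close>, gives the exponent
    \<open>e\<^sup>2 * N * \<mu> / b\<close>.\<close>
  define l where "l = e / b"
  have l: "0 \<le> l" "l * b = e" using e b by (auto simp: l_def)
  let ?m = "mean_load n D z"
  have "(\<integral>\<^sup>+S. ennreal (exp (- (l * (\<Sum>k<N. \<Sum>j<n. z j ((S ! k) j))))) \<partial>replicate_pmf N (product_dist n D))
      = (\<integral>\<^sup>+S. (\<Prod>k<N. ennreal (exp (- (l * (\<Sum>j<n. z j ((S ! k) j)))))) \<partial>replicate_pmf N (product_dist n D))"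
    by (simp add: prod_ennreal exp_sum[symmetric] sum_distrib_left[of l _ "{..<N}"] sum_negf)
  also have "\<dots> = (\<integral>\<^sup>+P. ennreal (exp (- (l * (\<Sum>j<n. z j (P j))))) \<partial>product_dist n D) ^ N"
    by (rule nn_integral_replicate_pmf_prod)
  also have "\<dots> \<le> ennreal (exp (- (l * (1 - l * b) * ?m))) ^ N"
    by (intro power_mono mgf_load z l) auto
  also have "\<dots> = ennreal (exp (- (l * (1 - e) * (N * ?m))))"
    unfolding l(2) by (simp add: ennreal_power exp_of_nat_mult[symmetric] mult_ac)
  finally have "measure_pmf.prob (replicate_pmf N (product_dist n D))
      {S. (\<Sum>k<N. \<Sum>j<n. z j ((S ! k) j)) \<le> (1 - 2 * e) * (N * \<mu>)}
     \<le> exp (l * ((1 - 2 * e) * (N * \<mu>))) * exp (- (l * (1 - e) * (N * ?m)))"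
    by (intro chernoff_lower l) auto
  also have "\<dots> \<le> exp (l * ((1 - 2 * e) * (N * \<mu>))) * exp (- (l * (1 - e) * (N * \<mu>)))"
    using \<mu> l e by (intro mult_left_mono) (auto intro!: mult_left_mono)
  also have "\<dots> = exp (- (e\<^sup>2 * N * \<mu> / b))"
    by (simp add: mult_exp_exp l_def power2_eq_square algebra_simps diff_divide_distrib add_divide_distrib)
  finally show ?thesis .
qed

text \<open>Jensen turns the expectation of \<open>f\<close> into that of exp (- l f), which is at
  most the sum of the exponentials of the candidates. Taking logarithms costs
  \<open>ln (real (card I)) / l\<close> for the minimum; no tail has to be integrated.\<close>

lemma expectation_softmin:
  fixes p :: "'a pmf" and f :: "'a \<Rightarrow> real" and g :: "'i \<Rightarrow> 'a \<Rightarrow> real"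
  assumes f: "\<And>x. x \<in> set_pmf p \<Longrightarrow> \<bar>f x\<bar> \<le> B"
    and I: "finite I" "I \<noteq> {}" and l: "0 < l"
    and min: "\<And>x. x \<in> set_pmf p \<Longrightarrow> \<exists>i\<in>I. g i x \<le> f x"
    and mgf: "\<And>i. i \<in> I \<Longrightarrow> (\<integral>\<^sup>+x. ennreal (exp (- (l * g i x))) \<partial>measure_pmf p) \<le> ennreal (exp (- (l * a)))"
  shows "a - ln (real (card I)) / l \<le> measure_pmf.expectation p f"
proof -
  let ?E = "measure_pmf.expectation p f"
  have int: "integrable p f" by (rule integrable_pmf_bounded[OF f])
  \<comment> \<open>Jensen's inequality, by integrating the tangent of exp (- l x) at the mean
    \<open>?E\<close>.\<close>
  have "ennreal (exp (- (l * ?E)))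
      = ennreal (measure_pmf.expectation p (\<lambda>x. exp (- (l * ?E)) * (1 - l * (f x - ?E))))"
    using int by (simp add: measure_pmf.prob_space)
  also have "\<dots> \<le> ennreal (measure_pmf.expectation p (\<lambda>x. exp (- (l * f x))))"
  proof (intro ennreal_leI integral_mono_AE AE_pmfI)
    show "integrable p (\<lambda>x. exp (- (l * f x)))"
    proof (rule integrable_pmf_bounded[of _ _ "exp (l * B)"])
      fix x assume "x \<in> set_pmf p"
      then have "l * - f x \<le> l * B" using f[of x] l by (intro mult_left_mono) auto
      then show "\<bar>exp (- (l * f x))\<bar> \<le> exp (l * B)" by simp
    qed
    fix x
    have "exp (- (l * ?E)) * (1 - l * (f x - ?E)) \<le> exp (- (l * ?E)) * exp (- (l * (f x - ?E)))"
      using exp_ge_add_one_self[of "- (l * (f x - ?E))"] by (intro mult_left_mono) auto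
    then show "exp (- (l * ?E)) * (1 - l * (f x - ?E)) \<le> exp (- (l * f x))"
      by (simp add: mult_exp_exp algebra_simps)
  qed (use int in auto)
  also have "\<dots> = (\<integral>\<^sup>+x. ennreal (exp (- (l * f x))) \<partial>measure_pmf p)"
  proof (rule nn_integral_pmf_bounded[symmetric, of _ _ "exp (l * B)"])
    fix x assume "x \<in> set_pmf p"
    then have "l * - f x \<le> l * B" using f[of x] l by (intro mult_left_mono) auto
    then show "exp (- (l * f x)) \<le> exp (l * B)" by simp
  qed simp
  also have "\<dots> \<le> (\<integral>\<^sup>+x. (\<Sum>i\<in>I. ennreal (exp (- (l * g i x)))) \<partial>measure_pmf p)"
  proof (intro nn_integral_mono_AE AE_pmfI)
    fix x assume "x \<in> set_pmf p"
    then obtain i where i: "i \<in> I" "g i x \<le> f x" using min by blast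
    then have "ennreal (exp (- (l * f x))) \<le> ennreal (exp (- (l * g i x)))"
      using l by (intro ennreal_leI) simp
    also have "\<dots> \<le> (\<Sum>i\<in>I. ennreal (exp (- (l * g i x))))"
      using I i by (intro member_le_sum) auto
    finally show "ennreal (exp (- (l * f x))) \<le> (\<Sum>i\<in>I. ennreal (exp (- (l * g i x))))" .
  qed
  also have "\<dots> = (\<Sum>i\<in>I. \<integral>\<^sup>+x. ennreal (exp (- (l * g i x))) \<partial>measure_pmf p)" by (rule nn_integral_sum) simp
  also have "\<dots> \<le> (\<Sum>i\<in>I. ennreal (exp (- (l * a))))" by (intro sum_mono mgf)
  also have "\<dots> = ennreal (real (card I) * exp (- (l * a)))"
    by (simp add: ennreal_mult ennreal_of_nat_eq_real_of_nat)
  also have "real (card I) * exp (- (l * a)) = exp (ln (real (card I)) - l * a)"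
    using I by (simp add: exp_diff exp_minus field_simps card_gt_0_iff)
  finally have "- (l * ?E) \<le> ln (real (card I)) - l * a" by simp
  then show ?thesis using l by (simp add: field_simps)
qed

section \<open>Allocations\<close>

definition bounded_columns ::
  "nat \<Rightarrow> nat \<Rightarrow> (nat \<Rightarrow> column pmf) \<Rightarrow>
   real \<Rightarrow> bool" where
  "bounded_columns m n D b \<longleftrightarrow> (\<forall>j<n. \<forall>c\<in>set_pmf (D j). \<forall>i<m. 0 < c i \<and> c i \<le> b)"

lemma bounded_columnsD:
  assumes "bounded_columns m n D b" "j < n" "c \<in> set_pmf (D j)" "i < m"
  shows "0 < c i" "c i \<le> b"
  using assms by (auto simp: bounded_columns_def)

lemma prob_pmf_mono:
  assumes "\<And>x. x \<in> A \<Longrightarrow> x \<in> set_pmf p \<Longrightarrow> x \<in> B"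
  shows "measure_pmf.prob p A \<le> measure_pmf.prob p B"
  using assms by (intro measure_pmf.finite_measure_mono_AE) (auto intro!: AE_pmfI)

lemma load_bounds:
  assumes D: "bounded_columns m n D b" and P: "P \<in> set_pmf (product_dist n D)" and i: "i < m"
    and X: "\<And>j. j < n \<Longrightarrow> 0 \<le> X j i \<and> X j i \<le> 1"
  shows "0 \<le> load n P X i" "load n P X i \<le> n * b"
proof -
  have *: "0 \<le> P j i * X j i \<and> P j i * X j i \<le> b" if j: "j < n" for j
  proof -
    have "0 < P j i" "P j i \<le> b"
      using bounded_columnsD[OF D j product_dist_column[OF P j] i] by auto
    with X[OF j] mult_mono[of "P j i" b "X j i" 1] show ?thesis by auto
  qed
  then have "load n P X i \<le> (\<Sum>j<n. b)" unfolding load_def by (intro sum_mono) auto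
  then show "load n P X i \<le> n * b" by simp
  show "0 \<le> load n P X i" unfolding load_def using * by (intro sum_nonneg) auto
qed

lemma min_load_attained: "0 < m \<Longrightarrow> \<exists>i<m. min_load m n P X = load n P X i"
proof -
  assume "0 < m"
  then have "min_load m n P X \<in> (\<lambda>i. load n P X i) ` {..<m}"
    unfolding min_load_def by (intro Min_in) auto
  then show ?thesis by auto
qed

lemma min_load_bounds:
  assumes D: "bounded_columns m n D b" and P: "P \<in> set_pmf (product_dist n D)" and m: "0 < m"
    and X: "\<And>i j. i < m \<Longrightarrow> j < n \<Longrightarrow> 0 \<le> X j i \<and> X j i \<le> 1"
  shows "0 \<le> min_load m n P X" "min_load m n P X \<le> n * b"
  using min_load_attained[OF m, of n P X] load_bounds[OF D P _ X] by fastforce+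

lemma opt_snt_bounds:
  assumes D: "bounded_columns m n D b" and P: "P \<in> set_pmf (product_dist n D)" and m: "0 < m"
  shows "0 \<le> opt_snt m n P" "opt_snt m n P \<le> n * b"
proof -
  obtain X where X: "feasible m n X" "opt_snt m n P = min_load m n P X"
    using opt_snt_attained[OF m] by blast
  have "0 \<le> X j i \<and> X j i \<le> 1" if "i < m" "j < n" for i j
    using X(1) that by (auto simp: feasible_def)
  from min_load_bounds[OF D P m this]
  show "0 \<le> opt_snt m n P" "opt_snt m n P \<le> n * b" unfolding X(2) by auto
qed

text \<open>A rule that sees one column at a time loses nothing on average: column \<open>c\<close>
  is divided as an optimal allocation of the whole matrix divides it, averaged over the other
  columns. Resampling column \<open>j\<close> shows that its mean loads are those of the optimal
  allocations. The loads of this rule are sums of independent contributions, so they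
  concentrate.\<close>

lemma fluid_allocation:
  assumes "0 < m" and D: "bounded_columns m n D b"
  obtains X :: "nat \<Rightarrow> column \<Rightarrow> nat \<Rightarrow> real" where
    "\<And>j c i. j < n \<Longrightarrow> i < m \<Longrightarrow> 0 \<le> X j c i \<and> X j c i \<le> 1"
    "\<And>j c. j < n \<Longrightarrow> (\<Sum>i<m. X j c i) = 1"
    "\<And>i. i < m \<Longrightarrow> expected_opt m n D \<le> mean_load n D (\<lambda>j c. c i * X j c i)"
proof -
  let ?p = "product_dist n D"
  have "\<exists>X. feasible m n X \<and> opt_snt m n P = min_load m n P X" for P
    using opt_snt_attained[OF \<open>0 < m\<close>] by blast
  then obtain Xo where Xo: "feasible m n (Xo P)" "opt_snt m n P = min_load m n P (Xo P)" for P
    by metis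
  have Xo01: "0 \<le> Xo P j i" "Xo P j i \<le> 1" if "j < n" "i < m" for P j i
    using Xo(1)[of P] that by (auto simp: feasible_def)
  have Xosum: "(\<Sum>i<m. Xo P j i) = 1" if "j < n" for P j
    using Xo(1)[of P] that by (auto simp: feasible_def)
  define X where "X = (\<lambda>j c i. measure_pmf.expectation ?p (\<lambda>P. Xo (P(j := c)) j i))"
  have int: "integrable ?p (\<lambda>P. Xo (P(j := c)) j i)" if "j < n" "i < m" for j i c
    using Xo01[OF that] by (intro integrable_pmf_bounded[of _ _ 1]) auto
  show ?thesis
  proof
    show "0 \<le> X j c i \<and> X j c i \<le> 1" if "j < n" "i < m" for j c i
      unfolding X_def using Xo01[OF that] int[OF that]
      by (auto intro!: measure_pmf.integral_le_const integral_nonneg_AE)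
    show "(\<Sum>i<m. X j c i) = 1" if "j < n" for j c
    proof -
      have "(\<Sum>i<m. X j c i) = measure_pmf.expectation ?p (\<lambda>P. \<Sum>i<m. Xo (P(j := c)) j i)"
        unfolding X_def using int[OF that] by (subst Bochner_Integration.integral_sum) auto
      then show ?thesis using Xosum[OF that] by (simp add: measure_pmf.prob_space)
    qed
    fix i assume i: "i < m"
    have bd: "0 \<le> P j i * Xo P j i \<and> P j i * Xo P j i \<le> b" if "P \<in> set_pmf ?p" "j < n" for P j
    proof -
      have "0 < P j i" "P j i \<le> b"
        using bounded_columnsD[OF D that(2) product_dist_column[OF that] i] by auto
      with Xo01[OF that(2) i, of P] mult_mono[of "P j i" b "Xo P j i" 1] show ?thesis by auto
    qed
    have "mean_load n D (\<lambda>j c. c i * X j c i)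
        = (\<Sum>j<n. measure_pmf.expectation ?p (\<lambda>P. P j i * Xo P j i))"
      unfolding mean_load_def
    proof (rule sum.cong[OF refl])
      fix j assume "j \<in> {..<n}"
      then have j: "j < n" by simp
      let ?h = "\<lambda>P. P j i * Xo P j i"
      have "measure_pmf.expectation ?p ?h = measure_pmf.expectation
          (bind_pmf (D j) (\<lambda>c. map_pmf (\<lambda>P. P(j := c)) ?p)) ?h"
        by (simp only: product_dist_resample[OF j])
      also have "\<dots> = measure_pmf.expectation (D j)
          (\<lambda>c. measure_pmf.expectation (map_pmf (\<lambda>P. P(j := c)) ?p) ?h)"
        by (rule expectation_bind_pmf_bounded[where B = b])
           (use bd j in \<open>auto simp: product_dist_resample[OF j] simp del: set_bind_pmf\<close>)
      also have "\<dots> = measure_pmf.expectation (D j) (\<lambda>c. c i * X j c i)"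
        by (simp add: X_def)
      finally show "measure_pmf.expectation (D j) (\<lambda>c. c i * X j c i)
          = measure_pmf.expectation ?p ?h" ..
    qed
    also have "\<dots> = measure_pmf.expectation ?p (\<lambda>P. load n P (Xo P) i)"
      unfolding load_def
      by (rule Bochner_Integration.integral_sum[symmetric])
         (use bd in \<open>auto intro!: integrable_pmf_bounded[of _ _ b]\<close>)
    also have "\<dots> \<ge> expected_opt m n D"
      unfolding expected_opt_def
    proof (rule expectation_pmf_mono)
      fix P assume P: "P \<in> set_pmf ?p"
      show "\<bar>opt_snt m n P\<bar> \<le> n * b"
        using opt_snt_bounds[OF D P \<open>0 < m\<close>] by simp
      show "\<bar>load n P (Xo P) i\<bar> \<le> n * b"
        using load_bounds[OF D P i, of "Xo P"] Xo01[OF _ i] by simp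
      show "opt_snt m n P \<le> load n P (Xo P) i"
        unfolding Xo(2) min_load_def using i by (intro Min_le) auto
    qed
    finally show "expected_opt m n D \<le> mean_load n D (\<lambda>j c. c i * X j c i)" .
  qed
qed

section \<open>Proportional shares under geometric weights\<close>

definition share ::
  "nat \<Rightarrow> real \<Rightarrow> (nat \<Rightarrow> real) \<Rightarrow>
   column \<Rightarrow> nat \<Rightarrow> real" where
  "share m \<alpha> w c i = c i powr \<alpha> * w i / (\<Sum>k<m. c k powr \<alpha> * w k)"

lemma prop_alloc_share: "prop_alloc m \<alpha> w P j i = share m \<alpha> w (P j) i"
  by (simp add: prop_alloc_def share_def)

lemma share_nonneg: "(\<And>k. k < m \<Longrightarrow> 0 \<le> w k) \<Longrightarrow> i < m \<Longrightarrow> 0 \<le> share m \<alpha> w c i"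
  unfolding share_def by (intro divide_nonneg_nonneg sum_nonneg mult_nonneg_nonneg) auto

lemma share_le_1:
  assumes "\<And>k. k < m \<Longrightarrow> 0 \<le> w k" "i < m"
  shows "share m \<alpha> w c i \<le> 1"
proof -
  have "c i powr \<alpha> * w i \<le> (\<Sum>k<m. c k powr \<alpha> * w k)"
    using assms by (intro member_le_sum) auto
  then show ?thesis unfolding share_def
    using assms by (intro divide_le_eq_1[THEN iffD2]) (auto simp: less_le intro!: sum_nonneg mult_nonneg_nonneg)
qed

text \<open>After cross-multiplication the powers \<open>\<rho> ^ (q i + q' k)\<close> and
  \<open>\<rho> ^ (q' i + q k)\<close> are compared term by term, and the hypothesis is the
  inequality of their exponents. Entries are arbitrary reals because the levels have to be
  substitutes for every column, not only for those in the support.\<close>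

lemma share_mono:
  fixes \<rho> :: real
  assumes \<rho>: "1 \<le> \<rho>" and i: "i < m"
    and q: "\<And>k. k < m \<Longrightarrow> int (q' k) - int (q' i) \<le> int (q k) - int (q i)"
  shows "share m \<alpha> (\<lambda>k. \<rho> ^ q k) c i \<le> share m \<alpha> (\<lambda>k. \<rho> ^ q' k) c i"
proof (cases "c i powr \<alpha> = 0")
  case False
  let ?a = "\<lambda>k. c k powr \<alpha>"
  have ai: "0 < ?a i" using False by (simp add: less_le)
  have pos: "0 < (\<Sum>k<m. ?a k * \<rho> ^ f k)" for f :: "nat \<Rightarrow> nat"
    using \<rho> i ai by (intro sum_pos2[of _ i]) auto
  have "?a i * \<rho> ^ q i * (\<Sum>k<m. ?a k * \<rho> ^ q' k) = ?a i * (\<Sum>k<m. ?a k * \<rho> ^ (q i + q' k))"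
    by (simp add: sum_distrib_left power_add mult_ac)
  also have "\<dots> \<le> ?a i * (\<Sum>k<m. ?a k * \<rho> ^ (q' i + q k))"
    using \<rho> q by (intro mult_left_mono sum_mono power_increasing) force+
  also have "\<dots> = ?a i * \<rho> ^ q' i * (\<Sum>k<m. ?a k * \<rho> ^ q k)"
    by (simp add: sum_distrib_left power_add mult_ac)
  finally show ?thesis
    unfolding share_def using pos[of q] pos[of q'] by (simp add: divide_simps mult_ac)
qed (simp add: share_def)

text \<open>Lowering the own exponent by one divides the numerator by \<rho> and can only shrink the
  denominator. So a weight that is minimal on the grid exceeds its threshold load by little more
  than a factor \<rho>.\<close>

lemma share_Suc_le:
  fixes \<rho> :: real
  assumes \<rho>: "1 \<le> \<rho>" and i: "i < m" and q: "0 < q i"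
  shows "share m \<alpha> (\<lambda>k. \<rho> ^ q k) c i \<le> \<rho> * share m \<alpha> (\<lambda>k. \<rho> ^ (q(i := q i - 1)) k) c i"
proof (cases "c i powr \<alpha> = 0")
  case False
  let ?a = "\<lambda>k. c k powr \<alpha>" and ?q = "q(i := q i - 1)"
  have ai: "0 < ?a i" using False by (simp add: less_le)
  have pos: "0 < (\<Sum>k<m. ?a k * \<rho> ^ f k)" for f :: "nat \<Rightarrow> nat"
    using \<rho> i ai by (intro sum_pos2[of _ i]) auto
  have le: "(\<Sum>k<m. ?a k * \<rho> ^ ?q k) \<le> (\<Sum>k<m. ?a k * \<rho> ^ q k)"
    using \<rho> by (intro sum_mono mult_left_mono power_increasing) auto
  have eq: "\<rho> ^ q i = \<rho> * \<rho> ^ ?q i" using q by (simp flip: power_Suc)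
  have "share m \<alpha> (\<lambda>k. \<rho> ^ q k) c i = \<rho> * (?a i * \<rho> ^ ?q i) / (\<Sum>k<m. ?a k * \<rho> ^ q k)"
    unfolding share_def eq by (simp add: mult_ac)
  also have "\<dots> \<le> \<rho> * (?a i * \<rho> ^ ?q i) / (\<Sum>k<m. ?a k * \<rho> ^ ?q k)"
    using \<rho> pos[of ?q] by (intro divide_left_mono le mult_pos_pos pos) auto
  finally show ?thesis by (simp add: share_def)
qed (simp add: share_def)

text \<open>With s = - ln x the left side is at most s exp (- a s). This bounds the value lost to an
  agent that is worth only the fraction x of the best one and receives weight
  \<open>x powr a\<close>.\<close>

lemma one_minus_mult_powr_le:
  fixes x a :: real
  assumes "0 < x" "x \<le> 1" "0 < a"
  shows "(1 - x) * x powr a \<le> 1 / a"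
proof -
  define s where "s = - ln x"
  have s: "0 \<le> s" "1 - x \<le> s" using assms ln_le_minus_one[of x] by (auto simp: s_def)
  have "x powr a = exp (- (a * s))" using assms by (simp add: powr_def s_def)
  then have "(1 - x) * x powr a \<le> s * exp (- (a * s))" using s by (simp add: mult_right_mono)
  also have "\<dots> = (a * s) * exp (- (a * s)) / a" using assms by simp
  also have "(a * s) * exp (- (a * s)) \<le> exp (a * s) * exp (- (a * s))"
  proof (rule mult_right_mono)
    have "1 + a * s \<le> exp (a * s)" by (rule exp_ge_add_one_self)
    then show "a * s \<le> exp (a * s)" by linarith
  qed simp
  finally show ?thesis using assms by (simp add: mult_exp_exp divide_right_mono)
qed

text \<open>The weights \<open>w\<close> act as prices \<open>w powr (1 / \<alpha>)\<close>: up to a factor \<open>1 - e\<close> the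
  proportional shares maximise the price-weighted value, as the best agent alone would.\<close>

lemma share_softmax:
  fixes w c X :: "nat \<Rightarrow> real"
  assumes c: "\<And>i. i < m \<Longrightarrow> 0 < c i" and w: "\<And>i. i < m \<Longrightarrow> 0 < w i" and m: "0 < m"
    and X: "\<And>i. i < m \<Longrightarrow> 0 \<le> X i" "(\<Sum>i<m. X i) = 1"
    and \<alpha>: "0 < \<alpha>" "real m \<le> e * \<alpha>" and e: "0 < e" "e < 1"
  shows "(1 - e) * (\<Sum>i<m. w i powr (1 / \<alpha>) * (c i * X i))
    \<le> (\<Sum>i<m. w i powr (1 / \<alpha>) * (c i * share m \<alpha> w c i))"
proof -
  define a where "a = (\<lambda>i. w i powr (1 / \<alpha>) * c i)"
  define M where "M = Max (a ` {..<m})"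
  have a: "0 < a i" if "i < m" for i using c[OF that] w[OF that] by (simp add: a_def)
  have "M \<in> a ` {..<m}" unfolding M_def using m by (intro Max_in) auto
  then obtain i0 where i0: "i0 < m" "M = a i0" by auto
  have M: "0 < M" using a i0 by simp
  have aM: "a i \<le> M" if "i < m" for i using that by (simp add: M_def)
  define b where "b = (\<lambda>i. a i / M)"
  have b: "0 < b i" "b i \<le> 1" if "i < m" for i using a[OF that] aM[OF that] M by (auto simp: b_def)
  define Z where "Z = (\<Sum>k<m. b k powr \<alpha>)"
  have Z: "1 \<le> Z"
  proof -
    have "b i0 powr \<alpha> \<le> Z" unfolding Z_def using i0 by (intro member_le_sum) auto
    moreover have "b i0 = 1" using i0 M by (simp add: b_def)
    ultimately show ?thesis by simp
  qed
  have share: "share m \<alpha> w c i = b i powr \<alpha> / Z" if i: "i < m" for i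
  proof -
    have "c k powr \<alpha> * w k = M powr \<alpha> * b k powr \<alpha>" if "k < m" for k
    proof -
      have "M powr \<alpha> * b k powr \<alpha> = (M * b k) powr \<alpha>"
        using M b[OF that] by (simp add: powr_mult)
      also have "M * b k = a k" using M by (simp add: b_def)
      also have "a k powr \<alpha> = c k powr \<alpha> * w k"
        using c[OF that] w[OF that] \<alpha> by (simp add: a_def powr_mult powr_powr mult.commute)
      finally show ?thesis ..
    qed
    then show ?thesis unfolding share_def Z_def using i M by (simp flip: sum_distrib_left)
  qed
  have "(\<Sum>i<m. w i powr (1 / \<alpha>) * (c i * X i)) = (\<Sum>i<m. a i * X i)"
    by (simp add: a_def mult_ac)
  also have "\<dots> \<le> (\<Sum>i<m. M * X i)" using aM X by (intro sum_mono mult_right_mono) auto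
  also have "\<dots> = M" using X by (simp flip: sum_distrib_left)
  finally have "(1 - e) * (\<Sum>i<m. w i powr (1 / \<alpha>) * (c i * X i)) \<le> (1 - e) * M"
    using e by (intro mult_left_mono) auto
  also have "\<dots> \<le> M * ((\<Sum>i<m. b i * b i powr \<alpha>) / Z)"
  proof -
    \<comment> \<open>Each agent loses at most \<open>1 / \<alpha>\<close>, all of them at most
      \<open>m / \<alpha> \<le> e\<close>, while the normalisation \<open>Z\<close> is at least 1
      thanks to the best agent. Hence the choice of an exponent of order m / e.\<close>
    have "(\<Sum>i<m. (1 - b i) * b i powr \<alpha>) \<le> (\<Sum>i<m. 1 / \<alpha>)"
      using b \<alpha> by (intro sum_mono one_minus_mult_powr_le) auto
    also have "\<dots> \<le> e" using \<alpha> by (simp add: field_simps)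
    also have "\<dots> \<le> e * Z" using Z e by simp
    finally have "(1 - e) * Z \<le> (\<Sum>i<m. b i * b i powr \<alpha>)"
      by (simp add: Z_def left_diff_distrib sum_subtractf)
    then have "1 - e \<le> (\<Sum>i<m. b i * b i powr \<alpha>) / Z" using Z by (simp add: field_simps)
    from mult_left_mono[OF this, of M] M show ?thesis by (simp only: mult.commute[of "1 - e"])
  qed
  also have "\<dots> = (\<Sum>i<m. M * b i * (b i powr \<alpha> / Z))"
    by (simp add: sum_distrib_left sum_divide_distrib mult_ac)
  also have "\<dots> = (\<Sum>i<m. w i powr (1 / \<alpha>) * (c i * share m \<alpha> w c i))"
    using M by (intro sum.cong refl) (simp add: share b_def a_def)
  finally show ?thesis .
qed

section \<open>Integer levels\<close>

text \<open>Rounding is done per item, so that a level remains a sum over items and swaps act on its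
  terms. The price is an error of up to \<delta> for every item.\<close>

definition item_level ::
  "nat \<Rightarrow> real \<Rightarrow> real \<Rightarrow> real \<Rightarrow> nat \<Rightarrow>
   column \<Rightarrow> (nat \<Rightarrow> nat) \<Rightarrow> nat" where
  "item_level m \<alpha> \<rho> \<delta> i c q = nat \<lfloor>c i * share m \<alpha> (\<lambda>k. \<rho> ^ q k) c i / \<delta>\<rfloor>"

lemma substitutes_item_level:
  assumes "1 \<le> \<rho>" "0 < \<delta>" "i < m"
  shows "substitutes m i (item_level m \<alpha> \<rho> \<delta> i c)"
  unfolding substitutes_def
proof (intro allI impI)
  fix q q' :: "nat \<Rightarrow> nat"
  assume q: "\<forall>k<m. int (q' k) - int (q' i) \<le> int (q k) - int (q i)"
  let ?s = "\<lambda>q. share m \<alpha> (\<lambda>k. \<rho> ^ q k) c i"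
  have s: "?s q \<le> ?s q'" using assms q by (intro share_mono) auto
  have s0: "0 \<le> ?s q" for q using assms by (intro share_nonneg) auto
  show "item_level m \<alpha> \<rho> \<delta> i c q \<le> item_level m \<alpha> \<rho> \<delta> i c q'"
  proof (cases "0 \<le> c i")
    case True
    then show ?thesis unfolding item_level_def
      using s assms by (intro nat_mono floor_mono divide_right_mono mult_left_mono) auto
  next
    \<comment> \<open>Columns outside the support may have negative entries; there
      \<open>nat\<close> makes the level 0.\<close>
    case False
    then have "c i * ?s q / \<delta> \<le> 0"
      using s0[of q] assms by (simp add: divide_le_0_iff mult_nonpos_nonneg)
    then have "\<lfloor>c i * ?s q / \<delta>\<rfloor> \<le> 0" by linarith
    then show ?thesis by (simp add: item_level_def)
  qed
qed

lemma substitutes_sum: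
  assumes "\<And>a. a \<in> A \<Longrightarrow> substitutes m i (h a)"
  shows "substitutes m i (\<lambda>q. \<Sum>a\<in>A. h a q)"
  using assms unfolding substitutes_def by (meson sum_mono)

lemma substitutes_level:
  assumes "\<And>c. substitutes m i (h c)"
  shows "substitutes m i (level n h S)"
proof -
  have "substitutes m i (\<lambda>q. \<Sum>k<length S. \<Sum>j<n. h ((S ! k) j) q)"
    by (intro substitutes_sum assms)
  then show ?thesis by (simp add: substitutes_def level_def)
qed

lemma item_level_bounds:
  assumes "0 \<le> c i" "i < m" "0 < \<delta>" "0 \<le> \<rho>"
  shows "real (item_level m \<alpha> \<rho> \<delta> i c q) \<le> c i * share m \<alpha> (\<lambda>k. \<rho> ^ q k) c i / \<delta>"
    "c i * share m \<alpha> (\<lambda>k. \<rho> ^ q k) c i / \<delta> \<le> real (item_level m \<alpha> \<rho> \<delta> i c q) + 1"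
proof -
  have "0 \<le> share m \<alpha> (\<lambda>k. \<rho> ^ q k) c i" using assms by (intro share_nonneg) auto
  then have "0 \<le> c i * share m \<alpha> (\<lambda>k. \<rho> ^ q k) c i / \<delta>" using assms by simp
  then show "real (item_level m \<alpha> \<rho> \<delta> i c q) \<le> c i * share m \<alpha> (\<lambda>k. \<rho> ^ q k) c i / \<delta>"
    "c i * share m \<alpha> (\<lambda>k. \<rho> ^ q k) c i / \<delta> \<le> real (item_level m \<alpha> \<rho> \<delta> i c q) + 1"
    unfolding item_level_def by linarith+
qed

definition sample_load ::
  "nat \<Rightarrow> (nat \<Rightarrow> column \<Rightarrow> real) \<Rightarrow>
   matrix list \<Rightarrow> real" where
  "sample_load n z S = (\<Sum>k<length S. \<Sum>j<n. z j ((S ! k) j))"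

definition share_load ::
  "nat \<Rightarrow> nat \<Rightarrow> real \<Rightarrow> (nat \<Rightarrow> real) \<Rightarrow>
   matrix list \<Rightarrow> nat \<Rightarrow> real" where
  "share_load m n \<alpha> w S i = sample_load n (\<lambda>j c. c i * share m \<alpha> w c i) S"

text \<open>
  No exponent of the least solution sits at its bound \<open>K\<close>: the agents with a positive exponent
  have small loads by minimality, while \<open>share_softmax\<close> makes the price-weighted average of
  the loads large; a price as high as \<open>\<rho> powr (K / \<alpha>)\<close> could not be compensated.
\<close>

lemma least_solution_level_reached:
  fixes S :: "matrix list" and X :: "nat \<Rightarrow> column \<Rightarrow> nat \<Rightarrow> real" and hi :: nat
  defines "N \<equiv> length S"
  assumes S: "\<And>k j i. k < N \<Longrightarrow> j < n \<Longrightarrow> i < m \<Longrightarrow> 0 < (S ! k) j i \<and> (S ! k) j i \<le> b"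
    and X: "\<And>j c i. j < n \<Longrightarrow> i < m \<Longrightarrow> 0 \<le> X j c i" "\<And>j c. j < n \<Longrightarrow> (\<Sum>i<m. X j c i) = 1"
    and V: "\<And>i. i < m \<Longrightarrow> V \<le> sample_load n (\<lambda>j c. c i * X j c i) S"
    and \<alpha>: "0 < \<alpha>" "real m \<le> e * \<alpha>" and e: "0 < e" "e < 1"
    and \<rho>: "1 \<le> \<rho>" and \<delta>: "0 < \<delta>" and b: "0 \<le> b"
    and \<tau>: "\<And>i. i < m \<Longrightarrow> \<tau> i \<le> hi"
    and A: "\<rho> * (\<delta> * (hi + real N * n)) \<le> A" "A < (1 - e) * V"
    and K: "0 < K" "m * (N * n * b) < \<rho> powr (K / \<alpha>) * ((1 - e) * V - A)"
    and i: "i < m"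
  defines "q \<equiv> least_solution m K (\<lambda>i. level n (item_level m \<alpha> \<rho> \<delta> i) S) \<tau>"
  shows "\<tau> i \<le> level n (item_level m \<alpha> \<rho> \<delta> i) S q"
proof (rule ccontr)
  assume less: "\<not> \<tau> i \<le> level n (item_level m \<alpha> \<rho> \<delta> i) S q"
  let ?H = "\<lambda>i. level n (item_level m \<alpha> \<rho> \<delta> i) S"
  have gr: "substitutes m k (?H k)" if "k < m" for k
    by (intro substitutes_level substitutes_item_level \<rho> \<delta> that)
  have qs: "q \<in> solutions m K ?H \<tau>" unfolding q_def by (intro least_solution_solutions substitutes_others_antitone gr)
  have qK: "q i = K" using solutions_level[OF qs i] less by simp
  define w where "w = (\<lambda>k. \<rho> ^ q k)"
  have w1: "1 \<le> w k" for k using \<rho> by (simp add: w_def)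
  define y where "y = (\<lambda>k. w k powr (1 / \<alpha>))"
  have y1: "1 \<le> y k" for k using w1[of k] \<alpha> by (simp add: y_def ge_one_powr_ge_zero)
  define L where "L = share_load m n \<alpha> w S"
  \<comment> \<open>If an agent with positive exponent still met its threshold one step lower, the
    lowered vector would be a smaller solution. So its level there is below \<open>hi\<close>;
    undoing the rounding adds at most \<open>N * n\<close> units and undoing the step a factor
    \<rho>.\<close>
  have raised: "L k \<le> A" if k: "k < m" "0 < q k" for k
  proof -
    define q' where "q' = q(k := q k - 1)"
    have lt: "?H k q' < \<tau> k"
    proof (rule ccontr)
      assume "\<not> ?H k q' < \<tau> k"
      then have "q' l = K \<or> \<tau> l \<le> ?H l q'" if l: "l < m" for l
      proof (cases "l = k")
        case False
        have "?H l q \<le> ?H l q'"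
          using substitutes_others_antitone[OF gr[OF l]] False unfolding others_antitone_def by (auto simp: q'_def)
        with solutions_level[OF qs l] False show ?thesis by (auto simp: q'_def)
      qed simp
      then have "q' \<in> solutions m K ?H \<tau>"
        using solutions_bounds[OF qs] k unfolding solutions_def q'_def by (auto intro: le_trans[OF diff_le_self])
      from least_solution_le[OF this, of k] k show False by (simp add: q_def[symmetric] q'_def)
    qed
    have "L k \<le> (\<Sum>l<N. \<Sum>j<n. \<rho> * (\<delta> * (real (item_level m \<alpha> \<rho> \<delta> k ((S ! l) j) q') + 1)))"
      unfolding L_def share_load_def sample_load_def N_def[symmetric]
    proof (intro sum_mono)
      fix l j assume lj: "l \<in> {..<N}" "j \<in> {..<n}"
      let ?c = "(S ! l) j"
      have c: "0 < ?c k" using S[of l j k] lj k by auto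
      have "?c k * share m \<alpha> w ?c k \<le> ?c k * (\<rho> * share m \<alpha> (\<lambda>k. \<rho> ^ q' k) ?c k)"
        unfolding w_def q'_def using c k \<rho> by (intro mult_left_mono share_Suc_le) auto
      also have "\<dots> = \<rho> * (\<delta> * (?c k * share m \<alpha> (\<lambda>k. \<rho> ^ q' k) ?c k / \<delta>))"
        using \<delta> by simp
      also have "\<dots> \<le> \<rho> * (\<delta> * (real (item_level m \<alpha> \<rho> \<delta> k ?c q') + 1))"
        using \<rho> \<delta> c k by (intro mult_left_mono item_level_bounds(2)) auto
      finally show "?c k * share m \<alpha> w ?c k \<le> \<rho> * (\<delta> * (real (item_level m \<alpha> \<rho> \<delta> k ?c q') + 1))" .
    qed
    also have "\<dots> = \<rho> * (\<delta> * (real (?H k q') + real N * n))"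
      by (simp add: level_def N_def sum_distrib_left[symmetric] sum.distrib)
    also have "\<dots> \<le> \<rho> * (\<delta> * (hi + real N * n))"
    proof -
      have "real (?H k q') \<le> hi" using lt \<tau>[OF k(1)] by linarith
      then show ?thesis using \<rho> \<delta> by (intro mult_left_mono) auto
    qed
    finally show ?thesis using A by simp
  qed
  have unraised: "L k \<le> N * n * b" if k: "k < m" for k
  proof -
    have "L k \<le> (\<Sum>l<N. \<Sum>j<n. b)"
      unfolding L_def share_load_def sample_load_def N_def[symmetric]
    proof (intro sum_mono)
      fix l j assume lj: "l \<in> {..<N}" "j \<in> {..<n}"
      have "0 < (S ! l) j k" "(S ! l) j k \<le> b" using S[of l j k] lj k by auto
      moreover have "share m \<alpha> w ((S ! l) j) k \<le> 1"
        by (rule share_le_1[OF _ k]) (use w1 in \<open>auto intro: order_trans[of 0 1]\<close>)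
      ultimately show "(S ! l) j k * share m \<alpha> w ((S ! l) j) k \<le> b"
        by (smt (verit) mult_left_le)
    qed
    then show ?thesis by simp
  qed
  have avg: "(1 - e) * (\<Sum>k<m. y k * V) \<le> (\<Sum>k<m. y k * L k)"
  proof -
    have sw: "(\<Sum>k<m. y k * sample_load n (\<lambda>j c. c k * f j c k) S)
        = (\<Sum>l<N. \<Sum>j<n. \<Sum>k<m. y k * ((S ! l) j k * f j ((S ! l) j) k))" for f
      unfolding sample_load_def N_def[symmetric]
      by (simp add: sum_distrib_left) (rule trans[OF sum.swap], rule sum.cong[OF refl], rule sum.swap)
    have "(1 - e) * (\<Sum>k<m. y k * V) \<le> (1 - e) * (\<Sum>k<m. y k * sample_load n (\<lambda>j c. c k * X j c k) S)"
      using e y1 V by (intro mult_left_mono sum_mono) (auto intro: order_trans[of 0 1])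
    also have "\<dots> = (\<Sum>l<N. \<Sum>j<n. (1 - e) * (\<Sum>k<m. y k * ((S ! l) j k * X j ((S ! l) j) k)))"
      unfolding sw by (simp add: sum_distrib_left)
    also have "\<dots> \<le> (\<Sum>l<N. \<Sum>j<n. \<Sum>k<m. y k * ((S ! l) j k * share m \<alpha> w ((S ! l) j) k))"
    proof (intro sum_mono)
      fix l j assume "l \<in> {..<N}" "j \<in> {..<n}"
      then show "(1 - e) * (\<Sum>k<m. y k * ((S ! l) j k * X j ((S ! l) j) k))
          \<le> (\<Sum>k<m. y k * ((S ! l) j k * share m \<alpha> w ((S ! l) j) k))"
        unfolding y_def using S X \<alpha> e i w1
        by (intro share_softmax) (auto intro: less_le_trans[of 0 1])
    qed
    also have "\<dots> = (\<Sum>k<m. y k * L k)"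
      unfolding L_def share_load_def by (rule sw[of "\<lambda>j c k. share m \<alpha> w c k", symmetric])
    finally show ?thesis .
  qed
  let ?g = "(1 - e) * V - A"
  \<comment> \<open>In the price-weighted excess over \<open>(1 - e) * V\<close>, raised agents
    contribute negatively, and agent \<open>i\<close> does so with price
    \<open>\<rho> powr (K / \<alpha>)\<close>. Agents at exponent 0 have price 1 and can add only
    their trivial load bound. The total is negative, against \<open>avg\<close>.\<close>
  have "(\<Sum>k<m. y k * L k) - (1 - e) * (\<Sum>k<m. y k * V) = (\<Sum>k<m. y k * (L k - (1 - e) * V))"
    by (simp add: sum_distrib_left right_diff_distrib sum_subtractf mult_ac)
  also have "\<dots> = y i * (L i - (1 - e) * V) + (\<Sum>k\<in>{..<m} - {i}. y k * (L k - (1 - e) * V))"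
    using i by (subst sum.remove[of _ i]) auto
  also have "\<dots> \<le> - (y i * ?g) + (\<Sum>k\<in>{..<m} - {i}. N * n * b)"
  proof (intro add_mono sum_mono)
    have "L i \<le> A" using raised[OF i] qK K by simp
    then have "y i * (L i - (1 - e) * V) \<le> y i * (- ?g)"
      using y1[of i] by (intro mult_left_mono) auto
    then show "y i * (L i - (1 - e) * V) \<le> - (y i * ?g)" by (simp only: mult_minus_right)
    fix k assume "k \<in> {..<m} - {i}"
    then have k: "k < m" by simp
    show "y k * (L k - (1 - e) * V) \<le> N * n * b"
    proof (cases "q k = 0")
      case True
      then have "y k = 1" by (simp add: y_def w_def)
      moreover have "0 \<le> (1 - e) * V"
      proof -
        have "0 \<le> \<rho> * (\<delta> * (hi + real N * n))" using \<rho> \<delta> by simp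
        with A show ?thesis by linarith
      qed
      ultimately show ?thesis using unraised[OF k] by simp
    next
      case False
      then have "L k - (1 - e) * V \<le> 0" using raised[OF k] A by simp
      then have "y k * (L k - (1 - e) * V) \<le> 0" using y1[of k] by (intro mult_nonneg_nonpos) auto
      also have "0 \<le> N * n * b" using b by simp
      finally show ?thesis .
    qed
  qed
  also have "\<dots> \<le> - (y i * ?g) + m * (N * n * b)"
  proof -
    have "(\<Sum>k\<in>{..<m} - {i}. real (N * n) * b) \<le> (\<Sum>k<m. real (N * n) * b)"
      using b by (intro sum_mono2) auto
    then show ?thesis by simp
  qed
  also have "y i = \<rho> powr (K / \<alpha>)"
    using \<rho> qK by (simp add: y_def w_def powr_powr flip: powr_realpow)
  finally show False using avg K(2) by simp
qed

section \<open>Generalization\<close>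

text \<open>The first component of \<open>z\<close> is the sample, the second one a ghost sample.\<close>

definition deviates :: "nat \<Rightarrow> nat \<Rightarrow> (nat \<Rightarrow> column \<Rightarrow> (nat \<Rightarrow> nat) \<Rightarrow> nat) \<Rightarrow> real \<Rightarrow> real \<Rightarrow>
    matrix list \<times> matrix list \<Rightarrow> (nat \<Rightarrow> nat) set" where
  "deviates m n h lo \<eta> z = {q. \<exists>i<m.
     lo \<le> real (level n (h i) (fst z) q) + real (level n (h i) (snd z) q) \<and>
     \<eta> * (real (level n (h i) (fst z) q) + real (level n (h i) (snd z) q))
       \<le> \<bar>real (level n (h i) (fst z) q) - real (level n (h i) (snd z) q)\<bar>}"

text \<open>For a fixed threshold vector the solution for both samples is invariant under swaps, so
  \<open>ghost_deviation\<close> bounds its deviations. \<open>hybrid_sum\<close> with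
  \<open>L = hi\<close> and \<open>L' = 3 * hi\<close> carries this over to the solutions for the
  first sample alone; the weights then add up to \<open>(4 * hi) ^ m\<close>.\<close>

lemma expected_deviations:
  fixes D :: "nat \<Rightarrow> column pmf" and h :: "nat \<Rightarrow> column \<Rightarrow> (nat \<Rightarrow> nat) \<Rightarrow> nat" and n N :: nat
  defines "p \<equiv> product_dist n D"
  defines "M \<equiv> pair_pmf (replicate_pmf N p) (replicate_pmf N p)"
  assumes h: "\<And>i c. i < m \<Longrightarrow> substitutes m i (h i c)"
    and hb: "\<And>i j c q. i < m \<Longrightarrow> j < n \<Longrightarrow> c \<in> set_pmf (D j) \<Longrightarrow> real (h i c q) \<le> B"
    and B: "0 < B" and \<eta>: "0 < \<eta>" "\<eta> \<le> 1 / 3" and hi: "1 \<le> hi" and lo: "lo \<le> real hi"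
  shows "(\<integral>\<^sup>+z. ennreal (real (card {\<tau>\<in>{..<m} \<rightarrow>\<^sub>E {1..hi}.
      least_solution m K (\<lambda>i. level n (h i) (fst z)) \<tau> \<in> deviates m n h lo \<eta> z})) \<partial>M)
    \<le> ennreal ((4 * real hi) ^ m * (real m * (2 * exp (- (\<eta>\<^sup>2 * lo / (4 * B))))))"
proof -
  define W where "W = (\<lambda>\<tau>::nat \<Rightarrow> nat. \<Prod>i<m. 1 + (if \<tau> i = 3 * hi then real hi else 0))"
  define y where "y = (\<lambda>\<tau> z. least_solution m K (\<lambda>i q. level n (h i) (fst z) q + level n (h i) (snd z) q) \<tau>)"
  let ?T = "{..<m} \<rightarrow>\<^sub>E {1..3 * hi}"
  let ?E = "\<lambda>\<tau>. {z. y \<tau> z \<in> deviates m n h lo \<eta> z}"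
  have W0: "0 \<le> W \<tau>" for \<tau> unfolding W_def by (intro prod_nonneg) auto
  have gr: "substitutes m i (level n (h i) S)" if "i < m" for i S by (intro substitutes_level h that)
  have count: "real (card {\<tau>\<in>{..<m} \<rightarrow>\<^sub>E {1..hi}.
      least_solution m K (\<lambda>i. level n (h i) (fst z)) \<tau> \<in> deviates m n h lo \<eta> z})
    \<le> (\<Sum>\<tau>\<in>?T. W \<tau> * of_bool (y \<tau> z \<in> deviates m n h lo \<eta> z))" for z
    unfolding W_def y_def
  proof (rule hybrid_sum[OF gr gr])
    fix i q assume i: "i < m" and *: "level n (h i) (fst z) q < hi"
      "3 * hi \<le> level n (h i) (fst z) q + level n (h i) (snd z) q"
    let ?s = "real (level n (h i) (fst z) q)" and ?s' = "real (level n (h i) (snd z) q)"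
    \<comment> \<open>The origin of \<open>3 * hi\<close>: at overflow the first sample accounts for
      at most a third of the sum, so the two levels differ by at least a third of it. Overflow is
      itself a deviation as long as \<open>\<eta> \<le> 1 / 3\<close>.\<close>
    have 1: "?s \<le> hi" "3 * real hi \<le> ?s + ?s'" using * by linarith+
    have "\<eta> * (?s + ?s') \<le> 1 / 3 * (?s + ?s')" using \<eta> by (intro mult_right_mono) auto
    also have "\<dots> \<le> ?s' - ?s" using 1 by (simp add: field_simps)
    also have "\<dots> \<le> \<bar>?s - ?s'\<bar>" by simp
    finally show "q \<in> deviates m n h lo \<eta> z"
      unfolding deviates_def using i 1 lo by auto
  qed (use hi in auto)
  have prob: "measure_pmf.prob M (?E \<tau>) \<le> real m * (2 * exp (- (\<eta>\<^sup>2 * lo / (4 * B))))" for \<tau>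
  proof -
    let ?Ei = "\<lambda>i. {z. lo \<le> real (level n (h i) (fst z) (y \<tau> z)) + real (level n (h i) (snd z) (y \<tau> z)) \<and>
      \<eta> * (real (level n (h i) (fst z) (y \<tau> z)) + real (level n (h i) (snd z) (y \<tau> z))) \<le>
      \<bar>real (level n (h i) (fst z) (y \<tau> z)) - real (level n (h i) (snd z) (y \<tau> z))\<bar>}"
    have "?E \<tau> = (\<Union>i<m. ?Ei i)" by (auto simp: deviates_def)
    then have "measure_pmf.prob M (?E \<tau>) \<le> (\<Sum>i<m. measure_pmf.prob M (?Ei i))"
      by (auto intro!: measure_pmf.finite_measure_subadditive_finite)
    also have "\<dots> \<le> (\<Sum>i<m. 2 * exp (- (\<eta>\<^sup>2 * lo / (4 * B))))"
    proof (rule sum_mono)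
      fix i assume "i \<in> {..<m}"
      then have i: "i < m" by simp
      show "measure_pmf.prob M (?Ei i) \<le> 2 * exp (- (\<eta>\<^sup>2 * lo / (4 * B)))"
        unfolding M_def p_def
      proof (rule ghost_deviation)
        fix k j and z :: "matrix list \<times> matrix list"
        assume "z \<in> set_pmf (pair_pmf (replicate_pmf N (product_dist n D)) (replicate_pmf N (product_dist n D)))"
        then have "length (fst z) = length (snd z)" by (auto simp: set_replicate_pmf)
        from level_swap_item[OF this] show "y \<tau> (swap_item k j z) = y \<tau> z" by (simp add: y_def)
      qed (use hb[OF i] \<eta> B in auto)
    qed
    finally show ?thesis by simp
  qed
  have "(\<integral>\<^sup>+z. ennreal (real (card {\<tau>\<in>{..<m} \<rightarrow>\<^sub>E {1..hi}.
      least_solution m K (\<lambda>i. level n (h i) (fst z)) \<tau> \<in> deviates m n h lo \<eta> z})) \<partial>M)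
    \<le> (\<integral>\<^sup>+z. (\<Sum>\<tau>\<in>?T. ennreal (W \<tau>) * indicator (?E \<tau>) z) \<partial>M)"
  proof (rule nn_integral_mono)
    fix z
    have "(\<Sum>\<tau>\<in>?T. ennreal (W \<tau>) * indicator (?E \<tau>) z)
        = ennreal (\<Sum>\<tau>\<in>?T. W \<tau> * of_bool (y \<tau> z \<in> deviates m n h lo \<eta> z))"
    proof (subst sum_ennreal[symmetric])
      show "(\<Sum>\<tau>\<in>?T. ennreal (W \<tau>) * indicator (?E \<tau>) z)
          = (\<Sum>\<tau>\<in>?T. ennreal (W \<tau> * of_bool (y \<tau> z \<in> deviates m n h lo \<eta> z)))"
        by (rule sum.cong) (auto simp: indicator_def)
    qed (use W0 in auto)
    then show "ennreal (real (card {\<tau>\<in>{..<m} \<rightarrow>\<^sub>E {1..hi}.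
        least_solution m K (\<lambda>i. level n (h i) (fst z)) \<tau> \<in> deviates m n h lo \<eta> z}))
      \<le> (\<Sum>\<tau>\<in>?T. ennreal (W \<tau>) * indicator (?E \<tau>) z)"
      using count[of z] by (simp add: ennreal_leI del: sum_mult_of_bool_eq)
  qed
  also have "\<dots> = (\<Sum>\<tau>\<in>?T. ennreal (W \<tau>) * emeasure M (?E \<tau>))"
    by (subst nn_integral_sum) (auto simp: nn_integral_cmult_indicator)
  also have "\<dots> \<le> (\<Sum>\<tau>\<in>?T. ennreal (W \<tau>) * ennreal (real m * (2 * exp (- (\<eta>\<^sup>2 * lo / (4 * B))))))"
    using prob by (intro sum_mono mult_left_mono)
      (auto simp: measure_pmf.emeasure_eq_measure intro!: ennreal_leI)
  also have "\<dots> = ennreal ((\<Sum>\<tau>\<in>?T. W \<tau>) * (real m * (2 * exp (- (\<eta>\<^sup>2 * lo / (4 * B))))))"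
    using W0 by (simp add: sum_distrib_right ennreal_mult flip: sum_ennreal)
  also have "(\<Sum>\<tau>\<in>?T. W \<tau>) = (real (3 * hi) + real hi) ^ m"
    unfolding W_def using hi by (intro sum_hybrid_weights) auto
  also have "real (3 * hi) + real hi = 4 * real hi" by simp
  finally show ?thesis .
qed

lemma nn_integral_replicate_pmf_sum:
  fixes f :: "'a \<Rightarrow> ennreal"
  shows "(\<integral>\<^sup>+S. (\<Sum>k<N. f (S ! k)) \<partial>replicate_pmf N p) = of_nat N * (\<integral>\<^sup>+x. f x \<partial>p)"
proof (induction N)
  case (Suc N)
  show ?case
    by (simp add: sum.lessThan_Suc_shift nn_integral_add Suc.IH distrib_right ac_simps
      del: sum.lessThan_Suc)
qed simp

text \<open>Markov's inequality is enough: the probability is only \<open>e\<close>, but it enters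
  the final estimate as a single factor 1 / e, not once per agent.\<close>

lemma ghost_level_small:
  fixes t e :: real
  assumes D: "bounded_columns m n D b" and i: "i < m" and \<rho>: "1 \<le> \<rho>" and \<delta>: "0 < \<delta>"
    and t: "0 < t" and e: "0 \<le> e" "e \<le> 1"
    and mean: "N * mean_load n D (\<lambda>j c. c i * share m \<alpha> (\<lambda>k. \<rho> ^ q k) c i) / \<delta> \<le> (1 - e) * t"
  shows "e \<le> measure_pmf.prob (replicate_pmf N (product_dist n D))
      {S. level n (item_level m \<alpha> \<rho> \<delta> i) S q < t}"
proof -
  let ?z = "\<lambda>j c. c i * share m \<alpha> (\<lambda>k. \<rho> ^ q k) c i"
  let ?p = "product_dist n D" and ?h = "item_level m \<alpha> \<rho> \<delta> i"
  let ?R = "replicate_pmf N ?p"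
  have sh: "0 \<le> share m \<alpha> (\<lambda>k. \<rho> ^ q k) c i" "share m \<alpha> (\<lambda>k. \<rho> ^ q k) c i \<le> 1" for c
    using \<rho> i by (auto intro!: share_nonneg share_le_1)
  have z: "0 \<le> ?z j c" "?z j c \<le> b" if "j < n" "c \<in> set_pmf (D j)" for j c
    using bounded_columnsD[OF D that i] sh[of c] mult_mono[of "c i" b "share m \<alpha> (\<lambda>k. \<rho> ^ q k) c i" 1]
    by auto
  have zP: "0 \<le> (\<Sum>j<n. ?z j (P j))" "(\<Sum>j<n. ?z j (P j)) \<le> n * b" if "P \<in> set_pmf ?p" for P
  proof -
    show "0 \<le> (\<Sum>j<n. ?z j (P j))"
      using z product_dist_column[OF that] by (intro sum_nonneg) auto
    have "(\<Sum>j<n. ?z j (P j)) \<le> (\<Sum>j<n. b)"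
      using z product_dist_column[OF that] by (intro sum_mono) auto
    then show "(\<Sum>j<n. ?z j (P j)) \<le> n * b" by simp
  qed
  have "(\<integral>\<^sup>+S. ennreal (level n ?h S q) \<partial>?R) \<le> (\<integral>\<^sup>+S. (\<Sum>k<N. ennreal ((\<Sum>j<n. ?z j ((S ! k) j)) / \<delta>)) \<partial>?R)"
  proof (intro nn_integral_mono_AE AE_pmfI)
    fix S assume S: "S \<in> set_pmf ?R"
    have Sk: "S ! k \<in> set_pmf ?p" if "k < N" for k using S that by (auto simp: set_replicate_pmf)
    have len: "length S = N" using S by (auto simp: set_replicate_pmf)
    have "real (level n ?h S q) \<le> (\<Sum>k<N. (\<Sum>j<n. ?z j ((S ! k) j)) / \<delta>)"
      unfolding level_def len of_nat_sum sum_divide_distrib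
    proof (intro sum_mono item_level_bounds(1) i \<delta>)
      fix k j assume "k \<in> {..<N}" "j \<in> {..<n}"
      then have "j < n" "(S ! k) j \<in> set_pmf (D j)" by (auto intro: product_dist_column[OF Sk])
      from bounded_columnsD(1)[OF D this i] show "0 \<le> (S ! k) j i" by simp
    qed (use \<rho> in auto)
    also have "ennreal \<dots> = (\<Sum>k<N. ennreal ((\<Sum>j<n. ?z j ((S ! k) j)) / \<delta>))"
      using zP(1)[OF Sk] \<delta> by (intro sum_ennreal[symmetric]) auto
    finally show "ennreal (level n ?h S q) \<le> (\<Sum>k<N. ennreal ((\<Sum>j<n. ?z j ((S ! k) j)) / \<delta>))"
      by (simp add: ennreal_leI)
  qed
  also have "\<dots> = of_nat N * (\<integral>\<^sup>+P. ennreal ((\<Sum>j<n. ?z j (P j)) / \<delta>) \<partial>?p)"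
    by (rule nn_integral_replicate_pmf_sum)
  also have "(\<integral>\<^sup>+P. ennreal ((\<Sum>j<n. ?z j (P j)) / \<delta>) \<partial>?p)
      = ennreal (measure_pmf.expectation ?p (\<lambda>P. (\<Sum>j<n. ?z j (P j)) / \<delta>))"
    using zP \<delta> by (intro nn_integral_pmf_bounded[of _ _ "n * b / \<delta>"]) (auto intro: divide_right_mono)
  also have "measure_pmf.expectation ?p (\<lambda>P. (\<Sum>j<n. ?z j (P j)) / \<delta>) = mean_load n D ?z / \<delta>"
    using mean_load_eq[of n D ?z b] z by simp
  also have "of_nat N * ennreal (mean_load n D ?z / \<delta>) = ennreal (N * mean_load n D ?z / \<delta>)"
    by (simp add: ennreal_mult'' ennreal_of_nat_eq_real_of_nat flip: times_divide_eq_right ennreal_mult')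
  also have "\<dots> \<le> ennreal ((1 - e) * t)" using mean by (rule ennreal_leI)
  finally have E: "(\<integral>\<^sup>+S. ennreal (level n ?h S q) \<partial>?R) \<le> ennreal ((1 - e) * t)" .
  let ?A = "{S. t \<le> real (level n ?h S q)}"
  have "ennreal t * emeasure ?R ?A = (\<integral>\<^sup>+S. ennreal t * indicator ?A S \<partial>?R)"
    by (subst nn_integral_cmult_indicator) auto
  also have "\<dots> \<le> (\<integral>\<^sup>+S. ennreal (level n ?h S q) \<partial>?R)"
    by (intro nn_integral_mono) (auto simp: indicator_def intro!: ennreal_leI)
  finally have "ennreal (t * measure_pmf.prob ?R ?A) \<le> ennreal ((1 - e) * t)"
    using E t by (simp add: measure_pmf.emeasure_eq_measure ennreal_mult')
  then have "t * measure_pmf.prob ?R ?A \<le> t * (1 - e)"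
    using e t by (simp add: mult.commute)
  then have "measure_pmf.prob ?R ?A \<le> 1 - e" using t by simp
  moreover have "measure_pmf.prob ?R (- ?A) = 1 - measure_pmf.prob ?R ?A"
    using measure_pmf.prob_compl[of ?A ?R] by (simp add: Compl_eq_Diff_UNIV)
  moreover have "- ?A = {S. level n ?h S q < t}" by auto
  ultimately show ?thesis by simp
qed

text \<open>The solution is determined by \<open>S\<close> and the thresholds, so a ghost sample is
  independent of it. If it is bad, some agent has level above \<open>lo\<close> on \<open>S\<close>
  but a low mean, hence with probability at least \<open>e\<close> a low level on the ghost sample;
  the pair deviates. Bad thresholds are therefore at most 1 / e times the expected number of
  deviating ones. These are counted in the full box up to \<open>hi\<close>, as the injection
  requires, and divided by the size of the box that is drawn from.\<close>

lemma random_solution: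
  fixes lo hi n N :: nat and D :: "nat \<Rightarrow> column pmf" and Feas :: "matrix list set" and e :: real
  defines "R \<equiv> replicate_pmf N (product_dist n D)"
  assumes D: "bounded_columns m n D b" and b: "0 < b" and e: "0 < e" "e < 1"
    and \<rho>: "1 \<le> \<rho>" and \<delta>: "0 < \<delta>" and lo: "0 < lo" "lo < hi"
    and feas: "\<And>S \<tau> i. S \<in> set_pmf R \<Longrightarrow> S \<in> Feas \<Longrightarrow> (\<And>k. k < m \<Longrightarrow> \<tau> k \<le> hi) \<Longrightarrow> i < m \<Longrightarrow>
      \<tau> i \<le> level n (item_level m \<alpha> \<rho> \<delta> i) S (least_solution m K (\<lambda>i. level n (item_level m \<alpha> \<rho> \<delta> i) S) \<tau>)"
    and bad: "\<And>q. q \<in> Bad \<Longrightarrow> \<exists>i<m. N * mean_load n D (\<lambda>j c. c i * share m \<alpha> (\<lambda>k. \<rho> ^ q k) c i) / \<delta>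
      \<le> (1 - e) * ((1 - e) * lo)"
  shows "measure_pmf.prob (bind_pmf R (\<lambda>S. map_pmf (least_solution m K (\<lambda>i. level n (item_level m \<alpha> \<rho> \<delta> i) S))
      (pmf_of_set ({..<m} \<rightarrow>\<^sub>E {lo<..hi})))) Bad
    \<le> measure_pmf.prob R (- Feas) +
      (4 * real hi / real (hi - lo)) ^ m * (real m * (2 * exp (- ((e / 3)\<^sup>2 * lo / (4 * (b / \<delta>)))))) / e"
proof -
  let ?h = "item_level m \<alpha> \<rho> \<delta>"
  let ?q = "\<lambda>S. least_solution m K (\<lambda>i. level n (?h i) S)"
  let ?box = "{..<m} \<rightarrow>\<^sub>E {lo<..hi}" and ?T = "{..<m} \<rightarrow>\<^sub>E {1..hi}"
  let ?M = "pair_pmf R R"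
  let ?dev = "\<lambda>z. deviates m n ?h lo (e / 3) z"
  let ?cnt = "\<lambda>S S'. real (card {\<tau>\<in>?T. ?q S \<tau> \<in> ?dev (S, S')})"
  define C where "C = real (hi - lo) ^ m"
  have C: "real (card ?box) = C" by (simp add: card_PiE C_def)
  have C0: "0 < C" using lo by (simp add: C_def)
  have box: "finite ?box" "?box \<noteq> {}" "?box \<subseteq> ?T" "finite ?T"
    using lo by (auto intro!: finite_PiE PiE_mono simp: PiE_eq_empty_iff)
  have caught: "e \<le> measure_pmf.prob R {S'. ?q S \<tau> \<in> ?dev (S, S')}"
    if S: "S \<in> set_pmf R" "S \<in> Feas" and \<tau>: "\<tau> \<in> ?box" "?q S \<tau> \<in> Bad" for S \<tau>
  proof -
    have \<tau>lo: "lo < \<tau> i" "\<tau> i \<le> hi" if "i < m" for i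
      using PiE_mem[OF \<tau>(1), of i] that by auto
    obtain i where i: "i < m" and mean: "N * mean_load n D (\<lambda>j c. c i * share m \<alpha> (\<lambda>k. \<rho> ^ ?q S \<tau> k) c i) / \<delta>
      \<le> (1 - e) * ((1 - e) * lo)" using bad[OF \<tau>(2)] by blast
    have "e \<le> measure_pmf.prob R {S'. level n (?h i) S' (?q S \<tau>) < (1 - e) * lo}"
      unfolding R_def using e lo mean by (intro ghost_level_small[OF D i \<rho> \<delta>]) auto
    also have "\<dots> \<le> measure_pmf.prob R {S'. ?q S \<tau> \<in> ?dev (S, S')}"
    proof (intro measure_pmf.finite_measure_mono subsetI CollectI)
      fix S' assume "S' \<in> {S'. level n (?h i) S' (?q S \<tau>) < (1 - e) * lo}"
      then have s': "real (level n (?h i) S' (?q S \<tau>)) < (1 - e) * lo" (is "?s' < _") by simp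
      have "\<tau> i \<le> level n (?h i) S (?q S \<tau>)" using feas[OF S] \<tau>lo(2) i by blast
      then have s: "real lo \<le> level n (?h i) S (?q S \<tau>)" (is "_ \<le> real ?s") using \<tau>lo(1)[OF i] by simp
      have "(1 - e) * lo \<le> (1 - e) * ?s" using e s by (intro mult_left_mono) auto
      then have 1: "?s' \<le> ?s - e * ?s" using s' by (simp add: algebra_simps)
      have es: "0 \<le> e * ?s" using e by simp
      \<comment> \<open>The levels differ by at least \<open>e * ?s\<close> while their sum is at
        most \<open>2 * ?s\<close>, so a relative deviation \<open>e / 3\<close> is certain.\<close>
      have "real ?s + ?s' \<le> 2 * real ?s" using 1 es by linarith
      then have "e / 3 * (?s + ?s') \<le> e / 3 * (2 * ?s)" using e by (intro mult_left_mono) auto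
      also have "\<dots> \<le> e * ?s" using es by simp
      also have "\<dots> \<le> \<bar>?s - ?s'\<bar>" using 1 by linarith
      finally show "?q S \<tau> \<in> ?dev (S, S')" unfolding deviates_def using i s by auto
    qed simp
    finally show ?thesis .
  qed
  have cnt_int: "(\<integral>\<^sup>+S'. ennreal (?cnt S S') \<partial>R)
      = ennreal (\<Sum>\<tau>\<in>?T. measure_pmf.prob R {S'. ?q S \<tau> \<in> ?dev (S, S')})" for S
  proof -
    have "ennreal (?cnt S S') = (\<Sum>\<tau>\<in>?T. indicator {S'. ?q S \<tau> \<in> ?dev (S, S')} S')" for S'
    proof -
      have "(\<Sum>\<tau>\<in>?T. indicator {S'. ?q S \<tau> \<in> ?dev (S, S')} S')
          = (\<Sum>\<tau>\<in>?T. ennreal (of_bool (?q S \<tau> \<in> ?dev (S, S'))))"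
        by (rule sum.cong) (auto simp: indicator_def)
      also have "\<dots> = ennreal (\<Sum>\<tau>\<in>?T. of_bool (?q S \<tau> \<in> ?dev (S, S')))"
        by (rule sum_ennreal) simp
      also have "(\<Sum>\<tau>\<in>?T. of_bool (?q S \<tau> \<in> ?dev (S, S'))) = ?cnt S S'"
        using box by (subst sum_of_bool_eq) (simp_all add: Int_def)
      finally show ?thesis ..
    qed
    then have "(\<integral>\<^sup>+S'. ennreal (?cnt S S') \<partial>R) = (\<Sum>\<tau>\<in>?T. emeasure R {S'. ?q S \<tau> \<in> ?dev (S, S')})"
      by (simp add: nn_integral_sum)
    then show ?thesis by (simp add: measure_pmf.emeasure_eq_measure)
  qed
  have point: "emeasure (map_pmf (?q S) (pmf_of_set ?box)) Bad
      \<le> indicator (- Feas) S + ennreal (1 / (e * C)) * (\<integral>\<^sup>+S'. ennreal (?cnt S S') \<partial>R)"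
    if S: "S \<in> set_pmf R" for S
  proof (cases "S \<in> Feas")
    case True
    have "e * real (card {\<tau>\<in>?box. ?q S \<tau> \<in> Bad}) = (\<Sum>\<tau>\<in>{\<tau>\<in>?box. ?q S \<tau> \<in> Bad}. e)" by simp
    also have "\<dots> \<le> (\<Sum>\<tau>\<in>{\<tau>\<in>?box. ?q S \<tau> \<in> Bad}. measure_pmf.prob R {S'. ?q S \<tau> \<in> ?dev (S, S')})"
      using caught[OF S True] by (intro sum_mono) auto
    also have "\<dots> \<le> (\<Sum>\<tau>\<in>?T. measure_pmf.prob R {S'. ?q S \<tau> \<in> ?dev (S, S')})"
      using box by (intro sum_mono2) auto
    finally have le: "real (card {\<tau>\<in>?box. ?q S \<tau> \<in> Bad}) / C
        \<le> 1 / (e * C) * (\<Sum>\<tau>\<in>?T. measure_pmf.prob R {S'. ?q S \<tau> \<in> ?dev (S, S')})"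
      using e C0 by (simp add: field_simps)
    have "emeasure (map_pmf (?q S) (pmf_of_set ?box)) Bad
        = ennreal (real (card {\<tau>\<in>?box. ?q S \<tau> \<in> Bad}) / C)"
      using box C by (simp add: measure_pmf.emeasure_eq_measure measure_pmf_of_set Int_def vimage_def conj_commute)
    also have "\<dots> \<le> ennreal (1 / (e * C) * (\<Sum>\<tau>\<in>?T. measure_pmf.prob R {S'. ?q S \<tau> \<in> ?dev (S, S')}))"
      by (rule ennreal_leI[OF le])
    also have "\<dots> = ennreal (1 / (e * C)) * (\<integral>\<^sup>+S'. ennreal (?cnt S S') \<partial>R)"
      unfolding cnt_int using e C0 by (intro ennreal_mult sum_nonneg) simp_all
    finally show ?thesis using True by simp
  next
    case False
    have "emeasure (map_pmf (?q S) (pmf_of_set ?box)) Bad \<le> 1"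
      by (rule measure_pmf.emeasure_le_1)
    with False show ?thesis by (simp add: add_increasing2)
  qed
  define X where "X = (4 * real hi) ^ m * (real m * (2 * exp (- ((e / 3)\<^sup>2 * lo / (4 * (b / \<delta>))))))"
  have X0: "0 \<le> X" by (simp add: X_def)
  have "(\<integral>\<^sup>+S. \<integral>\<^sup>+S'. ennreal (?cnt S S') \<partial>R \<partial>R)
      = (\<integral>\<^sup>+z. ennreal (real (card {\<tau>\<in>?T. ?q (fst z) \<tau> \<in> ?dev z})) \<partial>?M)"
    by (simp add: nn_integral_pair_pmf')
  also have "\<dots> \<le> ennreal X"
    unfolding R_def X_def
  proof (rule expected_deviations)
    show "real (?h i c q) \<le> b / \<delta>" if "i < m" "j < n" "c \<in> set_pmf (D j)" for i j c q
    proof -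
      have c: "0 < c i" "c i \<le> b" using bounded_columnsD[OF D that(2,3,1)] by auto
      have "share m \<alpha> (\<lambda>k. \<rho> ^ q k) c i \<le> 1" "0 \<le> share m \<alpha> (\<lambda>k. \<rho> ^ q k) c i"
        using \<rho> that by (auto intro!: share_le_1 share_nonneg)
      then have "c i * share m \<alpha> (\<lambda>k. \<rho> ^ q k) c i \<le> b * 1" using c by (intro mult_mono) auto
      then have "c i * share m \<alpha> (\<lambda>k. \<rho> ^ q k) c i / \<delta> \<le> b / \<delta>" using \<delta> by (simp add: divide_right_mono)
      then show ?thesis using item_level_bounds(1)[of c i m \<delta> \<rho> \<alpha> q] c that \<delta> \<rho> by auto
    qed
  qed (use \<rho> \<delta> b e lo in \<open>auto intro: substitutes_item_level\<close>)
  finally have ghost: "(\<integral>\<^sup>+S. \<integral>\<^sup>+S'. ennreal (?cnt S S') \<partial>R \<partial>R) \<le> ennreal X" .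
  have "emeasure (bind_pmf R (\<lambda>S. map_pmf (?q S) (pmf_of_set ?box))) Bad
      = (\<integral>\<^sup>+S. emeasure (map_pmf (?q S) (pmf_of_set ?box)) Bad \<partial>R)"
    by (rule emeasure_bind_pmf)
  also have "\<dots> \<le> (\<integral>\<^sup>+S. indicator (- Feas) S + ennreal (1 / (e * C)) * (\<integral>\<^sup>+S'. ennreal (?cnt S S') \<partial>R) \<partial>R)"
    by (intro nn_integral_mono_AE AE_pmfI point)
  also have "\<dots> = emeasure R (- Feas) + ennreal (1 / (e * C)) * (\<integral>\<^sup>+S. \<integral>\<^sup>+S'. ennreal (?cnt S S') \<partial>R \<partial>R)"
    by (simp add: nn_integral_add nn_integral_cmult)
  also have "\<dots> \<le> emeasure R (- Feas) + ennreal (1 / (e * C)) * ennreal X"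
    by (intro add_left_mono mult_left_mono ghost) simp
  also have "emeasure R (- Feas) + ennreal (1 / (e * C)) * ennreal X
      = ennreal (measure_pmf.prob R (- Feas) + 1 / (e * C) * X)"
    using e C0 X0 by (simp add: measure_pmf.emeasure_eq_measure flip: ennreal_mult)
  finally have fin: "emeasure (bind_pmf R (\<lambda>S. map_pmf (?q S) (pmf_of_set ?box))) Bad
      \<le> ennreal (measure_pmf.prob R (- Feas) + 1 / (e * C) * X)" .
  have "0 \<le> measure_pmf.prob R (- Feas) + 1 / (e * C) * X" using e C0 X0 by simp
  from fin[unfolded measure_pmf.emeasure_eq_measure ennreal_le_iff[OF this]]
  have "measure_pmf.prob (bind_pmf R (\<lambda>S. map_pmf (?q S) (pmf_of_set ?box))) Bad
      \<le> measure_pmf.prob R (- Feas) + 1 / (e * C) * X" .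
  also have "measure_pmf.prob R (- Feas) + 1 / (e * C) * X = measure_pmf.prob R (- Feas) + (4 * real hi / real (hi - lo)) ^ m * (real m * (2 * exp (- ((e / 3)\<^sup>2 * lo / (4 * (b / \<delta>)))))) / e"
    by (simp add: X_def C_def power_divide)
  finally show ?thesis .
qed

section \<open>The optimal value and the loads of an instance\<close>

lemma share_bounds:
  "(\<And>k. k < m \<Longrightarrow> 0 \<le> w k) \<Longrightarrow> i < m \<Longrightarrow> 0 \<le> share m \<alpha> w c i \<and> share m \<alpha> w c i \<le> 1"
  using share_nonneg share_le_1 by blast

lemma expected_min_load_nonneg:
  assumes D: "bounded_columns m n D b" and m: "0 < m" and w: "\<And>k. k < m \<Longrightarrow> 0 \<le> w k"
  shows "0 \<le> measure_pmf.expectation (product_dist n D) (\<lambda>P. min_load m n P (prop_alloc m \<alpha> w P))"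
  using w by (intro integral_nonneg_AE AE_pmfI min_load_bounds(1)[OF D _ m])
    (auto simp: prop_alloc_share intro: share_nonneg share_le_1)

text \<open>Large mean loads suffice for a large expected minimum: the soft minimum costs
  \<open>l * b\<close> in relative and \<open>ln m / l\<close> in absolute terms, and small items
  allow an \<open>l\<close> for which both are of order \<epsilon>.\<close>

lemma expected_min_load:
  assumes D: "bounded_columns m n D b" and m: "0 < m" and w: "\<And>k. k < m \<Longrightarrow> 0 \<le> w k"
    and \<mu>: "\<And>i. i < m \<Longrightarrow> \<mu> \<le> mean_load n D (\<lambda>j c. c i * share m \<alpha> w c i)"
    and l: "0 < l" "l * b \<le> 1"
  shows "(1 - l * b) * \<mu> - ln (real m) / l
    \<le> measure_pmf.expectation (product_dist n D) (\<lambda>P. min_load m n P (prop_alloc m \<alpha> w P))"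
proof -
  let ?z = "\<lambda>i j c. c i * share m \<alpha> w c i"
  have sh: "0 \<le> share m \<alpha> w c i \<and> share m \<alpha> w c i \<le> 1" if "i < m" for i c
    using share_bounds[OF w that] by simp
  have "(1 - l * b) * \<mu> - ln (real (card {..<m})) / l
    \<le> measure_pmf.expectation (product_dist n D) (\<lambda>P. min_load m n P (prop_alloc m \<alpha> w P))"
  proof (rule expectation_softmin[where g = "\<lambda>i P. \<Sum>j<n. ?z i j (P j)" and B = "n * b"])
    fix P assume P: "P \<in> set_pmf (product_dist n D)"
    show "\<bar>min_load m n P (prop_alloc m \<alpha> w P)\<bar> \<le> n * b"
      using min_load_bounds[OF D P m, of "prop_alloc m \<alpha> w P"] sh by (simp add: prop_alloc_share)
    show "\<exists>i\<in>{..<m}. (\<Sum>j<n. ?z i j (P j)) \<le> min_load m n P (prop_alloc m \<alpha> w P)"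
      using min_load_attained[OF m, of n P "prop_alloc m \<alpha> w P"]
      by (auto simp: load_def prop_alloc_share)
  next
    fix i assume "i \<in> {..<m}"
    then have i: "i < m" by simp
    have "(\<integral>\<^sup>+P. ennreal (exp (- (l * (\<Sum>j<n. ?z i j (P j))))) \<partial>measure_pmf (product_dist n D))
      \<le> ennreal (exp (- (l * (1 - l * b) * mean_load n D (?z i))))"
    proof (rule mgf_load)
      fix j c assume "j < n" "c \<in> set_pmf (D j)"
      from bounded_columnsD[OF D this i] sh[OF i, of c] mult_mono[of "c i" b "share m \<alpha> w c i" 1]
      show "0 \<le> c i * share m \<alpha> w c i" "c i * share m \<alpha> w c i \<le> b" by auto
    qed (use l in auto)
    also have "\<dots> \<le> ennreal (exp (- (l * ((1 - l * b) * \<mu>))))"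
      using \<mu>[OF i] l by (intro ennreal_leI) (auto simp: mult.assoc intro!: mult_left_mono)
    finally show "(\<integral>\<^sup>+P. ennreal (exp (- (l * (\<Sum>j<n. ?z i j (P j))))) \<partial>measure_pmf (product_dist n D))
      \<le> ennreal (exp (- (l * ((1 - l * b) * \<mu>))))" .
  qed (use m l in auto)
  then show ?thesis by simp
qed

context
  fixes m n :: nat and D :: "nat \<Rightarrow> column pmf" and b e T :: real and X :: "nat \<Rightarrow> column \<Rightarrow> nat \<Rightarrow> real"
  assumes D: "bounded_columns m n D b" and m: "0 < m" and b: "0 < b" and e: "0 < e" "e < 1"
    and X: "\<And>j c i. j < n \<Longrightarrow> i < m \<Longrightarrow> 0 \<le> X j c i \<and> X j c i \<le> 1"
      "\<And>j c. j < n \<Longrightarrow> (\<Sum>i<m. X j c i) = 1"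
      "\<And>i. i < m \<Longrightarrow> T \<le> mean_load n D (\<lambda>j c. c i * X j c i)"
    and T: "0 < T" "T = expected_opt m n D"
begin

lemma fluid_item_bounds:
  assumes "i < m" "j < n" "c \<in> set_pmf (D j)"
  shows "0 \<le> c i * X j c i" "c i * X j c i \<le> b"
  using bounded_columnsD[OF D assms(2,3,1)] X(1)[OF assms(2,1), of c] mult_mono[of "c i" b "X j c i" 1]
  by auto

text \<open>The fluid rule certifies that the drawn sample itself admits large loads for all agents;
  this is the benchmark \<open>V\<close> against which the least solution is compared.\<close>

lemma fluid_sample_tail:
  "measure_pmf.prob (replicate_pmf N (product_dist n D))
      {S. \<exists>i<m. sample_load n (\<lambda>j c. c i * X j c i) S \<le> (1 - 2 * e) * (N * T)}
    \<le> m * exp (- (e\<^sup>2 * N * T / b))"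
proof -
  let ?R = "replicate_pmf N (product_dist n D)"
  let ?A = "\<lambda>i. {S. (\<Sum>k<N. \<Sum>j<n. (S ! k) j i * X j ((S ! k) j) i) \<le> (1 - 2 * e) * (N * T)}"
  have "measure_pmf.prob ?R {S. \<exists>i<m. sample_load n (\<lambda>j c. c i * X j c i) S \<le> (1 - 2 * e) * (N * T)}
      \<le> measure_pmf.prob ?R (\<Union>i<m. ?A i)"
    by (rule prob_pmf_mono) (auto simp: sample_load_def set_replicate_pmf)
  also have "\<dots> \<le> (\<Sum>i<m. measure_pmf.prob ?R (?A i))"
    by (intro measure_pmf.finite_measure_subadditive_finite) auto
  also have "\<dots> \<le> (\<Sum>i<m. exp (- (e\<^sup>2 * N * T / b)))"
    by (intro sum_mono load_lower_tail) (use fluid_item_bounds b e X(3) in auto)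
  finally show ?thesis by simp
qed

lemma opt_ge_fluid:
  "min_load m n P (\<lambda>j i. X j (P j) i) \<le> opt_snt m n P"
proof -
  have "feasible m n (\<lambda>j i. X j (P j) i)" using X(1,2) by (auto simp: feasible_def)
  then show ?thesis using opt_snt_attained[OF m, of n P] by metis
qed

lemma opt_lower_tail:
  "measure_pmf.prob (product_dist n D) {P. opt_snt m n P \<le> (1 - 2 * e) * T} \<le> m * exp (- (e\<^sup>2 * T / b))"
proof -
  let ?A = "{S. \<exists>i<m. sample_load n (\<lambda>j c. c i * X j c i) S \<le> (1 - 2 * e) * (1 * T)}"
  have "measure_pmf.prob (product_dist n D) {P. opt_snt m n P \<le> (1 - 2 * e) * T}
      \<le> measure_pmf.prob (product_dist n D) ((\<lambda>P. [P]) -` ?A)"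
  proof (intro measure_pmf.finite_measure_mono subsetI)
    fix P assume "P \<in> {P. opt_snt m n P \<le> (1 - 2 * e) * T}"
    then have "min_load m n P (\<lambda>j i. X j (P j) i) \<le> (1 - 2 * e) * T"
      using opt_ge_fluid[of P] by simp
    then show "P \<in> (\<lambda>P. [P]) -` ?A"
      using min_load_attained[OF m, of n P "\<lambda>j i. X j (P j) i"] by (auto simp: sample_load_def load_def)
  qed simp
  also have "\<dots> = measure_pmf.prob (replicate_pmf 1 (product_dist n D)) ?A"
    unfolding replicate_pmf_1 by simp
  also have "\<dots> \<le> m * exp (- (e\<^sup>2 * T / b))" using fluid_sample_tail[of 1] by simp
  finally show ?thesis .
qed

text \<open>The optimum has mean exactly \<open>T\<close>, and already its truncation at
  \<open>T\<close> has mean at least (1 - 2 e) T. The part above \<open>T\<close> thus has mean at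
  most 2 e T, and Markov's inequality bounds it. No concentration of the optimum from above
  enters.\<close>

lemma opt_upper_tail:
  assumes "ln (real m + 1) * b \<le> e\<^sup>2 * T"
  shows "measure_pmf.prob (product_dist n D) {P. (1 + 6 * e) * T < opt_snt m n P} \<le> 1 / 2"
proof -
  let ?p = "product_dist n D"
  define l where "l = e / b"
  have l: "0 < l" "l * b = e" using e b by (auto simp: l_def)
  \<comment> \<open>The index \<open>m\<close> stands for the constant candidate \<open>T\<close>,
    so that the truncated optimum is bounded below by a minimum of \<open>m + 1\<close> candidates;
    hence \<open>ln (real m + 1)\<close>.\<close>
  let ?g = "\<lambda>i P. if i < m then \<Sum>j<n. P j i * X j (P j) i else T"
  let ?f = "\<lambda>P. min (opt_snt m n P) T"
  have opt: "0 \<le> opt_snt m n P" "opt_snt m n P \<le> n * b" if "P \<in> set_pmf ?p" for P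
    using opt_snt_bounds[OF D that m] by auto
  have "(1 - e) * T - ln (real (card {..m})) / l \<le> measure_pmf.expectation ?p ?f"
  proof (rule expectation_softmin[where g = ?g and B = T])
    fix P assume P: "P \<in> set_pmf ?p"
    show "\<bar>?f P\<bar> \<le> T" using opt[OF P] T by auto
    obtain i where i: "i < m" "min_load m n P (\<lambda>j i. X j (P j) i) = (\<Sum>j<n. P j i * X j (P j) i)"
      using min_load_attained[OF m, of n P "\<lambda>j i. X j (P j) i"] by (auto simp: load_def)
    show "\<exists>i\<in>{..m}. ?g i P \<le> ?f P"
    proof (cases "opt_snt m n P \<le> T")
      case True
      then show ?thesis using i opt_ge_fluid[of P] by (intro bexI[of _ i]) auto
    qed (auto intro!: bexI[of _ m])
  next
    fix i assume "i \<in> {..m}"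
    show "(\<integral>\<^sup>+P. ennreal (exp (- (l * ?g i P))) \<partial>measure_pmf ?p) \<le> ennreal (exp (- (l * ((1 - e) * T))))"
    proof (cases "i < m")
      case True
      have "(\<integral>\<^sup>+P. ennreal (exp (- (l * (\<Sum>j<n. P j i * X j (P j) i)))) \<partial>measure_pmf ?p)
        \<le> ennreal (exp (- (l * (1 - l * b) * mean_load n D (\<lambda>j c. c i * X j c i))))"
        by (rule mgf_load) (use fluid_item_bounds[OF True] l in auto)
      also have "\<dots> \<le> ennreal (exp (- (l * ((1 - e) * T))))"
        using X(3)[OF True] l e by (intro ennreal_leI) (auto simp: mult.assoc intro!: mult_left_mono)
      finally show ?thesis using True by simp
    next
      case False
      have "exp (- (l * T)) \<le> exp (- (l * ((1 - e) * T)))" using l e T by simp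
      with False show ?thesis by (simp add: ennreal_leI)
    qed
  qed (use m l in auto)
  moreover have "ln (real (card {..m})) / l \<le> e * T"
    using assms b e by (simp add: l_def field_simps power2_eq_square)
  ultimately have Ef: "(1 - 2 * e) * T \<le> measure_pmf.expectation ?p ?f" by (simp add: algebra_simps)
  have int: "integrable ?p (opt_snt m n)"
    using opt by (intro integrable_pmf_bounded[of _ _ "n * b"]) auto
  have intf: "integrable ?p ?f"
    using opt T by (intro integrable_pmf_bounded[of _ _ T]) (auto simp: min_def)
  have "(6 * e * T) * measure_pmf.prob ?p {P. (1 + 6 * e) * T < opt_snt m n P}
      = measure_pmf.expectation ?p (\<lambda>P. (6 * e * T) * indicator {P. (1 + 6 * e) * T < opt_snt m n P} P)"
    by simp
  also have "\<dots> \<le> measure_pmf.expectation ?p (\<lambda>P. opt_snt m n P - ?f P)"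
  proof (intro integral_mono_AE AE_pmfI)
    fix P
    have "0 \<le> e * T" using e T by simp
    then show "(6 * e * T) * indicator {P. (1 + 6 * e) * T < opt_snt m n P} P \<le> opt_snt m n P - ?f P"
      by (auto simp: indicator_def algebra_simps min_def)
  qed (use int intf in \<open>auto intro!: integrable_pmf_bounded[of _ _ 1] simp: indicator_def\<close>)
  also have "\<dots> = T - measure_pmf.expectation ?p ?f"
    using int intf T(2) by (simp add: expected_opt_def)
  also have "\<dots> \<le> 2 * e * T" using Ef by (simp add: algebra_simps)
  finally have "(6 * e * T) * measure_pmf.prob ?p {P. (1 + 6 * e) * T < opt_snt m n P} \<le> (6 * e * T) * (1 / 3)"
    by simp
  then have "measure_pmf.prob ?p {P. (1 + 6 * e) * T < opt_snt m n P} \<le> 1 / 3"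
    using e T by (subst (asm) mult_le_cancel_left_pos) auto
  then show ?thesis by simp
qed

text \<open>The two tails are of different quality. A minimum is too small as soon as one optimum
  is, which the exponentially small lower tail can afford; it is too large only if all are, so a
  constant upper tail becomes \<open>(1 / 2) ^ r\<close>.\<close>

lemma opt_estimate:
  assumes "ln (real m + 1) * b \<le> e\<^sup>2 * T" "0 < r"
  shows "measure_pmf.prob (replicate_pmf r (product_dist n D))
      {S. \<not> ((1 - 2 * e) * T \<le> Min (opt_snt m n ` set S) \<and> Min (opt_snt m n ` set S) \<le> (1 + 6 * e) * T)}
    \<le> r * (m * exp (- (e\<^sup>2 * T / b))) + (1 / 2) ^ r"
proof -
  let ?p = "product_dist n D" and ?R = "replicate_pmf r (product_dist n D)"
  let ?L = "{P. opt_snt m n P \<le> (1 - 2 * e) * T}" and ?U = "{P. (1 + 6 * e) * T < opt_snt m n P}"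
  let ?A = "{S. \<exists>k<r. S ! k \<in> ?L}" and ?B = "{S. \<forall>k<r. S ! k \<in> ?U}"
  have "measure_pmf.prob ?R {S. \<not> ((1 - 2 * e) * T \<le> Min (opt_snt m n ` set S) \<and> Min (opt_snt m n ` set S) \<le> (1 + 6 * e) * T)}
      \<le> measure_pmf.prob ?R (?A \<union> ?B)"
  proof (rule prob_pmf_mono)
    fix S assume S: "S \<in> {S. \<not> ((1 - 2 * e) * T \<le> Min (opt_snt m n ` set S) \<and> Min (opt_snt m n ` set S) \<le> (1 + 6 * e) * T)}"
      "S \<in> set_pmf ?R"
    then have len: "length S = r" by (auto simp: set_replicate_pmf)
    have ne: "finite (opt_snt m n ` set S)" "opt_snt m n ` set S \<noteq> {}" using len assms(2) by auto
    show "S \<in> ?A \<union> ?B"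
    proof (cases "(1 - 2 * e) * T \<le> Min (opt_snt m n ` set S)")
      case True
      then have "(1 + 6 * e) * T < Min (opt_snt m n ` set S)" using S by auto
      then have "\<forall>P\<in>set S. P \<in> ?U" using ne by (simp add: Min_gr_iff)
      then show ?thesis using len by auto
    next
      case False
      then have "\<exists>P\<in>set S. opt_snt m n P < (1 - 2 * e) * T"
        using Min_ge_iff[OF ne, of "(1 - 2 * e) * T"] by (auto simp: not_le)
      then show ?thesis using len by (force simp: in_set_conv_nth)
    qed
  qed
  also have "\<dots> \<le> measure_pmf.prob ?R ?A + measure_pmf.prob ?R ?B" by (rule measure_Un_le) auto
  also have "measure_pmf.prob ?R ?A \<le> r * (m * exp (- (e\<^sup>2 * T / b)))"
  proof -
    have "emeasure ?R ?A \<le> (\<integral>\<^sup>+S. (\<Sum>k<r. indicator ?L (S ! k)) \<partial>?R)"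
    proof (subst nn_integral_indicator[symmetric])
      show "(\<integral>\<^sup>+S. indicator ?A S \<partial>?R) \<le> (\<integral>\<^sup>+S. (\<Sum>k<r. indicator ?L (S ! k)) \<partial>?R)"
      proof (rule nn_integral_mono)
        fix S :: "matrix list"
        show "indicator ?A S \<le> (\<Sum>k<r. indicator ?L (S ! k) :: ennreal)"
        proof (cases "S \<in> ?A")
          case True
          then obtain k where "k < r" "S ! k \<in> ?L" by auto
          then show ?thesis
            using member_le_sum[of k "{..<r}" "\<lambda>k. indicator ?L (S ! k) :: ennreal"] True by simp
        qed simp
      qed
    qed simp
    also have "\<dots> = of_nat r * emeasure ?p ?L"
      by (subst nn_integral_replicate_pmf_sum) simp
    also have "\<dots> = ennreal (r * measure_pmf.prob ?p ?L)"
      by (simp add: measure_pmf.emeasure_eq_measure ennreal_mult ennreal_of_nat_eq_real_of_nat)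
    finally have "measure_pmf.prob ?R ?A \<le> r * measure_pmf.prob ?p ?L"
      by (simp add: measure_pmf.emeasure_eq_measure)
    also have "\<dots> \<le> r * (m * exp (- (e\<^sup>2 * T / b)))" by (intro mult_left_mono opt_lower_tail) auto
    finally show ?thesis .
  qed
  also have "measure_pmf.prob ?R ?B \<le> (1 / 2) ^ r"
  proof -
    have "emeasure ?R ?B = (\<integral>\<^sup>+S. (\<Prod>k<r. indicator ?U (S ! k)) \<partial>?R)"
    proof (subst nn_integral_indicator[symmetric])
      show "(\<integral>\<^sup>+S. indicator ?B S \<partial>?R) = (\<integral>\<^sup>+S. (\<Prod>k<r. indicator ?U (S ! k)) \<partial>?R)"
      proof (rule nn_integral_cong)
        fix S :: "matrix list"
        show "indicator ?B S = (\<Prod>k<r. indicator ?U (S ! k) :: ennreal)"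
          by (cases "S \<in> ?B") (auto simp: indicator_def)
      qed
    qed simp
    also have "\<dots> = emeasure ?p ?U ^ r"
      by (subst nn_integral_replicate_pmf_prod) simp
    also have "\<dots> = ennreal (measure_pmf.prob ?p ?U ^ r)"
      by (simp add: measure_pmf.emeasure_eq_measure ennreal_power)
    finally have "measure_pmf.prob ?R ?B = measure_pmf.prob ?p ?U ^ r"
      by (simp add: measure_pmf.emeasure_eq_measure)
    also have "\<dots> \<le> (1 / 2) ^ r" using opt_upper_tail[OF assms(1)] by (intro power_mono) auto
    finally show ?thesis .
  qed
  finally show ?thesis by simp
qed

end

lemma prob_bind_pmf_le:
  assumes "\<And>x. x \<in> set_pmf p \<Longrightarrow> x \<notin> E \<Longrightarrow> measure_pmf.prob (f x) A \<le> c" "0 \<le> c"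
  shows "measure_pmf.prob (bind_pmf p f) A \<le> measure_pmf.prob p E + c"
proof -
  have "emeasure (bind_pmf p f) A = (\<integral>\<^sup>+x. emeasure (f x) A \<partial>p)" by (rule emeasure_bind_pmf)
  also have "\<dots> \<le> (\<integral>\<^sup>+x. indicator E x + ennreal c \<partial>p)"
  proof (intro nn_integral_mono_AE AE_pmfI)
    fix x assume x: "x \<in> set_pmf p"
    show "emeasure (f x) A \<le> indicator E x + ennreal c"
    proof (cases "x \<in> E")
      case True
      have "emeasure (f x) A \<le> 1" by (rule measure_pmf.emeasure_le_1)
      with True show ?thesis by (simp add: add_increasing2)
    next
      case False
      with assms(1)[OF x] show ?thesis by (simp add: measure_pmf.emeasure_eq_measure ennreal_leI)
    qed
  qed
  also have "\<dots> = emeasure p E + ennreal c" by (simp add: nn_integral_add)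
  also have "\<dots> = ennreal (measure_pmf.prob p E + c)"
    using assms(2) by (simp add: measure_pmf.emeasure_eq_measure)
  finally show ?thesis using assms(2) by (simp add: measure_pmf.emeasure_eq_measure del: ennreal_plus)
qed

section \<open>The learner\<close>

text \<open>\<open>G\<close> is the number of level units in the estimated optimum, so
  \<open>real N * G\<close> corresponds to a total load of \<open>N\<close> times that estimate. The
  targets 1 - 13 e and 1 - 14 e leave a gap of at least half of \<open>e * x\<close> after taking
  floors; the lower floor costs at most one further \<open>e * x\<close>.\<close>

lemma rounding_parameters:
  fixes e :: real
  assumes e: "0 < e" "e < 1 / 100" and "0 < N" "0 < n"
  shows "\<exists>(G::nat) (hi::nat) (lo::nat). 0 < G \<and> 2 * real n \<le> e * G \<and> 0 < lo \<and> lo < hi \<and>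
    real hi \<le> (1 - 13 * e) * (real N * G) \<and> (1 - 15 * e) * (real N * G) \<le> real lo \<and>
    4 * real hi / real (hi - lo) \<le> 8 / e"
proof -
  \<comment> \<open>An item is rounded by up to one unit, \<open>N * n\<close> units in all; this
    choice keeps them within a fraction e / 2 of \<open>real N * G\<close>.\<close>
  obtain G where G: "2 * real n / e \<le> real G" using real_arch_simple by blast
  define x where "x = real N * G"
  have eG: "2 * real n \<le> e * G" using G e by (simp add: field_simps)
  then have eG2: "2 \<le> e * G" using assms by simp
  have "1 * (e * G) \<le> real N * (e * G)" using assms eG2 by (intro mult_right_mono) auto
  then have ex: "2 \<le> e * x" using eG2 by (simp add: x_def mult_ac)
  have "0 < e * x" using ex by linarith
  then have x: "0 < x" using e by (simp add: zero_less_mult_iff)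
  have "e * x \<le> 1 / 100 * x" using e x by (intro mult_right_mono) auto
  note ex2 = this
  define hi lo where "hi = nat \<lfloor>(1 - 13 * e) * x\<rfloor>" and "lo = nat \<lfloor>(1 - 14 * e) * x\<rfloor>"
  have pos: "0 \<le> (1 - 13 * e) * x" "0 \<le> (1 - 14 * e) * x" using x e by auto
  have hi: "real hi \<le> (1 - 13 * e) * x" "(1 - 13 * e) * x - 1 \<le> real hi"
    using pos unfolding hi_def by linarith+
  have lo: "real lo \<le> (1 - 14 * e) * x" "(1 - 14 * e) * x - 1 \<le> real lo"
    using pos unfolding lo_def by linarith+
  have hi': "real hi \<le> x - 13 * (e * x)" "x - 13 * (e * x) - 1 \<le> real hi"
    using hi by (simp_all add: algebra_simps)
  have lo': "real lo \<le> x - 14 * (e * x)" "x - 14 * (e * x) - 1 \<le> real lo"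
    using lo by (simp_all add: algebra_simps)
  have gap: "e * x / 2 \<le> real hi - real lo" using hi' lo' ex by linarith
  then have lt: "lo < hi" using ex by linarith
  have "0 < lo" using lo' ex ex2 by linarith
  moreover have "(1 - 15 * e) * x \<le> real lo" using lo' ex by (simp add: algebra_simps)
  moreover have "4 * real hi / real (hi - lo) \<le> 8 / e"
  proof -
    have "4 * real hi / real (hi - lo) \<le> 4 * x / (e * x / 2)"
      using gap hi' ex lt x by (intro frac_le) (auto simp: of_nat_diff)
    then show ?thesis using x by simp
  qed
  moreover have "0 < G" using eG2 e by (cases "G = 0") auto
  ultimately show ?thesis using eG lt hi(1) unfolding x_def
    by (intro exI[of _ G] exI[of _ hi] exI[of _ lo] conjI) auto
qed

lemma price_bound_exists:
  fixes e a x :: real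
  assumes "0 < e" "0 < a"
  shows "\<exists>K>0. x < (1 + e) powr (real K / a)"
proof -
  define y where "y = log (1 + e) (\<bar>x\<bar> + 1)"
  obtain K where K: "\<bar>a * y\<bar> + 1 < real K" using reals_Archimedean2 by blast
  have "a * y < real K" using K by linarith
  then have "y < real K / a" using assms by (simp add: field_simps)
  have "x < \<bar>x\<bar> + 1" by linarith
  also have "\<bar>x\<bar> + 1 = (1 + e) powr y" using assms by (simp add: y_def)
  also have "\<dots> < (1 + e) powr (real K / a)" using assms \<open>y < real K / a\<close> by simp
  finally show ?thesis using K by (intro exI[of _ K]) auto
qed

text \<open>For x = e / m the exponential is \<open>x ^ (8 * m)\<close>. Two factors
  \<open>x ^ m\<close> absorb \<open>(8 / e) ^ m\<close>, one x cancels m / e, and another one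
  leaves 2 x; the remaining powers are at most 1.\<close>

lemma union_bound_numeric:
  fixes e :: real
  assumes e: "0 < e" "e < 1 / 100" and m: "2 \<le> m"
  shows "(8 / e) ^ m * (real m * (2 * exp (- (8 * (m * ln (m / e)))))) / e \<le> 1 / (4 * real m)"
proof -
  define x where "x = e / m"
  have x: "0 < x" "x \<le> e" "8 * x \<le> 1" "x * m = e" using e m by (auto simp: x_def field_simps)
  have "exp (- (8 * (m * ln (m / e)))) = x ^ (8 * m)"
  proof -
    have "x ^ (8 * m) = exp (real (8 * m) * ln x)" using x by (subst exp_of_nat_mult) simp
    also have "ln x = - ln (m / e)" using e m by (simp add: x_def ln_div)
    finally show ?thesis by (simp add: mult_ac)
  qed
  also have "x ^ (8 * m) = x ^ m * (x * (x ^ m * (x * x ^ (6 * m - 2))))"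
  proof -
    have "8 * m = m + (1 + (m + (1 + (6 * m - 2))))" using m by simp
    then show ?thesis by (metis power_add power_one_right)
  qed
  also have "\<dots> \<le> x ^ m * (x * (x ^ m * (x * 1)))"
    using x e by (intro mult_left_mono power_le_one) auto
  finally have E: "exp (- (8 * (m * ln (m / e)))) \<le> x ^ m * (x * (x ^ m * x))" by simp
  have "(8 / e) ^ m * (real m * (2 * exp (- (8 * (m * ln (m / e)))))) / e
      \<le> (8 / e) ^ m * (real m * (2 * (x ^ m * (x * (x ^ m * x))))) / e"
    using e E by (intro divide_right_mono mult_left_mono) auto
  also have "\<dots> = (8 * x) ^ m * (x / e) ^ m * (2 * (x * m) * x / e)"
    by (simp add: power_mult_distrib power_divide)
  also have "\<dots> = (8 * x) ^ m * (x / e) ^ m * (2 * x)" using x e by simp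
  also have "\<dots> \<le> 1 * 1 * (2 * x)"
    using x e by (intro mult_mono power_le_one mult_nonneg_nonneg) auto
  also have "\<dots> \<le> 1 / (4 * real m)" using e m by (simp add: x_def field_simps)
  finally show ?thesis .
qed

text \<open>The budget in units of e: thresholds end at 1 - 13 e, so half a unit of rounding, a grid
  step 1 + e and an estimate up to 1 + 6 e leave raised agents at most 1 - 4 e. The fluid value (1 -
  e) (1 - 2 e) is above 1 - 3 e, which leaves a slack of one unit. Thresholds start no lower than 1
  - 15 e; two factors 1 - e from the ghost sample and an estimate as low as 1 - 2 e lead to 1 - 20
  e.\<close>

lemma random_solution_mean_load:
  fixes m n N G hi lo K :: nat and D :: "nat \<Rightarrow> column pmf" and e T Th b :: real
  defines "R \<equiv> replicate_pmf N (product_dist n D)" and "\<alpha> \<equiv> m / e" and "\<delta> \<equiv> Th / G"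
  assumes m: "2 \<le> m" and e: "0 < e" "e < 1 / 100" and n: "0 < n"
    and D: "bounded_columns m n D b" and b: "b * (1152 * ln m) = e\<^sup>2 * T"
    and T: "0 < T" "T = expected_opt m n D" and Th: "(1 - 2 * e) * T \<le> Th" "Th \<le> (1 + 6 * e) * T"
    and N: "m * ln (m / e) \<le> N * ln m" "0 < N"
    and G: "0 < G" "2 * real n \<le> e * G" and lo: "0 < lo" "lo < hi"
    and hi: "real hi \<le> (1 - 13 * e) * (real N * G)" and lo2: "(1 - 15 * e) * (real N * G) \<le> real lo"
    and ratio: "4 * real hi / real (hi - lo) \<le> 8 / e"
    and K: "0 < K" "m * n / e < (1 + e) powr (K / \<alpha>)"
  shows "measure_pmf.prob (bind_pmf R (\<lambda>S. map_pmf (least_solution m K (\<lambda>i. level n (item_level m \<alpha> (1 + e) \<delta> i) S))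
      (pmf_of_set ({..<m} \<rightarrow>\<^sub>E {lo<..hi}))))
      {q. \<exists>i<m. mean_load n D (\<lambda>j c. c i * share m \<alpha> (\<lambda>k. (1 + e) ^ q k) c i) < (1 - 20 * e) * T}
    \<le> 1 / (2 * real m)"
proof -
  have "ln 2 \<le> ln (real m)" using m by simp
  then have ln: "2 / 3 \<le> ln (real m)" using ln2_ge_two_thirds by linarith
  have b0: "0 < b"
  proof -
    have "0 < b * (1152 * ln m)" using b e T by simp
    then show ?thesis using ln by (simp add: zero_less_mult_iff)
  qed
  have bT: "b \<le> T"
  proof -
    have "b * 1 \<le> b * (1152 * ln m)" using b0 ln by (intro mult_left_mono) auto
    also have "\<dots> \<le> 1 * T" unfolding b using e T by (intro mult_right_mono) (auto simp: power_le_one)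
    finally show ?thesis by simp
  qed
  have "0 < (1 - 2 * e) * T" using T e by (intro mult_pos_pos) auto
  then have Th0: "0 < Th" using Th(1) by linarith
  have \<delta>0: "0 < \<delta>" using Th0 G by (simp add: \<delta>_def)
  have \<alpha>0: "0 < \<alpha>" "real m \<le> e * \<alpha>" using m e by (auto simp: \<alpha>_def)
  have m0: "0 < m" using m by simp
  obtain X :: "nat \<Rightarrow> column \<Rightarrow> nat \<Rightarrow> real" where
    X: "\<And>j c i. j < n \<Longrightarrow> i < m \<Longrightarrow> 0 \<le> X j c i \<and> X j c i \<le> 1"
      "\<And>j c. j < n \<Longrightarrow> (\<Sum>i<m. X j c i) = 1"
      "\<And>i. i < m \<Longrightarrow> T \<le> mean_load n D (\<lambda>j c. c i * X j c i)"
    by (rule fluid_allocation[OF m0 D, folded T(2)]) (rule that)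
  define V where "V = (1 - 2 * e) * (N * T)"
  define Feas where "Feas = - {S. \<exists>i<m. sample_load n (\<lambda>j c. c i * X j c i) S \<le> V}"
  have NT: "0 < N * T" using N T by simp
  define A where "A = (1 + e) * (\<delta> * (hi + real N * n))"
  have A: "A \<le> (1 - 4 * e) * (N * T)"
  proof -
    have "hi + real N * n \<le> (1 - 13 * e) * (real N * G) + real N * (e * G / 2)"
      using hi G(2) by (intro add_mono mult_left_mono) auto
    also have "\<dots> = (1 - 25 / 2 * e) * (real N * G)" by (simp add: algebra_simps)
    finally have "\<delta> * (hi + real N * n) \<le> \<delta> * ((1 - 25 / 2 * e) * (real N * G))"
      using \<delta>0 by (intro mult_left_mono) auto
    also have "\<dots> = (1 - 25 / 2 * e) * N * Th" using G by (simp add: \<delta>_def)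
    also have "\<dots> \<le> (1 - 25 / 2 * e) * N * ((1 + 6 * e) * T)"
      using Th e by (intro mult_left_mono) auto
    finally have "A \<le> (1 + e) * ((1 - 25 / 2 * e) * N * ((1 + 6 * e) * T))"
      unfolding A_def using e by (intro mult_left_mono) auto
    also have "\<dots> = ((1 + e) * (1 - 25 / 2 * e) * (1 + 6 * e)) * (N * T)" by simp
    also have "\<dots> \<le> (1 - 4 * e) * (N * T)"
    proof (rule mult_right_mono)
      have "(1 + e) * (1 - 25 / 2 * e) * (1 + 6 * e) = 1 - 11 / 2 * e - 163 / 2 * e\<^sup>2 - 75 * e ^ 3"
        by (simp add: algebra_simps power2_eq_square power3_eq_cube)
      also have "\<dots> \<le> 1 - 4 * e"
      proof -
        have "0 \<le> e\<^sup>2" "0 \<le> e ^ 3" using e by simp_all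
        then show ?thesis using e by linarith
      qed
      finally show "(1 + e) * (1 - 25 / 2 * e) * (1 + 6 * e) \<le> 1 - 4 * e" .
    qed (use NT in simp)
    finally show ?thesis .
  qed
  have gap: "e * (N * T) \<le> (1 - e) * V - A"
  proof -
    have "(1 - 3 * e) * (N * T) \<le> ((1 - e) * (1 - 2 * e)) * (N * T)"
      using NT e by (intro mult_right_mono) (auto simp: algebra_simps)
    with A show ?thesis by (simp add: V_def algebra_simps)
  qed
  have eNT: "0 < e * (N * T)" using e NT by simp
  have "measure_pmf.prob (bind_pmf R (\<lambda>S. map_pmf (least_solution m K (\<lambda>i. level n (item_level m \<alpha> (1 + e) \<delta> i) S))
      (pmf_of_set ({..<m} \<rightarrow>\<^sub>E {lo<..hi}))))
      {q. \<exists>i<m. mean_load n D (\<lambda>j c. c i * share m \<alpha> (\<lambda>k. (1 + e) ^ q k) c i) < (1 - 20 * e) * T}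
    \<le> measure_pmf.prob R (- Feas) +
      (4 * real hi / real (hi - lo)) ^ m * (real m * (2 * exp (- ((e / 3)\<^sup>2 * lo / (4 * (b / \<delta>)))))) / e"
    unfolding R_def
  proof (rule random_solution[OF D b0 e(1) _ _ \<delta>0 lo])
    fix S \<tau> i assume S: "S \<in> set_pmf (replicate_pmf N (product_dist n D))" "S \<in> Feas"
      and \<tau>: "\<And>k. k < m \<Longrightarrow> \<tau> k \<le> hi" and i: "i < m"
    have len: "length S = N" using S by (auto simp: set_replicate_pmf)
    show "\<tau> i \<le> level n (item_level m \<alpha> (1 + e) \<delta> i) S
        (least_solution m K (\<lambda>i. level n (item_level m \<alpha> (1 + e) \<delta> i) S) \<tau>)"
    proof (rule least_solution_level_reached[where X = X and V = V and A = A and e = e and b = b and hi = hi])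
      fix k j i assume k: "k < length S" "j < n" "i < m"
      then have "S ! k \<in> set_pmf (product_dist n D)" using S by (auto simp: set_replicate_pmf)
      from bounded_columnsD[OF D k(2) product_dist_column[OF this k(2)] k(3)]
      show "0 < (S ! k) j i \<and> (S ! k) j i \<le> b" by simp
    next
      show "V \<le> sample_load n (\<lambda>j c. c i * X j c i) S" if "i < m" for i
        using S(2) that by (auto simp: Feas_def not_le intro: less_imp_le)
      show "(1 + e) * (\<delta> * (hi + real (length S) * n)) \<le> A" by (simp add: len A_def)
      show "A < (1 - e) * V" using gap eNT by linarith
      \<comment> \<open>\<open>K\<close> must not depend on the unknown \<open>T\<close>. It cancels
        because \<open>b \<le> T\<close> and because the slack is the fixed fraction
        \<open>e\<close> of \<open>N * T\<close>.\<close>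
      have "real m * (real (N * n) * b) \<le> real m * (real (N * n) * T)"
        using bT by (intro mult_left_mono) auto
      also have "\<dots> = (m * n / e) * (e * (N * T))" using e by simp
      also have "\<dots> < (1 + e) powr (K / \<alpha>) * (e * (N * T))" using K eNT by (intro mult_strict_right_mono)
      also have "\<dots> \<le> (1 + e) powr (K / \<alpha>) * ((1 - e) * V - A)" using gap by (intro mult_left_mono) auto
      finally show "m * (real (length S * n) * b) < (1 + e) powr (K / \<alpha>) * ((1 - e) * V - A)"
        by (simp add: len)
    qed (use X \<alpha>0 e \<delta>0 b0 \<tau> K i in auto)
  next
    fix q assume "q \<in> {q. \<exists>i<m. mean_load n D (\<lambda>j c. c i * share m \<alpha> (\<lambda>k. (1 + e) ^ q k) c i) < (1 - 20 * e) * T}"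
    then obtain i where i: "i < m"
      and mean: "mean_load n D (\<lambda>j c. c i * share m \<alpha> (\<lambda>k. (1 + e) ^ q k) c i) < (1 - 20 * e) * T" (is "?\<mu> < _")
      by auto
    have "N * ?\<mu> / \<delta> \<le> N * ((1 - 20 * e) * T) / \<delta>"
      using mean \<delta>0 by (intro divide_right_mono mult_left_mono) auto
    also have "\<dots> \<le> N * ((1 - e) * (1 - e) * (1 - 15 * e) * Th) / \<delta>"
    proof (intro divide_right_mono mult_left_mono)
      have "1 - 20 * e \<le> (1 - e) * (1 - e) * (1 - 15 * e) * (1 - 2 * e)"
      proof -
        have "(1 - e) * (1 - e) * (1 - 15 * e) * (1 - 2 * e)
            = 1 - 19 * e + e\<^sup>2 * (65 - 77 * e + 30 * e\<^sup>2)"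
          by (simp add: algebra_simps power2_eq_square)
        moreover have "0 \<le> e\<^sup>2 * (65 - 77 * e + 30 * e\<^sup>2)"
        proof (rule mult_nonneg_nonneg)
          have "0 \<le> 30 * e\<^sup>2" by simp
          then show "0 \<le> 65 - 77 * e + 30 * e\<^sup>2" using e by linarith
        qed simp
        ultimately show ?thesis using e by linarith
      qed
      then have "(1 - 20 * e) * T \<le> (1 - e) * (1 - e) * (1 - 15 * e) * (1 - 2 * e) * T"
        using T by (intro mult_right_mono) auto
      also have "\<dots> = (1 - e) * (1 - e) * (1 - 15 * e) * ((1 - 2 * e) * T)" by simp
      also have "\<dots> \<le> (1 - e) * (1 - e) * (1 - 15 * e) * Th"
        using Th e by (intro mult_left_mono mult_nonneg_nonneg) auto
      finally show "(1 - 20 * e) * T \<le> (1 - e) * (1 - e) * (1 - 15 * e) * Th" .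
    qed (use \<delta>0 in auto)
    also have "\<dots> = (1 - e) * ((1 - e) * ((1 - 15 * e) * (real N * G)))"
      using Th0 G by (simp add: \<delta>_def)
    also have "\<dots> \<le> (1 - e) * ((1 - e) * lo)" using lo2 e by (intro mult_left_mono) auto
    finally show "\<exists>i<m. N * mean_load n D (\<lambda>j c. c i * share m \<alpha> (\<lambda>k. (1 + e) ^ q k) c i) / \<delta>
      \<le> (1 - e) * ((1 - e) * lo)" using i by blast
  qed (use e in auto)
  also have "measure_pmf.prob R (- Feas) \<le> 1 / (4 * real m)"
  proof -
    have "measure_pmf.prob R (- Feas) \<le> m * exp (- (e\<^sup>2 * N * T / b))"
      unfolding R_def Feas_def V_def double_compl
      by (rule fluid_sample_tail[OF D _ b0 e(1) _ X T]) (use m e in auto)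
    also have "e\<^sup>2 * N * T / b = N * (1152 * ln m)"
    proof -
      have "e\<^sup>2 * N * T / b = N * (b * (1152 * ln m)) / b" unfolding b by simp
      then show ?thesis using b0 by simp
    qed
    also have "m * exp (- (N * (1152 * ln m))) \<le> m * exp (- (4 * ln m))"
    proof -
      have "1 * (4 * ln m) \<le> N * (1152 * ln m)" using N ln by (intro mult_mono) auto
      then show ?thesis by (intro mult_left_mono) auto
    qed
    also have "exp (- (4 * ln (real m))) = 1 / real m ^ 4"
    proof -
      have "exp (real 4 * ln (real m)) = real m ^ 4" using m by (subst exp_of_nat_mult) auto
      then show ?thesis by (simp add: exp_minus inverse_eq_divide)
    qed
    also have "m * (1 / real m ^ 4) \<le> 1 / (4 * real m)"
    proof -
      have "4 * real m * real m \<le> real m ^ 4"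
      proof -
        have "2 * 2 * (real m * real m) \<le> (real m * real m) * (real m * real m)"
          using m by (intro mult_mono) auto
        then show ?thesis by (simp add: power4_eq_xxxx mult_ac)
      qed
      then show ?thesis using m by (simp add: field_simps)
    qed
    finally show ?thesis by simp
  qed
  also have "(4 * real hi / real (hi - lo)) ^ m * (real m * (2 * exp (- ((e / 3)\<^sup>2 * lo / (4 * (b / \<delta>)))))) / e
      \<le> (8 / e) ^ m * (real m * (2 * exp (- (8 * (m * ln (m / e)))))) / e"
  proof (intro divide_right_mono mult_mono power_mono ratio order_refl exp_le_cancel_iff[THEN iffD2])
    \<comment> \<open>The origin of 1152 = 8 * 9 * 4 * 4: the factor 9 comes from
      \<open>(e / 3)\<^sup>2\<close>, one 4 from \<open>lo * \<delta> \<ge> N * T / 4\<close> and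
      one from \<open>ghost_deviation\<close>.\<close>
    have "8 * (m * ln (m / e)) * (4 * b) \<le> 8 * (N * ln m) * (4 * b)"
      using N b0 by (intro mult_right_mono mult_left_mono) auto
    also have "\<dots> = N * (b * (1152 * ln m)) / 36" by simp
    also have "\<dots> = e\<^sup>2 / 9 * (N * T / 4)" unfolding b by simp
    also have "\<dots> \<le> e\<^sup>2 / 9 * (lo * \<delta>)"
    proof (rule mult_left_mono)
      have "1 / 2 * (real N * G) \<le> (1 - 15 * e) * (real N * G)" using e by (intro mult_right_mono) auto
      then have 1: "real N * G / 2 \<le> lo" using lo2 by simp
      have "T / 2 \<le> (1 - 2 * e) * T" using e T by simp
      then have "T / 2 / G \<le> \<delta>" unfolding \<delta>_def using Th G by (intro divide_right_mono) auto
      from mult_mono[OF 1 this] show "N * T / 4 \<le> lo * \<delta>" using T G by simp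
    qed simp
    also have "\<dots> = (e / 3)\<^sup>2 * lo * \<delta>" by (simp add: power_divide)
    finally have "8 * (m * ln (m / e)) \<le> (e / 3)\<^sup>2 * lo * \<delta> / (4 * b)" using b0 by (simp add: pos_le_divide_eq)
    then show "- ((e / 3)\<^sup>2 * lo / (4 * (b / \<delta>))) \<le> - (8 * (m * ln (m / e)))" by simp
  qed (use e in auto)
  also have "(8 / e) ^ m * (real m * (2 * exp (- (8 * (m * ln (m / e)))))) / e \<le> 1 / (4 * real m)"
    by (rule union_bound_numeric[OF e m])
  finally show ?thesis using m by simp
qed

lemma small_items_bounded_columns:
  assumes pos: "positive_columns m n D" and small: "small_items m n D \<zeta>"
    and "0 < n" "0 < m" "0 < \<zeta>"
  shows "0 < expected_opt m n D" "bounded_columns m n D (expected_opt m n D / \<zeta>)"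
proof -
  obtain P where P: "P \<in> set_pmf (product_dist n D)" using set_pmf_not_empty by fastforce
  have entry: "0 < c i" if "j < n" "c \<in> set_pmf (D j)" "i < m" for c i j
    using pos that unfolding positive_columns_def by (force simp: PiE_iff)
  \<comment> \<open>One positive entry below \<open>T / \<zeta>\<close> already forces
    \<open>T > 0\<close>.\<close>
  have "0 < P 0 0" using entry[OF _ product_dist_column[OF P]] assms by simp
  also have "P 0 0 \<le> expected_opt m n D / \<zeta>" using small P assms unfolding small_items_def by blast
  finally show "0 < expected_opt m n D" using assms by (simp add: zero_less_divide_iff)
  show "bounded_columns m n D (expected_opt m n D / \<zeta>)"
    unfolding bounded_columns_def
  proof (intro allI impI ballI conjI)
    fix j c i assume *: "j < n" "c \<in> set_pmf (D j)" "i < m"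
    show "0 < c i" by (rule entry[OF *])
    have "P(j := c) \<in> set_pmf (product_dist n D)" by (rule product_dist_upd[OF P *(1,2)])
    then have "(P(j := c)) j i \<le> expected_opt m n D / \<zeta>" using small * unfolding small_items_def by blast
    then show "c i \<le> expected_opt m n D / \<zeta>" by simp
  qed
qed

lemma min_load_no_items: "0 < m \<Longrightarrow> min_load m 0 P X = 0"
  using min_load_attained[of m 0 P X] by (auto simp: load_def)

lemma expected_opt_no_items: "0 < m \<Longrightarrow> expected_opt m 0 D = 0"
proof -
  assume m: "0 < m"
  have "opt_snt m 0 P = 0" for P
    using opt_snt_attained[OF m, of 0 P] min_load_no_items[OF m] by metis
  then show ?thesis by (simp add: expected_opt_def)
qed

text \<open>Logarithmically many optima would do for the upper tail; \<open>m + 3\<close> keeps the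
  estimate simple through m < 2^m and still fits the sample budget, which is at least of order
  m.\<close>

lemma optimum_estimate_fails:
  fixes m n :: nat and e b T :: real
  assumes m: "2 \<le> m" and e: "0 < e" "e < 1" and n: "0 < n" and D: "bounded_columns m n D b"
    and b: "0 < b" "b * (1152 * ln m) = e\<^sup>2 * T" and T: "0 < T" "T = expected_opt m n D"
  shows "measure_pmf.prob (replicate_pmf (m + 3) (product_dist n D))
      {S. \<not> ((1 - 2 * e) * T \<le> Min (opt_snt m n ` set S) \<and> Min (opt_snt m n ` set S) \<le> (1 + 6 * e) * T)}
    \<le> 1 / (2 * real m)" (is "?p \<le> _")
proof -
  have m0: "0 < m" using m by simp
  obtain X :: "nat \<Rightarrow> column \<Rightarrow> nat \<Rightarrow> real" where
    X: "\<And>j c i. j < n \<Longrightarrow> i < m \<Longrightarrow> 0 \<le> X j c i \<and> X j c i \<le> 1"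
      "\<And>j c. j < n \<Longrightarrow> (\<Sum>i<m. X j c i) = 1"
      "\<And>i. i < m \<Longrightarrow> T \<le> mean_load n D (\<lambda>j c. c i * X j c i)"
    by (rule fluid_allocation[OF m0 D, folded T(2)]) (rule that)
  have "ln 2 \<le> ln (real m)" using m by simp
  then have ln: "2 / 3 \<le> ln (real m)" using ln2_ge_two_thirds by linarith
  have "ln (real m + 1) * b \<le> e\<^sup>2 * T"
  proof -
    have "real m + 1 \<le> real m * 2" using m by simp
    also have "\<dots> \<le> real m ^ 2" unfolding power2_eq_square using m by (intro mult_left_mono) auto
    finally have "ln (real m + 1) \<le> ln (real m ^ 2)" using m by (subst ln_le_cancel_iff) auto
    also have "\<dots> = 2 * ln (real m)" using m by (simp add: ln_realpow)
    also have "\<dots> \<le> 1152 * ln (real m)" using ln by simp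
    finally have "b * ln (real m + 1) \<le> b * (1152 * ln (real m))"
      using b(1) by (intro mult_left_mono) auto
    then show ?thesis unfolding b(2) by (simp only: mult.commute)
  qed
  then have "?p \<le> (m + 3) * (m * exp (- (e\<^sup>2 * T / b))) + (1 / 2) ^ (m + 3)"
    using opt_estimate[OF D m0 b(1) e X T, of "m + 3"] by simp
  also have "e\<^sup>2 * T / b = 1152 * ln m" using b by (simp flip: b(2))
  also have "(m + 3) * (m * exp (- (1152 * ln (real m)))) \<le> 1 / (4 * real m)"
  proof -
    have "exp (- (1152 * ln (real m))) \<le> exp (- (real 8 * ln (real m)))" using ln by simp
    also have "\<dots> = 1 / real m ^ 8"
      unfolding exp_minus by (subst exp_of_nat_mult) (use m in \<open>simp add: inverse_eq_divide\<close>)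
    finally have "(m + 3) * (m * exp (- (1152 * ln (real m)))) \<le> (m + 3) * (m * (1 / real m ^ 8))"
      by (intro mult_left_mono) auto
    also have "\<dots> \<le> 1 / (4 * real m)"
    proof -
      have "4 * (real m + 3) * real m * real m \<le> 4 * (3 * real m) * real m * real m"
        using m by (intro mult_right_mono mult_left_mono) auto
      also have "\<dots> \<le> 2 ^ 5 * real m ^ 3" by (simp add: power3_eq_cube)
      also have "\<dots> \<le> real m ^ 5 * real m ^ 3" using m by (intro mult_right_mono power_mono) auto
      also have "\<dots> = real m ^ 8" by (simp flip: power_add)
      finally show ?thesis using m by (simp add: field_simps)
    qed
    finally show ?thesis .
  qed
  also have "(1 / 2) ^ (m + 3) \<le> 1 / (4 * real m)"
  proof -
    have "real m < 2 ^ m" by (rule of_nat_less_two_power)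
    moreover have "(2::real) ^ (m + 3) = 8 * 2 ^ m" by (simp add: power_add)
    ultimately have "4 * real m \<le> 2 ^ (m + 3)" by linarith
    then show ?thesis using m by (simp add: power_one_over frac_le)
  qed
  finally show ?thesis by simp
qed

text \<open>The scale \<delta> is taken from separate samples, so that it is a constant once these
  are fixed and the levels in the other samples can be analysed for a given \<delta>. The parameters
  are functions of \<open>n\<close>, since only the exponent and the sample count must be chosen
  before \<open>n\<close> is known.\<close>

definition load_learner ::
  "nat \<Rightarrow> real \<Rightarrow> real \<Rightarrow> (nat \<Rightarrow> nat) \<Rightarrow> (nat \<Rightarrow> nat) \<Rightarrow>
   (nat \<Rightarrow> nat) \<Rightarrow> (nat \<Rightarrow> nat) \<Rightarrow> learner" where
  "load_learner m e \<alpha> G lo hi K n Ps =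
    (let \<delta> = Min (opt_snt m n ` set (take (m + 3) Ps)) / G n; S = drop (m + 3) Ps
     in map_pmf (\<lambda>q k. (1 + e) ^ q k)
       (map_pmf (least_solution m (K n) (\<lambda>i. level n (item_level m \<alpha> (1 + e) \<delta> i) S))
         (pmf_of_set ({..<m} \<rightarrow>\<^sub>E {lo n<..hi n}))))"

theorem theorem6p1:
  shows "\<exists>C1>0::real. \<exists>C2>0::real. \<exists>C3>0::real.
    \<forall>m\<ge>2::nat. \<forall>\<epsilon>\<in>{0<..<1::real}.
      \<exists>(\<alpha>::real) (N::nat) (A::learner).
        real N \<le> C2 * (real m / ln (real m)) * ln (real m / \<epsilon>) \<and>
        (\<forall>(n::nat) (D :: nat \<Rightarrow> column pmf).
           positive_columns m n D \<longrightarrow>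
           small_items m n D (C1 * ln (real m) / \<epsilon>\<^sup>2) \<longrightarrow>
           measure_pmf.prob (learner_output n D N A)
             {w. (\<forall>i<m. w i > 0) \<and>
                 measure_pmf.expectation (product_dist n D)
                   (\<lambda>P. min_load m n P (prop_alloc m \<alpha> w P))
                 \<ge> (1 - C3 * \<epsilon>) * expected_opt m n D}
           \<ge> 1 - 1 / real m)"
proof (rule exI[of _ 1152], rule conjI, simp, rule exI[of _ 4], rule conjI, simp,
    rule exI[of _ 100], rule conjI, simp, intro allI impI ballI)
  fix m :: nat and e :: real
  assume m: "2 \<le> m" and "e \<in> {0<..<1}"
  then have e: "0 < e" "e < 1" by auto
  have m0: "0 < m" using m by simp
  have "ln 2 \<le> ln (real m)" using m by simp
  then have ln: "2 / 3 \<le> ln (real m)" using ln2_ge_two_thirds by linarith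
  \<comment> \<open>As \<open>x \<ge> m \<ge> 2\<close>, the \<open>m + 3\<close> samples for the
    scale and the rounding up of \<open>N\<close> fit into \<open>4 * x\<close>.\<close>
  define x where "x = real m / ln (real m) * ln (real m / e)"
  define N where "N = nat \<lceil>x\<rceil>"
  define \<alpha> where "\<alpha> = m / e"
  have xm: "real m \<le> x"
  proof -
    have "real m \<le> real m / e" using e by (simp add: pos_le_divide_eq mult_left_le)
    then have "ln (real m) \<le> ln (real m / e)" using m0 by (intro ln_mono) auto
    then have "real m / ln (real m) * ln (real m) \<le> x"
      unfolding x_def using ln by (intro mult_left_mono) auto
    then show ?thesis using ln by simp
  qed
  have N: "x \<le> real N" "real N \<le> x + 1" using xm unfolding N_def by linarith+
  have N0: "0 < N" using N xm m by linarith
  have "m * ln (m / e) = x * ln m" using ln by (simp add: x_def)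
  also have "\<dots> \<le> N * ln m" using N ln by (intro mult_right_mono) auto
  finally have Nln: "m * ln (m / e) \<le> N * ln m" .
  \<comment> \<open>The guard keeps the choice total in \<open>n\<close>: the learner is one
    function for all \<open>n\<close>, although the parameters matter only for \<open>n > 0\<close>
    and small \<open>e\<close>.\<close>
  have "\<forall>n. \<exists>G hi lo K. 0 < n \<and> e < 1 / 100 \<longrightarrow> 0 < G \<and> 2 * real n \<le> e * real G \<and> 0 < lo \<and> lo < hi \<and>
    real hi \<le> (1 - 13 * e) * (real N * real G) \<and> (1 - 15 * e) * (real N * real G) \<le> real lo \<and>
    4 * real hi / real (hi - lo) \<le> 8 / e \<and> 0 < K \<and> real m * real n / e < (1 + e) powr (real K / \<alpha>)"
  proof
    fix n :: nat
    have "0 < \<alpha>" using m0 e by (simp add: \<alpha>_def)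
    obtain K where K: "0 < K" "real m * real n / e < (1 + e) powr (real K / \<alpha>)"
      using price_bound_exists[OF e(1) \<open>0 < \<alpha>\<close>] by blast
    show "\<exists>G hi lo K. 0 < n \<and> e < 1 / 100 \<longrightarrow> 0 < G \<and> 2 * real n \<le> e * real G \<and> 0 < lo \<and> lo < hi \<and>
    real hi \<le> (1 - 13 * e) * (real N * real G) \<and> (1 - 15 * e) * (real N * real G) \<le> real lo \<and>
    4 * real hi / real (hi - lo) \<le> 8 / e \<and> 0 < K \<and> real m * real n / e < (1 + e) powr (real K / \<alpha>)"
    proof (cases "0 < n \<and> e < 1 / 100")
      case True
      then obtain G hi lo :: nat where "0 < G \<and> 2 * real n \<le> e * real G \<and> 0 < lo \<and> lo < hi \<and>
          real hi \<le> (1 - 13 * e) * (real N * real G) \<and> (1 - 15 * e) * (real N * real G) \<le> real lo \<and>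
          4 * real hi / real (hi - lo) \<le> 8 / e"
        using rounding_parameters[OF e(1) _ N0, of n] by (auto simp del: of_nat_diff)
      with K show ?thesis by (intro exI[of _ G] exI[of _ hi] exI[of _ lo] exI[of _ K]) blast
    qed blast
  qed
  then obtain G hi lo K :: "nat \<Rightarrow> nat" where par: "\<And>n. 0 < n \<Longrightarrow> e < 1 / 100 \<Longrightarrow>
    0 < G n \<and> 2 * real n \<le> e * real (G n) \<and> 0 < lo n \<and> lo n < hi n \<and>
    real (hi n) \<le> (1 - 13 * e) * (real N * real (G n)) \<and> (1 - 15 * e) * (real N * real (G n)) \<le> real (lo n) \<and>
    4 * real (hi n) / real (hi n - lo n) \<le> 8 / e \<and> 0 < K n \<and>
    real m * real n / e < (1 + e) powr (real (K n) / \<alpha>)"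
    by metis
  define A where "A = load_learner m e \<alpha> G lo hi K"
  have count: "real (m + 3 + N) \<le> 4 * (real m / ln (real m)) * ln (real m / e)"
  proof -
    have "real (m + 3 + N) \<le> 4 * x" using N xm m by simp
    then show ?thesis by (simp only: x_def mult.assoc)
  qed
  have main: "1 - 1 / real m \<le> measure_pmf.prob (learner_output n D (m + 3 + N) A)
             {w. (\<forall>i<m. 0 < w i) \<and> (1 - 100 * e) * expected_opt m n D
               \<le> measure_pmf.expectation (product_dist n D) (\<lambda>P. min_load m n P (prop_alloc m \<alpha> w P))}"
    (is "_ \<le> measure_pmf.prob _ ?Good")
    if pos: "positive_columns m n D" and small: "small_items m n D (1152 * ln (real m) / e\<^sup>2)" for n D
  proof -
    define T where "T = expected_opt m n D"
    have wpos: "0 < w i" if "w \<in> set_pmf (learner_output n D (m + 3 + N) A)" for w i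
      using that e by (auto simp: learner_output_def A_def load_learner_def Let_def)
    have \<zeta>: "0 < 1152 * ln (real m) / e\<^sup>2" using ln e by simp
    define b where "b = T / (1152 * ln (real m) / e\<^sup>2)"
    have b: "b * (1152 * ln (real m)) = e\<^sup>2 * T" using ln e by (simp add: b_def)
    show ?thesis
    proof (cases "0 < n")
      case False
      then have "UNIV \<inter> set_pmf (learner_output n D (m + 3 + N) A) \<subseteq> ?Good"
        using wpos m0 by (auto simp: expected_opt_no_items min_load_no_items)
      then have "measure_pmf.prob (learner_output n D (m + 3 + N) A) UNIV
          \<le> measure_pmf.prob (learner_output n D (m + 3 + N) A) ?Good"
        by (intro prob_pmf_mono) blast
      then show ?thesis by (simp add: order_trans[of _ 1])
    next
      case n: True
      have T: "0 < T" "bounded_columns m n D b"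
        using small_items_bounded_columns[OF pos small n m0 \<zeta>] by (auto simp: T_def b_def)
      have b0: "0 < b" unfolding b_def using T(1) \<zeta> by (rule divide_pos_pos)
      show ?thesis
      proof (cases "e < 1 / 100")
        case False
        \<comment> \<open>For \<open>e \<ge> 1 / 100\<close> the factor \<open>1 - 100 * e\<close>
          is not positive, so any positive weights satisfy the bound.\<close>
        have "w \<in> ?Good" if w: "w \<in> set_pmf (learner_output n D (m + 3 + N) A)" for w
        proof -
          have "(1 - 100 * e) * expected_opt m n D \<le> 0"
            using False T(1) by (intro mult_nonpos_nonneg) (auto simp: T_def)
          also have "0 \<le> measure_pmf.expectation (product_dist n D) (\<lambda>P. min_load m n P (prop_alloc m \<alpha> w P))"
            using wpos[OF w] by (intro expected_min_load_nonneg[OF T(2) m0]) (auto intro: less_imp_le)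
          finally show ?thesis using wpos[OF w] by simp
        qed
        then have "measure_pmf.prob (learner_output n D (m + 3 + N) A) UNIV
            \<le> measure_pmf.prob (learner_output n D (m + 3 + N) A) ?Good"
          by (intro prob_pmf_mono) blast
        then show ?thesis by (simp add: order_trans[of _ 1])
      next
        case e2: True
        let ?p = "product_dist n D"
        let ?low = "{q :: nat \<Rightarrow> nat. \<exists>i<m. mean_load n D (\<lambda>j c. c i * share m \<alpha> (\<lambda>k. (1 + e) ^ q k) c i) < (1 - 20 * e) * T}"
        let ?E = "{S. \<not> ((1 - 2 * e) * T \<le> Min (opt_snt m n ` set S) \<and> Min (opt_snt m n ` set S) \<le> (1 + 6 * e) * T)}"
        have good: "(\<lambda>k. (1 + e) ^ q k) \<in> ?Good" if q: "q \<notin> ?low" for q :: "nat \<Rightarrow> nat"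
        proof -
          let ?w = "\<lambda>k. (1 + e) ^ q k"
          have w: "0 < ?w k" for k using e by simp
          \<comment> \<open>With \<open>l = e / b\<close> the relative loss is \<open>e\<close>, and
            by the small items assumption the logarithmic term is
            \<open>e * T / 1152\<close>.\<close>
          have "(1 - e / b * b) * ((1 - 20 * e) * T) - ln (real m) / (e / b)
            \<le> measure_pmf.expectation ?p (\<lambda>P. min_load m n P (prop_alloc m \<alpha> ?w P))"
          proof (rule expected_min_load[OF T(2) m0])
            fix i assume i: "i < m"
            show "(1 - 20 * e) * T \<le> mean_load n D (\<lambda>j c. c i * share m \<alpha> ?w c i)"
            proof (rule ccontr)
              assume "\<not> ?thesis"
              then have "q \<in> ?low" using i by (intro CollectI exI[of _ i]) (simp only: not_le)
              with q show False by contradiction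
            qed
          qed (use b0 e in auto)
          moreover have "(1 - 100 * e) * T \<le> (1 - e / b * b) * ((1 - 20 * e) * T) - ln (real m) / (e / b)"
          proof -
            have "ln (real m) / (e / b) = (b * (1152 * ln (real m))) / (1152 * e)" using b0 e by simp
            also have "\<dots> = e * T / 1152" unfolding b using e by (simp add: power2_eq_square)
            finally have 1: "ln (real m) / (e / b) = e * T / 1152" .
            have "0 \<le> e * T" "0 \<le> e * e * T" using e T by auto
            then show ?thesis unfolding 1 using b0 by (simp add: algebra_simps)
          qed
          ultimately show ?thesis using w by (simp add: T_def)
        qed
        \<comment> \<open>The sample is split so as to condition on the first \<open>m + 3\<close>
          instances: a wrong scale and a bad random solution each receive half of the failure
          probability 1 / m.\<close>
        have "measure_pmf.prob (learner_output n D (m + 3 + N) A) (- ?Good)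
          = measure_pmf.prob (bind_pmf (replicate_pmf (m + 3) ?p)
              (\<lambda>xs. bind_pmf (replicate_pmf N ?p) (\<lambda>ys. A n (xs @ ys)))) (- ?Good)"
          unfolding learner_output_def replicate_pmf_distrib by (simp add: bind_assoc_pmf bind_return_pmf)
        also have "\<dots> \<le> measure_pmf.prob (replicate_pmf (m + 3) ?p) ?E + 1 / (2 * real m)"
        proof (rule prob_bind_pmf_le)
          fix xs assume xs: "xs \<in> set_pmf (replicate_pmf (m + 3) ?p)" "xs \<notin> ?E"
          define Th where "Th = Min (opt_snt m n ` set xs)"
          have Th: "(1 - 2 * e) * T \<le> Th" "Th \<le> (1 + 6 * e) * T" using xs(2) by (auto simp: Th_def)
          have len: "length xs = m + 3" using xs(1) by (simp add: set_replicate_pmf)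
          let ?Q = "bind_pmf (replicate_pmf N ?p) (\<lambda>S. map_pmf
            (least_solution m (K n) (\<lambda>i. level n (item_level m \<alpha> (1 + e) (Th / G n) i) S))
            (pmf_of_set ({..<m} \<rightarrow>\<^sub>E {lo n<..hi n})))"
          have "bind_pmf (replicate_pmf N ?p) (\<lambda>ys. A n (xs @ ys)) = map_pmf (\<lambda>q k. (1 + e) ^ q k) ?Q"
            using len by (simp add: A_def load_learner_def Let_def Th_def map_bind_pmf)
          then have "measure_pmf.prob (bind_pmf (replicate_pmf N ?p) (\<lambda>ys. A n (xs @ ys))) (- ?Good)
              = measure_pmf.prob ?Q ((\<lambda>q k. (1 + e) ^ q k) -` (- ?Good))" by simp
          also have "\<dots> \<le> measure_pmf.prob ?Q ?low"
            using good by (intro prob_pmf_mono) blast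
          also have "\<dots> \<le> 1 / (2 * real m)"
            unfolding \<alpha>_def
            using par[OF n e2, unfolded \<alpha>_def]
            by (intro random_solution_mean_load[OF m e(1) e2 n T(2) b T(1) T_def Th Nln N0]) auto
          finally show "measure_pmf.prob (bind_pmf (replicate_pmf N ?p) (\<lambda>ys. A n (xs @ ys))) (- ?Good)
              \<le> 1 / (2 * real m)" .
        qed simp
        also have "measure_pmf.prob (replicate_pmf (m + 3) ?p) ?E \<le> 1 / (2 * real m)"
          by (rule optimum_estimate_fails[OF m e n T(2) b0 b T(1) T_def])
        finally have "measure_pmf.prob (learner_output n D (m + 3 + N) A) (- ?Good) \<le> 1 / real m"
          by (simp add: field_simps)
        moreover have "measure_pmf.prob (learner_output n D (m + 3 + N) A) (- ?Good)
            = 1 - measure_pmf.prob (learner_output n D (m + 3 + N) A) ?Good"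
          by (subst measure_pmf.prob_compl[symmetric]) (auto simp: Compl_eq_Diff_UNIV)
        ultimately show ?thesis by simp
      qed
    qed
  qed
  show "\<exists>(\<alpha>::real) (N::nat) (A::learner).
        real N \<le> 4 * (real m / ln (real m)) * ln (real m / e) \<and>
        (\<forall>(n::nat) (D :: nat \<Rightarrow> column pmf).
           positive_columns m n D \<longrightarrow>
           small_items m n D (1152 * ln (real m) / e\<^sup>2) \<longrightarrow>
           measure_pmf.prob (learner_output n D N A)
             {w. (\<forall>i<m. w i > 0) \<and>
                 measure_pmf.expectation (product_dist n D)
                   (\<lambda>P. min_load m n P (prop_alloc m \<alpha> w P))
                 \<ge> (1 - 100 * e) * expected_opt m n D}
           \<ge> 1 - 1 / real m)"
    by (rule exI[of _ \<alpha>], rule exI[of _ "m + 3 + N"], rule exI[of _ A]) (use count main in blast)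
qed

end
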